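(* Let $n, M\in\mathbb{Z}_{\geq 1}$. For every $\gamma\in\Gamma_{M,n}$ the coefficients $C_{M,n}(\gamma)$, $C_{\mathrm{B},M,n}(\gamma)$, $C_{\mathrm{scS},M,n}(\gamma)$ satisfy \[ 1\le \frac{C_{M,n}(\gamma)}{C_{\mathrm{B},M,n}(\gamma)}\le \bigl(2^{n/2}\bigr)^{M-1}, \qquad \Bigl(\frac{M^M}{M!}\Bigr)^{n}\Bigl(\frac{n!}{n^n}\Bigr)^{M-1}\le \frac{C_{M,n}(\gamma)}{C_{\mathrm{scS},M,n}(\gamma)}\le \Bigl(\frac{M^M}{M!}\Bigr)^{n}. \]
   Context: $[n]=\{1,\dots,n\}$; $\mathcal{S}_{[n]}$ is the set of permutations of $[n]$; for $\sigma\in\mathcal{S}_{[n]}$, $P_\sigma$ is the $n\times n$ matrix with $P_\sigma(i,j)=1$ if $\sigma(i)=j$ and $0$ otherwise. $\Gamma_{M,n}$ is the set of $n\times n$ doubly stochastic matrices all of whose entries are integer multiples of $1/M$. For $\gamma\in\Gamma_{M,n}$: $C_{M,n}(\gamma)$ is the number of tuples $(\sigma_1,\dots,\sigma_M)\in\mathcal{S}_{[n]}^M$ with $\gamma=\frac1M\sum_{m=1}^M P_{\sigma_m}$; $C_{\mathrm{B},M,n}(\gamma)=(M!)^{2n-n^2}\prod_{i,j\in[n]}\frac{(M-M\gamma(i,j))!}{(M\gamma(i,j))!}$; $C_{\mathrm{scS},M,n}(\gamma)=M^{-nM}\frac{(M!)^{2n}}{\prod_{i,j\in[n]}(M\gamma(i,j))!}$.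 *)

theory Defs
  imports Complex_Main "HOL-Library.FuncSet" "HOL-Combinatorics.Permutations"
begin

text \<open>An \<open>n \<times> n\<close> matrix is a function \<open>nat \<Rightarrow> nat \<Rightarrow> real\<close> whose entries are its values
  on \<open>{1..n} \<times> {1..n}\<close>. Values outside this range are unconstrained and never used.\<close>

definition perm_matrix :: "(nat \<Rightarrow> nat) \<Rightarrow> nat \<Rightarrow> nat \<Rightarrow> real" where
  "perm_matrix \<sigma> i j = (if \<sigma> i = j then 1 else 0)"

definition doubly_stochastic :: "nat \<Rightarrow> (nat \<Rightarrow> nat \<Rightarrow> real) \<Rightarrow> bool" where
  "doubly_stochastic n \<gamma> \<longleftrightarrow>
     (\<forall>i\<in>{1..n}. \<forall>j\<in>{1..n}. 0 \<le> \<gamma> i j) \<and>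
     (\<forall>i\<in>{1..n}. (\<Sum>j\<in>{1..n}. \<gamma> i j) = 1) \<and>
     (\<forall>j\<in>{1..n}. (\<Sum>i\<in>{1..n}. \<gamma> i j) = 1)"

definition Gamma_set :: "nat \<Rightarrow> nat \<Rightarrow> (nat \<Rightarrow> nat \<Rightarrow> real) set" where
  "Gamma_set M n = {\<gamma>. doubly_stochastic n \<gamma> \<and>
     (\<forall>i\<in>{1..n}. \<forall>j\<in>{1..n}. \<exists>k::int. \<gamma> i j = of_int k * (1 / real M))}"

text \<open>Tuples \<open>(\<sigma>\<^sub>1, \<dots>, \<sigma>\<^sub>M)\<close> are extensional functions on \<open>{1..M}\<close>, so that each one is counted once.\<close>

definition C_coeff :: "nat \<Rightarrow> nat \<Rightarrow> (nat \<Rightarrow> nat \<Rightarrow> real) \<Rightarrow> nat" where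
  "C_coeff M n \<gamma> = card {s \<in> {1..M} \<rightarrow>\<^sub>E {\<sigma>. \<sigma> permutes {1..n}}.
     \<forall>i\<in>{1..n}. \<forall>j\<in>{1..n}. \<gamma> i j = 1 / real M * (\<Sum>m\<in>{1..M}. perm_matrix (s m) i j)}"

text \<open>For \<open>\<gamma> \<in> Gamma_set M n\<close> and \<open>M \<ge> 1\<close>, the arguments of \<open>floor\<close> below are nonnegative integers,
  so \<open>nat\<close> and \<open>floor\<close> only change the type.\<close>

definition C_Bethe :: "nat \<Rightarrow> nat \<Rightarrow> (nat \<Rightarrow> nat \<Rightarrow> real) \<Rightarrow> real" where
  "C_Bethe M n \<gamma> = (fact M) powi (2 * int n - (int n)\<^sup>2) *
     (\<Prod>i\<in>{1..n}. \<Prod>j\<in>{1..n}.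
        fact (nat \<lfloor>real M - real M * \<gamma> i j\<rfloor>) / fact (nat \<lfloor>real M * \<gamma> i j\<rfloor>))"

definition C_scSinkhorn :: "nat \<Rightarrow> nat \<Rightarrow> (nat \<Rightarrow> nat \<Rightarrow> real) \<Rightarrow> real" where
  "C_scSinkhorn M n \<gamma> = real M powi (- (int n * int M)) *
     ((fact M) ^ (2 * n) / (\<Prod>i\<in>{1..n}. \<Prod>j\<in>{1..n}. fact (nat \<lfloor>real M * \<gamma> i j\<rfloor>)))"

end

theory Submission
  imports Defs "HOL-Analysis.Analysis" "HOL-Real_Asymp.Real_Asymp"
    "HOL-Computational_Algebra.Fundamental_Theorem_Algebra"
begin

text \<open>
  Removing one permutation \<open>\<sigma>\<close> from a decomposition of \<open>K = M \<gamma>\<close> gives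
  \<open>C\<^sub>M(K) = (\<Sum>\<sigma>. C\<^bsub>M - 1\<^esub>(K - P\<^sub>\<sigma>))\<close>, and the closed formulas change by
  explicit factors under \<open>K \<mapsto> K - P\<^sub>\<sigma>\<close>. By induction on \<open>M\<close> the four bounds
  reduce to facts about a doubly stochastic matrix \<open>\<gamma>\<close>: Schrijver's inequality
  \<open>per(\<gamma> (1 - \<gamma>)) \<ge> \<Prod>(1 - \<gamma>)\<close> for the lower Bethe bound, van der Waerden's
  inequality \<open>per \<gamma> \<ge> n! / n\<^sup>n\<close> for the lower Sinkhorn bound, and
  \<open>per \<gamma> \<le> 1\<close> for the upper one. The upper Bethe bound is an entropy estimate in the style
  of Bregman and of Anari and Rezaei: in a uniformly random decomposition each permutation has
  marginals \<open>\<gamma>\<close>, and a distribution on permutations with marginals \<open>\<gamma>\<close> has entropy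
  at most its Bethe entropy plus \<open>(n / 2) ln 2\<close>.
\<close>

text \<open>Schrijver's inequality is reached without stability theory. Giving every edge its own
  row variable and its own column variable makes the matching polynomial affine in each of them, so
  an edge is switched on by a statement about a + b y + c z + d y z alone, and the only input about
  matchings is b c <= a d. Van der Waerden's inequality removes one variable at a time from a
  product of linear forms; its estimate rests on real-rootedness, hence the detour through complex
  half-planes.

  The upper Bethe bound is the delicate one. A route through the permanent of \<gamma> (1 -
  \<gamma>) alone would involve the maximum of the Bethe functional over all doubly stochastic
  matrices. The random decomposition has marginals exactly \<gamma>, so the functional is evaluated
  at \<gamma> only. What remains is an inequality for one row at a time; equality for the row (1/2,
  1/2) is the source of the factor 2^(1/2) per row. The exponent M - 1 reflects that a single
  permutation is counted exactly: one of the M removals is free.\<close>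

section \<open>Matching polynomials\<close>

text \<open>
  \<open>mpol w u v is J\<close> is the sum over all matchings between the rows \<open>is\<close> and the columns
  \<open>J\<close> of the product of the edge weights \<open>w\<close> and of the weights \<open>u\<close>, \<open>v\<close> of
  the unmatched rows and columns.
\<close>

fun mpol :: "('a \<Rightarrow> 'b \<Rightarrow> real) \<Rightarrow> ('a \<Rightarrow> real) \<Rightarrow> ('b \<Rightarrow> real) \<Rightarrow> 'a list \<Rightarrow> 'b set \<Rightarrow> real" where
  "mpol w u v [] J = (\<Prod>j\<in>J. v j)"
| "mpol w u v (i # is) J = u i * mpol w u v is J + (\<Sum>k\<in>J. w i k * mpol w u v is (J - {k}))"

lemma mpol_cong:
  assumes "\<And>i j. i \<in> set is \<Longrightarrow> j \<in> J \<Longrightarrow> w i j = w' i j"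
    and "\<And>i. i \<in> set is \<Longrightarrow> u i = u' i" and "\<And>j. j \<in> J \<Longrightarrow> v j = v' j"
  shows "mpol w u v is J = mpol w' u' v' is J"
  using assms
proof (induction "is" arbitrary: J)
  case (Cons i "is")
  have "mpol w u v is (J - {k}) = mpol w' u' v' is (J - {k})" for k
    by (rule Cons.IH) (use Cons.prems in auto)
  moreover have "mpol w u v is J = mpol w' u' v' is J"
    by (rule Cons.IH) (use Cons.prems in auto)
  ultimately show ?case using Cons.prems by simp
qed simp

lemma mpol_nonneg:
  assumes "\<And>i j. i \<in> set is \<Longrightarrow> j \<in> J \<Longrightarrow> 0 \<le> w i j"
    and "\<And>i. i \<in> set is \<Longrightarrow> 0 \<le> u i" and "\<And>j. j \<in> J \<Longrightarrow> 0 \<le> v j"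
  shows "0 \<le> mpol w u v is J"
  using assms
proof (induction "is" arbitrary: J)
  case (Cons i "is")
  have "0 \<le> mpol w u v is (J - {k})" for k
    by (rule Cons.IH) (use Cons.prems in auto)
  moreover have "0 \<le> mpol w u v is J"
    by (rule Cons.IH) (use Cons.prems in auto)
  ultimately show ?case using Cons.prems by (auto intro!: add_nonneg_nonneg sum_nonneg)
qed (auto intro: prod_nonneg)

lemma sum_swap_distinct:
  fixes f :: "'b \<Rightarrow> 'b \<Rightarrow> real"
  assumes "finite J"
  shows "(\<Sum>k\<in>J. \<Sum>l\<in>J - {k}. f k l) = (\<Sum>l\<in>J. \<Sum>k\<in>J - {l}. f k l)"
proof -
  have "(\<Sum>k\<in>J. \<Sum>l\<in>J - {k}. f k l) = (\<Sum>k\<in>J. \<Sum>l\<in>J. if l \<noteq> k then f k l else 0)"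
    using assms by (intro sum.cong refl sum.mono_neutral_cong_left) auto
  also have "\<dots> = (\<Sum>l\<in>J. \<Sum>k\<in>J. if l \<noteq> k then f k l else 0)"
    by (rule sum.swap)
  also have "\<dots> = (\<Sum>l\<in>J. \<Sum>k\<in>J - {l}. f k l)"
    using assms by (intro sum.cong refl sum.mono_neutral_cong_right) auto
  finally show ?thesis .
qed

text \<open>Exchanging row \<open>i\<close> with the head of the list, by a double sum over ordered
  pairs of distinct columns, shows that the order of the list is immaterial.\<close>

lemma mpol_row_expand:
  assumes "finite J" "i \<in> set is" "distinct is"
  shows "mpol w u v is J = u i * mpol w u v (remove1 i is) J
    + (\<Sum>k\<in>J. w i k * mpol w u v (remove1 i is) (J - {k}))"
  using assms
proof (induction "is" arbitrary: J)
  case (Cons a "is")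
  show ?case
  proof (cases "a = i")
    case False
    let ?m = "mpol w u v"
    let ?r = "remove1 i is"
    have i: "i \<in> set is" using Cons.prems False by simp
    have IH: "?m is J' = u i * ?m ?r J' + (\<Sum>k\<in>J'. w i k * ?m ?r (J' - {k}))" if "finite J'" for J'
      using Cons.IH[OF that i] Cons.prems by simp
    have "?m (a # is) J = u a * ?m is J + (\<Sum>l\<in>J. w a l * ?m is (J - {l}))" by simp
    also have "\<dots> = u a * (u i * ?m ?r J + (\<Sum>k\<in>J. w i k * ?m ?r (J - {k})))
      + (\<Sum>l\<in>J. w a l * (u i * ?m ?r (J - {l}) + (\<Sum>k\<in>J - {l}. w i k * ?m ?r (J - {l} - {k}))))"
      using Cons.prems by (simp add: IH)
    also have "\<dots> = u a * (u i * ?m ?r J) + (\<Sum>k\<in>J. u a * (w i k * ?m ?r (J - {k})))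
      + (\<Sum>l\<in>J. u i * (w a l * ?m ?r (J - {l})))
      + (\<Sum>l\<in>J. \<Sum>k\<in>J - {l}. w a l * w i k * ?m ?r (J - {l} - {k}))"
      by (simp add: algebra_simps sum.distrib sum_distrib_left)
    also have "(\<Sum>l\<in>J. \<Sum>k\<in>J - {l}. w a l * w i k * ?m ?r (J - {l} - {k}))
      = (\<Sum>k\<in>J. \<Sum>l\<in>J - {k}. w a l * w i k * ?m ?r (J - {l} - {k}))"
      using Cons.prems by (intro sum_swap_distinct) auto
    also have "\<dots> = (\<Sum>k\<in>J. \<Sum>l\<in>J - {k}. w a l * w i k * ?m ?r (J - {k} - {l}))"
      by (intro sum.cong refl) (simp add: Diff_insert2[symmetric] insert_commute)
    also have "u a * (u i * ?m ?r J) + (\<Sum>k\<in>J. u a * (w i k * ?m ?r (J - {k})))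
      + (\<Sum>l\<in>J. u i * (w a l * ?m ?r (J - {l})))
      + (\<Sum>k\<in>J. \<Sum>l\<in>J - {k}. w a l * w i k * ?m ?r (J - {k} - {l}))
      = u i * ?m (a # ?r) J + (\<Sum>k\<in>J. w i k * ?m (a # ?r) (J - {k}))"
      by (simp add: algebra_simps sum.distrib sum_distrib_left)
    finally show ?thesis using False by simp
  qed simp
qed simp

text \<open>Restores the symmetry between rows and columns that the recursion along the rows
  hides.\<close>

lemma mpol_col_expand:
  assumes "finite J" "j \<in> J" "distinct is"
  shows "mpol w u v is J = v j * mpol w u v is (J - {j})
    + (\<Sum>l\<in>set is. w l j * mpol w u v (remove1 l is) (J - {j}))"
  using assms
proof (induction "is" arbitrary: J)
  case Nil
  then show ?case by (simp add: prod.remove)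
next
  case (Cons a "is")
  let ?m = "mpol w u v"
  have IH: "?m is J' = v j * ?m is (J' - {j}) + (\<Sum>l\<in>set is. w l j * ?m (remove1 l is) (J' - {j}))"
    if "finite J'" "j \<in> J'" for J'
    using Cons.IH[OF that] Cons.prems by simp
  have a: "a \<notin> set is" using Cons.prems by simp
  have rem: "remove1 l (a # is) = a # remove1 l is" if "l \<in> set is" for l using that a by auto
  have "?m (a # is) J = u a * ?m is J + w a j * ?m is (J - {j})
      + (\<Sum>k\<in>J - {j}. w a k * ?m is (J - {k}))"
    using Cons.prems by (simp add: sum.remove)
  also have "?m is J = v j * ?m is (J - {j}) + (\<Sum>l\<in>set is. w l j * ?m (remove1 l is) (J - {j}))"
    using IH Cons.prems by blast
  also have "(\<Sum>k\<in>J - {j}. w a k * ?m is (J - {k})) = (\<Sum>k\<in>J - {j}. w a k *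
     (v j * ?m is (J - {j} - {k}) + (\<Sum>l\<in>set is. w l j * ?m (remove1 l is) (J - {j} - {k}))))"
  proof (intro sum.cong refl)
    fix k assume k: "k \<in> J - {j}"
    have "J - {k} - {j} = J - {j} - {k}" "j \<in> J - {k}" using Cons.prems k by auto
    then show "w a k * ?m is (J - {k}) = w a k *
     (v j * ?m is (J - {j} - {k}) + (\<Sum>l\<in>set is. w l j * ?m (remove1 l is) (J - {j} - {k})))"
      using IH[of "J - {k}"] Cons.prems k by simp
  qed
  also have "\<dots> = (\<Sum>k\<in>J - {j}. v j * (w a k * ?m is (J - {j} - {k})))
     + (\<Sum>l\<in>set is. \<Sum>k\<in>J - {j}. w l j * (w a k * ?m (remove1 l is) (J - {j} - {k})))"
    by (subst sum.swap, simp add: algebra_simps sum.distrib sum_distrib_left)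
  also have "u a * (v j * ?m is (J - {j}) + (\<Sum>l\<in>set is. w l j * ?m (remove1 l is) (J - {j})))
     + w a j * ?m is (J - {j}) + ((\<Sum>k\<in>J - {j}. v j * (w a k * ?m is (J - {j} - {k})))
     + (\<Sum>l\<in>set is. \<Sum>k\<in>J - {j}. w l j * (w a k * ?m (remove1 l is) (J - {j} - {k}))))
     = v j * ?m (a # is) (J - {j}) + (w a j * ?m is (J - {j})
       + (\<Sum>l\<in>set is. w l j * ?m (a # remove1 l is) (J - {j})))"
    by (simp add: algebra_simps sum.distrib sum_distrib_left)
  also have "(\<Sum>l\<in>set is. w l j * ?m (a # remove1 l is) (J - {j}))
     = (\<Sum>l\<in>set is. w l j * ?m (remove1 l (a # is)) (J - {j}))"
    by (intro sum.cong refl) (use rem in simp)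
  also have "w a j * ?m is (J - {j}) + (\<Sum>l\<in>set is. w l j * ?m (remove1 l (a # is)) (J - {j}))
     = (\<Sum>l\<in>set (a # is). w l j * ?m (remove1 l (a # is)) (J - {j}))"
    using a by simp
  finally show ?case .
qed

text \<open>
  The cross term compares the covered/uncovered patterns of a row \<open>i\<close> and a column \<open>j\<close>:
  an alternating path from \<open>i\<close> to \<open>j\<close> has odd length, so swapping along the path at
  \<open>i\<close> never affects \<open>j\<close>; for two columns the parity, hence the inequality, is reversed.
\<close>

lemma mpol_cross:
  fixes w :: "'a \<Rightarrow> 'b \<Rightarrow> real"
  assumes "\<And>i j. 0 \<le> w i j" "\<And>i. 0 \<le> u i" "\<And>j. 0 \<le> v j" "finite J" "distinct is"
  shows "i \<in> set is \<Longrightarrow> j \<in> J \<Longrightarrow> mpol w u v (remove1 i is) J * mpol w u v is (J - {j})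
            \<le> mpol w u v is J * mpol w u v (remove1 i is) (J - {j})"
    and "j \<in> J \<Longrightarrow> k \<in> J \<Longrightarrow> j \<noteq> k \<Longrightarrow> mpol w u v is J * mpol w u v is (J - {j} - {k})
            \<le> mpol w u v is (J - {j}) * mpol w u v is (J - {k})"
  using assms(4,5)
proof (induction "length is + card J" arbitrary: "is" J i j k rule: less_induct)
  case less
  let ?m = "mpol w u v"
  have nn: "0 \<le> ?m is' J'" for is' J' using assms by (intro mpol_nonneg) auto
  {
    case 1
    let ?r = "remove1 i is"
    \<comment> \<open>Deleting row \<open>i\<close> leads from the mixed inequality to the
      two-column one, and deleting a column leads back, so the two statements feed each other in one
      induction on the total size.\<close>
    have IH: "?m ?r J * ?m ?r (J - {j} - {k}) \<le> ?m ?r (J - {j}) * ?m ?r (J - {k})"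
      if "k \<in> J - {j}" for k
      using 1 that length_pos_if_in_set[of i "is"] by (intro less.hyps(2)) (auto simp: length_remove1)
    have e1: "?m is J = u i * ?m ?r J + w i j * ?m ?r (J - {j})
        + (\<Sum>k\<in>J - {j}. w i k * ?m ?r (J - {k}))"
      using 1 by (subst mpol_row_expand[of _ i]) (auto simp: sum.remove)
    have e2: "?m is (J - {j}) = u i * ?m ?r (J - {j}) + (\<Sum>k\<in>J - {j}. w i k * ?m ?r (J - {j} - {k}))"
      using 1 by (subst mpol_row_expand[of _ i]) auto
    \<comment> \<open>Only the edge from \<open>i\<close> to \<open>j\<close> itself produces a
      square; every other column \<open>k\<close> produces an instance of \<open>IH\<close>.\<close>
    have "0 \<le> w i j * (?m ?r (J - {j}))\<^sup>2 + (\<Sum>k\<in>J - {j}. w i k *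
        (?m ?r (J - {j}) * ?m ?r (J - {k}) - ?m ?r J * ?m ?r (J - {j} - {k})))"
      using IH assms(1) by (intro add_nonneg_nonneg sum_nonneg mult_nonneg_nonneg) auto
    also have "\<dots> = ?m is J * ?m ?r (J - {j}) - ?m ?r J * ?m is (J - {j})"
      unfolding e1 e2
      by (simp add: algebra_simps sum_subtractf sum_distrib_left power2_eq_square)
    finally show ?case by simp
  next
    case 2
    have IH: "?m (remove1 l is) (J - {j}) * ?m is (J - {j} - {k})
        \<le> ?m is (J - {j}) * ?m (remove1 l is) (J - {j} - {k})" if "l \<in> set is" for l
      using 2 that card_gt_0_iff[of J] by (intro less.hyps(1)) auto
    have e1: "?m is J = v j * ?m is (J - {j}) + (\<Sum>l\<in>set is. w l j * ?m (remove1 l is) (J - {j}))"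
      using 2 by (subst mpol_col_expand[of _ j]) auto
    have jk: "J - {k} - {j} = J - {j} - {k}" by auto
    have e2: "?m is (J - {k}) = v j * ?m is (J - {j} - {k})
        + (\<Sum>l\<in>set is. w l j * ?m (remove1 l is) (J - {j} - {k}))"
      using 2 by (subst mpol_col_expand[of _ j]) (auto simp: jk)
    have "0 \<le> (\<Sum>l\<in>set is. w l j * (?m is (J - {j}) * ?m (remove1 l is) (J - {j} - {k})
         - ?m (remove1 l is) (J - {j}) * ?m is (J - {j} - {k})))"
      using IH assms(1) by (intro sum_nonneg mult_nonneg_nonneg) auto
    also have "\<dots> = ?m is (J - {j}) * ?m is (J - {k}) - ?m is J * ?m is (J - {j} - {k})"
      unfolding e1 e2
      by (simp add: algebra_simps sum_subtractf sum_distrib_left)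
    finally show ?case by simp
  }
qed

text \<open>With \<open>mpol_shift_col\<close> this writes the polynomial as a + b y + c z + d y z
  when y and z are added to the weights of one row and one column. \<open>mpol_cross\<close> is the
  inequality b c <= a d for these coefficients, and \<open>mpol_add_edge\<close> shows that
  switching on the edge replaces the value by a plus a multiple of d.\<close>

lemma mpol_shift_row:
  assumes "finite J" "i \<in> set is" "distinct is"
  shows "mpol w (u(i := u i + y)) v is J = mpol w u v is J + y * mpol w u v (remove1 i is) J"
proof -
  have "mpol w (u(i := u i + y)) v (remove1 i is) J' = mpol w u v (remove1 i is) J'" for J'
    using assms by (intro mpol_cong) auto
  then show ?thesis using assms
    by (simp add: mpol_row_expand[of J i "is"] algebra_simps)
qed

lemma mpol_shift_col:
  assumes "finite J" "j \<in> J" "distinct is"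
  shows "mpol w u (v(j := v j + z)) is J = mpol w u v is J + z * mpol w u v is (J - {j})"
proof -
  have "mpol w u (v(j := v j + z)) is' (J - {j}) = mpol w u v is' (J - {j})" for is'
    using assms by (intro mpol_cong) auto
  then show ?thesis using assms
    by (simp add: mpol_col_expand[of J j "is"] algebra_simps)
qed

lemma mpol_add_edge:
  assumes "finite J" "i \<in> set is" "j \<in> J" "distinct is"
  shows "mpol (w(i := (w i)(j := w i j + c))) u v is J
    = mpol w u v is J + c * mpol w u v (remove1 i is) (J - {j})"
proof -
  let ?w = "w(i := (w i)(j := w i j + c))"
  have "mpol ?w u v (remove1 i is) J' = mpol w u v (remove1 i is) J'" for J'
    using assms by (intro mpol_cong) auto
  moreover have "(\<Sum>k\<in>J. ?w i k * mpol w u v (remove1 i is) (J - {k}))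
     = (\<Sum>k\<in>J. w i k * mpol w u v (remove1 i is) (J - {k})) + c * mpol w u v (remove1 i is) (J - {j})"
    using assms by (simp add: sum.remove[of J j] algebra_simps)
  ultimately show ?thesis using assms
    by (simp only: mpol_row_expand[of J i "is"])
qed

lemma mpol_no_edges:
  assumes "finite J" "distinct is"
  shows "mpol (\<lambda>_ _. 0) u v is J = (\<Prod>i\<in>set is. u i) * (\<Prod>j\<in>J. v j)"
  using assms by (induction "is") auto

section \<open>Permanents\<close>

text \<open>Extensional, so that each bijection is counted once; source and target may differ
  because expansion along a row deletes unrelated elements from the two sides.\<close>

definition bijections :: "'a set \<Rightarrow> 'b set \<Rightarrow> ('a \<Rightarrow> 'b) set" where
  "bijections I J = {f \<in> I \<rightarrow>\<^sub>E J. bij_betw f I J}"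

definition permanent :: "('a \<Rightarrow> 'b \<Rightarrow> 'c::comm_semiring_1) \<Rightarrow> 'a set \<Rightarrow> 'b set \<Rightarrow> 'c" where
  "permanent w I J = (\<Sum>f\<in>bijections I J. \<Prod>i\<in>I. w i (f i))"

lemma finite_bijections: "finite I \<Longrightarrow> finite J \<Longrightarrow> finite (bijections I J)"
  unfolding bijections_def by (rule finite_subset[of _ "I \<rightarrow>\<^sub>E J"]) (auto intro: finite_PiE)

lemma bijections_mem: "f \<in> bijections I J \<Longrightarrow> i \<in> I \<Longrightarrow> f i \<in> J"
  by (auto simp: bijections_def)

lemma bijections_empty: "bijections {} J = (if J = {} then {\<lambda>_. undefined} else {})"
  by (auto simp: bijections_def bij_betw_def)

lemma permanent_empty: "permanent w {} J = (if J = {} then 1 else 0)"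
  by (simp add: permanent_def bijections_empty)

lemma sum_bijections_insert:
  assumes "finite I" "finite J" "i \<notin> I"
  shows "(\<Sum>f\<in>bijections (insert i I) J. F f) = (\<Sum>k\<in>J. \<Sum>f\<in>bijections I (J - {k}). F (f(i := k)))"
proof -
  have fin: "\<forall>k\<in>J. finite (bijections I (J - {k}))" using assms by (auto intro: finite_bijections)
  have "(\<Sum>k\<in>J. \<Sum>f\<in>bijections I (J - {k}). F (f(i := k)))
     = (\<Sum>(k, f)\<in>Sigma J (\<lambda>k. bijections I (J - {k})). F (f(i := k)))"
    using assms(2) fin by (rule sum.Sigma)
  also have "\<dots> = (\<Sum>f\<in>bijections (insert i I) J. F f)"
  proof (rule sum.reindex_bij_witness[where i = "\<lambda>f. (f i, f(i := undefined))" and j = "\<lambda>(k, f). f(i := k)"])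
    fix a assume "a \<in> Sigma J (\<lambda>k. bijections I (J - {k}))"
    then obtain k f where a: "a = (k, f)" "k \<in> J" "f \<in> bijections I (J - {k})" by auto
    then have f: "f \<in> I \<rightarrow>\<^sub>E (J - {k})" "bij_betw f I (J - {k})" by (auto simp: bijections_def)
    have fi: "f i = undefined" using f assms by auto
    show "(\<lambda>f. (f i, f(i := undefined))) ((\<lambda>(k, f). f(i := k)) a) = a"
      using a fi by (auto simp: fun_upd_idem)
    have "bij_betw (f(i := k)) I (J - {k})"
      using f(2) assms(3) by (subst bij_betw_cong[of _ _ f]) auto
    then have "bij_betw (f(i := k)) (I \<union> {i}) (J - {k} \<union> {(f(i := k)) i})"
      using assms a by (subst notIn_Un_bij_betw3[symmetric]) auto
    then have "bij_betw (f(i := k)) (insert i I) J" using a(2) by (simp add: insert_absorb)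
    then show "(\<lambda>(k, f). f(i := k)) a \<in> bijections (insert i I) J"
      using a(1) by (auto simp: bijections_def bij_betw_def PiE_iff extensional_def fi f(1)[unfolded PiE_iff extensional_def])
        (use f(1) in \<open>auto simp: PiE_iff extensional_def\<close>)
    show "F ((\<lambda>(k, f). f(i := k)) a) = (case a of (k, f) \<Rightarrow> F (f(i := k)))" using a by simp
  next
    fix f assume f: "f \<in> bijections (insert i I) J"
    then have b: "bij_betw f (insert i I) J" and fE: "f \<in> insert i I \<rightarrow>\<^sub>E J" by (auto simp: bijections_def)
    show "(\<lambda>(k, f). f(i := k)) ((\<lambda>f. (f i, f(i := undefined))) f) = f" by simp
    have "bij_betw f I (J - {f i})"
      using bij_betw_DiffI[OF b bij_betw_singletonI[OF refl, of f i]] assms(3) b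
      by (auto simp: bij_betw_def)
    then have "bij_betw (f(i := undefined)) I (J - {f i})"
      using assms(3) by (subst bij_betw_cong[of _ _ f]) auto
    moreover have "f i \<in> J" using b by (auto simp: bij_betw_def)
    ultimately show "(\<lambda>f. (f i, f(i := undefined))) f \<in> Sigma J (\<lambda>k. bijections I (J - {k}))"
      using fE by (auto simp: bijections_def PiE_iff extensional_def bij_betw_def)
  qed
  finally show ?thesis by simp
qed

lemma permanent_insert:
  assumes "finite I" "finite J" "i \<notin> I"
  shows "permanent w (insert i I) J = (\<Sum>k\<in>J. w i k * permanent w I (J - {k}))"
  unfolding permanent_def sum_bijections_insert[OF assms] sum_distrib_left
  using assms by (intro sum.cong refl) (auto intro!: arg_cong2[where f = "(*)"] prod.cong)

text \<open>A permutation is the identity off \<open>I\<close>, an element of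
  \<open>bijections I I\<close> is \<open>undefined\<close> there; hence the hypothesis that
  \<open>F\<close> sees only the values on \<open>I\<close>.\<close>

lemma sum_permutes_bijections:
  assumes "\<And>f g. (\<And>i. i \<in> I \<Longrightarrow> f i = g i) \<Longrightarrow> F f = F g"
  shows "(\<Sum>\<sigma>\<in>{\<sigma>. \<sigma> permutes I}. F \<sigma>) = (\<Sum>f\<in>bijections I I. F f)"
proof (rule sum.reindex_bij_witness[where j = "\<lambda>\<sigma>. restrict \<sigma> I" and i = "\<lambda>f x. if x \<in> I then f x else x"])
  fix \<sigma> assume "\<sigma> \<in> {\<sigma>. \<sigma> permutes I}"
  then have s: "\<sigma> permutes I" by simp
  show "(\<lambda>x. if x \<in> I then restrict \<sigma> I x else x) = \<sigma>"
    using s by (auto simp: fun_eq_iff permutes_def)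
  show "restrict \<sigma> I \<in> bijections I I"
    using permutes_imp_bij[OF s] permutes_in_image[OF s]
    by (auto simp: bijections_def)
  show "F (restrict \<sigma> I) = F \<sigma>" by (rule assms) simp
next
  fix f assume "f \<in> bijections I I"
  then have f: "f \<in> I \<rightarrow>\<^sub>E I" "bij_betw f I I" by (auto simp: bijections_def)
  show "restrict (\<lambda>x. if x \<in> I then f x else x) I = f"
    using f(1) by (auto simp: fun_eq_iff restrict_def PiE_iff extensional_def)
  have "bij_betw (\<lambda>x. if x \<in> I then f x else x) I I"
    using f(2) by (subst bij_betw_cong[of _ _ f]) auto
  then show "(\<lambda>x. if x \<in> I then f x else x) \<in> {\<sigma>. \<sigma> permutes I}"
    by (auto intro: bij_imp_permutes)
qed

lemma permanent_permutes:
  "permanent w I I = (\<Sum>\<sigma>\<in>{\<sigma>. \<sigma> permutes I}. \<Prod>i\<in>I. w i (\<sigma> i))"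
  unfolding permanent_def by (rule sum_permutes_bijections[symmetric]) (auto intro: prod.cong)

lemma mpol_permanent:
  assumes "finite J" "distinct is"
  shows "mpol w (\<lambda>_. 0) (\<lambda>_. 0) is J = permanent w (set is) J"
  using assms
proof (induction "is" arbitrary: J)
  case Nil
  then show ?case by (cases "J = {}") (auto simp: permanent_empty)
qed (simp add: permanent_insert)

section \<open>Schrijver's inequality\<close>

lemma weighted_am_gm:
  fixes g :: "'a \<Rightarrow> real"
  assumes "finite A" "(\<Sum>a\<in>A. g a) = 1" "\<And>a. a \<in> A \<Longrightarrow> 0 \<le> g a" "\<And>a. a \<in> A \<Longrightarrow> 0 < y a"
  shows "exp (\<Sum>a\<in>A. g a * (ln (y a) - ln (g a))) \<le> (\<Sum>a\<in>A. y a)"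
proof -
  have "A \<noteq> {}" using assms by auto
  then have "exp (\<Sum>a\<in>A. g a *\<^sub>R (ln (y a) - ln (g a))) \<le> (\<Sum>a\<in>A. g a * exp (ln (y a) - ln (g a)))"
    using assms by (intro convex_on_sum[OF _ _ exp_convex]) auto
  also have "\<dots> \<le> (\<Sum>a\<in>A. y a)"
  proof (rule sum_mono)
    fix a assume a: "a \<in> A"
    show "g a * exp (ln (y a) - ln (g a)) \<le> y a"
    \<comment> \<open>For positive weight the two sides agree; a zero weight gives 0 on the left,
      and \<open>y a\<close> is positive.\<close>
    proof (cases "g a = 0")
      case False
      then have "0 < g a" using assms(3)[OF a] by simp
      then show ?thesis using assms(4)[OF a] by (simp add: exp_diff)
    qed (use assms(4)[OF a] in simp)
  qed
  finally show ?thesis by simp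
qed

lemma capacity_pair_aux:
  fixes a b c d g C :: real
  assumes "0 < a" "0 < d" "0 \<le> b" "0 \<le> c" "b * c \<le> a * d" "0 < g" "g < 1"
    and cap: "\<And>y z. 0 < y \<Longrightarrow> 0 < z \<Longrightarrow> C * exp (g * (ln y + ln z)) \<le> a + b * y + c * z + d * y * z"
  shows "C * (exp (2 * g * ln g) * (1 - g)) \<le> a + g * (1 - g) * d"
proof (cases "C \<le> 0")
  case True
  then have "C * (exp (2 * g * ln g) * (1 - g)) \<le> 0"
    using assms by (intro mult_nonpos_nonneg) auto
  also have "0 \<le> a + g * (1 - g) * d" using assms by simp
  finally show ?thesis .
next
  case False
  \<comment> \<open>This is the minimiser of (1 + t)^2 / t^(2 g), the bound for \<open>C\<close>
    obtained from y, z with d y z = a t^2.\<close>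
  define t where "t = g / (1 - g)"
  have t: "0 < t" using assms by (simp add: t_def)
  \<comment> \<open>Both mixed terms can be kept below a t while their product is prescribed
    precisely because b c <= a d. If \<open>c\<close> is positive, c z = a t is attained; if c = 0
    the freedom is used for b y instead.\<close>
  obtain y z where yz: "0 < y" "0 < z" "d * (y * z) = a * t\<^sup>2" "b * y \<le> a * t" "c * z \<le> a * t"
  proof (cases "c = 0")
    case c: False
    then have "0 < c" using assms by simp
    have "b * (c * t / d) \<le> a * t"
      using mult_right_mono[OF assms(5), of t] t assms by (simp add: field_simps)
    then show ?thesis using \<open>0 < c\<close> t assms
      by (intro that[of "c * t / d" "a * t / c"]) (auto simp: power2_eq_square)
  next
    case c: True
    show ?thesis
    proof (cases "b = 0")
      case True
      then show ?thesis using c t assms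
        by (intro that[of 1 "a * t\<^sup>2 / d"]) auto
    next
      case False
      then show ?thesis using c t assms
        by (intro that[of "a * t / b" "b * t / d"]) (auto simp: power2_eq_square)
    qed
  qed
  have "a + b * y + c * z + d * y * z \<le> a * (1 + t)\<^sup>2"
    using yz by (simp add: power2_eq_square algebra_simps)
  also have "1 + t = 1 / (1 - g)" using assms by (simp add: t_def field_simps)
  finally have "C * exp (g * (ln y + ln z)) \<le> a * (1 / (1 - g))\<^sup>2"
    using cap[OF yz(1,2)] by linarith
  then have "ln (C * exp (g * (ln y + ln z))) \<le> ln (a * (1 / (1 - g))\<^sup>2)"
    using False assms by (subst ln_le_cancel_iff) auto
  then have 1: "ln C + g * (ln y + ln z) \<le> ln a - 2 * ln (1 - g)"
    using False assms by (simp add: ln_mult ln_div ln_realpow)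
  have "ln d + (ln y + ln z) = ln (d * (y * z))" using yz(1,2) assms(2) by (simp add: ln_mult)
  also have "\<dots> = ln a + 2 * ln t" unfolding yz(3) using assms(1) t by (simp add: ln_mult ln_realpow)
  finally have "ln d + (ln y + ln z) = ln a + 2 * ln t" .
  then have 2: "ln y + ln z = ln a - ln d + 2 * (ln g - ln (1 - g))"
    using assms by (simp add: t_def ln_div)
  \<comment> \<open>In product form the right side is the geometric mean of a / (1 - g) and d (1 -
    g) with weights 1 - g and g; their arithmetic mean is the claimed bound.\<close>
  have "ln C + 2 * g * ln g + ln (1 - g)
      \<le> (1 - g) * (ln a - ln (1 - g)) + g * (ln d + ln (1 - g))"
    using 1 unfolding 2 by (simp add: algebra_simps)
  also have "\<dots> = (1 - g) * ln (a / (1 - g)) + g * ln (d * (1 - g))"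
    using assms by (simp add: ln_mult ln_div)
  also have "exp \<dots> \<le> (1 - g) * exp (ln (a / (1 - g))) + g * exp (ln (d * (1 - g)))"
    using convex_onD[OF exp_convex, of g "ln (a / (1 - g))" "ln (d * (1 - g))"] assms by simp
  also have "\<dots> = a + g * (1 - g) * d" using assms by simp
  finally have "exp (ln C + 2 * g * ln g + ln (1 - g)) \<le> a + g * (1 - g) * d" by simp
  then show ?thesis using False assms by (simp add: exp_add mult_ac)
qed

text \<open>
  The factor \<open>1 - g\<close>, except that an entry \<open>g = 1\<close> (a forced edge) contributes nothing
  instead of making both sides vanish.
\<close>

definition co_weight :: "real \<Rightarrow> real" where
  "co_weight g = (if g = 1 then 1 else 1 - g)"

text \<open>The degenerate cases are limits: y = z -> 0 isolates \<open>a\<close> when g = 0, and y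
  = z -> infinity isolates \<open>d\<close> when g = 1. For 0 < g < 1, adding a small constant to
  both \<open>a\<close> and \<open>d\<close> makes them positive and keeps b c <= a d.\<close>

lemma capacity_pair:
  fixes a b c d g C :: real
  assumes "0 \<le> a" "0 \<le> d" "0 \<le> b" "0 \<le> c" "b * c \<le> a * d" "0 \<le> g" "g \<le> 1"
    and cap: "\<And>y z. 0 < y \<Longrightarrow> 0 < z \<Longrightarrow> C * exp (g * (ln y + ln z)) \<le> a + b * y + c * z + d * y * z"
  shows "C * (exp (2 * g * ln g) * co_weight g) \<le> a + g * co_weight g * d"
proof -
  consider "g = 0" | "g = 1" | "0 < g" "g < 1" using assms by linarith
  then show ?thesis
  proof cases
    case 1
    have "((\<lambda>t. a + b * t + c * t + d * t * t) \<longlongrightarrow> a + b * 0 + c * 0 + d * 0 * 0) (at_right 0)"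
      by (intro tendsto_intros)
    moreover have "eventually (\<lambda>t. C \<le> a + b * t + c * t + d * t * t) (at_right 0)"
      using cap 1 by (auto simp: eventually_at_right_less intro: eventually_at_rightI[of 0 1])
    ultimately have "C \<le> a" by (auto intro: tendsto_lowerbound)
    then show ?thesis using 1 by (simp add: co_weight_def)
  next
    case 2
    have "C \<le> a * t * t + b * t + c * t + d" if "0 < t" for t
    proof -
      have "C * exp (ln (1/t) + ln (1/t)) \<le> a + b * (1/t) + c * (1/t) + d * (1/t) * (1/t)"
        using cap[of "1/t" "1/t"] that 2 by simp
      moreover have "exp (ln (1/t) + ln (1/t)) = 1/t * (1/t)" using that by (subst exp_add) simp
      ultimately have "C * (1/t * (1/t)) \<le> a + b * (1/t) + c * (1/t) + d * (1/t) * (1/t)"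
        by (simp only:)
      then have "C * (1/t * (1/t)) * (t * t) \<le> (a + b * (1/t) + c * (1/t) + d * (1/t) * (1/t)) * (t * t)"
        using that by (intro mult_right_mono) auto
      also have "C * (1/t * (1/t)) * (t * t) = C" using that by simp
      also have "(a + b * (1/t) + c * (1/t) + d * (1/t) * (1/t)) * (t * t) = a * t * t + b * t + c * t + d"
        using that by (simp add: field_simps)
      finally show ?thesis .
    qed
    then have "eventually (\<lambda>t. C \<le> a * t * t + b * t + c * t + d) (at_right 0)"
      by (auto intro: eventually_at_rightI[of 0 1])
    moreover have "((\<lambda>t. a * t * t + b * t + c * t + d) \<longlongrightarrow> a * 0 * 0 + b * 0 + c * 0 + d) (at_right 0)"
      by (intro tendsto_intros)
    ultimately have "C \<le> d" by (auto intro: tendsto_lowerbound)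
    then show ?thesis using 2 assms by (simp add: co_weight_def)
  next
    case 3
    let ?K = "C * (exp (2 * g * ln g) * (1 - g))"
    have "?K \<le> (a + e) + g * (1 - g) * (d + e)" if "0 < e" for e
    proof (rule capacity_pair_aux)
      have "a * d \<le> (a + e) * (d + e)" using assms that by (intro mult_mono) auto
      then show "b * c \<le> (a + e) * (d + e)" using assms by linarith
      fix y z :: real assume yz: "0 < y" "0 < z"
      have "C * exp (g * (ln y + ln z)) \<le> a + b * y + c * z + d * y * z" using cap yz by blast
      also have "\<dots> \<le> a + e + b * y + c * z + (d + e) * y * z"
        using yz that by (simp add: algebra_simps)
      finally show "C * exp (g * (ln y + ln z)) \<le> a + e + b * y + c * z + (d + e) * y * z" .
    qed (use 3 assms that in auto)
    then have "eventually (\<lambda>e. ?K \<le> (a + e) + g * (1 - g) * (d + e)) (at_right 0)"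
      by (auto intro: eventually_at_rightI[of 0 1])
    moreover have "((\<lambda>e. (a + e) + g * (1 - g) * (d + e)) \<longlongrightarrow> (a + 0) + g * (1 - g) * (d + 0)) (at_right 0)"
      by (intro tendsto_intros)
    ultimately have "?K \<le> a + g * (1 - g) * d" by (auto intro: tendsto_lowerbound)
    then show ?thesis using 3 by (simp add: co_weight_def)
  qed
qed

text \<open>
  The capacity bound is kept while edges are switched on one at a time: \<open>y\<close> and \<open>z\<close> are
  the row and column variables of the edges that are still off, and the powers of \<open>y\<close>,
  \<open>z\<close>, \<open>G\<close> are written through \<open>exp\<close> and \<open>ln\<close> because
  \<open>0 powr 0 = 0\<close>, whereas \<open>ln 0 = 0\<close> gives the intended value 1.
\<close>

lemma mpol_capacity:
  fixes g :: "'a \<Rightarrow> 'b \<Rightarrow> real"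
  assumes fin: "finite J" and dist: "distinct is"
    and nn: "\<And>i j. 0 \<le> g i j"
    and row: "\<And>i. i \<in> set is \<Longrightarrow> (\<Sum>j\<in>J. g i j) = 1"
    and col: "\<And>j. j \<in> J \<Longrightarrow> (\<Sum>i\<in>set is. g i j) = 1"
    and E: "E \<subseteq> set is \<times> J" and pos: "\<And>e. 0 < y e" "\<And>e. 0 < z e"
  defines "G \<equiv> \<lambda>e. g (fst e) (snd e)"
  shows "exp ((\<Sum>e\<in>set is \<times> J - E. G e * (ln (y e) + ln (z e))) - (\<Sum>e\<in>set is \<times> J - E. 2 * G e * ln (G e)))
       * (\<Prod>e\<in>E. co_weight (G e))
    \<le> mpol (\<lambda>i j. if (i, j) \<in> E then g i j * co_weight (g i j) else 0)
        (\<lambda>i. \<Sum>j\<in>{j\<in>J. (i, j) \<notin> E}. y (i, j)) (\<lambda>j. \<Sum>i\<in>{i\<in>set is. (i, j) \<notin> E}. z (i, j)) is J"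
proof -
  have finE: "finite E" using E fin by (meson finite_SigmaI finite_set finite_subset)
  from finE E pos show ?thesis
  proof (induction E arbitrary: y z rule: finite_induct)
    case empty
    \<comment> \<open>Without edges the polynomial is the product of the row sums of
      \<open>y\<close> and the column sums of \<open>z\<close>. One of the two copies of G ln G goes
      to the rows and one to the columns, and each line is an instance of
      \<open>weighted_am_gm\<close>.\<close>
    have "exp ((\<Sum>e\<in>set is \<times> J. G e * (ln (y e) + ln (z e))) - (\<Sum>e\<in>set is \<times> J. 2 * G e * ln (G e)))
      = exp ((\<Sum>i\<in>set is. \<Sum>j\<in>J. g i j * (ln (y (i, j)) - ln (g i j)))
           + (\<Sum>j\<in>J. \<Sum>i\<in>set is. g i j * (ln (z (i, j)) - ln (g i j))))"
    proof -
      have "(\<Sum>i\<in>set is. \<Sum>j\<in>J. g i j * (ln (y (i, j)) - ln (g i j)))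
          = (\<Sum>e\<in>set is \<times> J. G e * (ln (y e) - ln (G e)))"
        by (simp add: sum.cartesian_product G_def split_def)
      moreover have "(\<Sum>j\<in>J. \<Sum>i\<in>set is. g i j * (ln (z (i, j)) - ln (g i j)))
          = (\<Sum>e\<in>set is \<times> J. G e * (ln (z e) - ln (G e)))"
        by (subst sum.swap) (simp add: sum.cartesian_product G_def split_def)
      ultimately show ?thesis
        by (simp add: sum_subtractf[symmetric] sum.distrib[symmetric] algebra_simps)
    qed
    also have "\<dots> = (\<Prod>i\<in>set is. exp (\<Sum>j\<in>J. g i j * (ln (y (i, j)) - ln (g i j))))
       * (\<Prod>j\<in>J. exp (\<Sum>i\<in>set is. g i j * (ln (z (i, j)) - ln (g i j))))"
      using fin by (simp add: exp_add exp_sum)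
    also have "\<dots> \<le> (\<Prod>i\<in>set is. \<Sum>j\<in>J. y (i, j)) * (\<Prod>j\<in>J. \<Sum>i\<in>set is. z (i, j))"
      using fin row col nn empty less_imp_le[OF empty(2)] less_imp_le[OF empty(3)]
      by (intro mult_mono prod_mono conjI weighted_am_gm prod_nonneg) (auto intro!: sum_nonneg)
    finally show ?case using fin dist by (simp add: mpol_no_edges)
  next
    case (insert e E)
    obtain i j where e: "e = (i, j)" by force
    have ij: "i \<in> set is" "j \<in> J" using insert.prems e by auto
    let ?w = "\<lambda>i j. if (i, j) \<in> E then g i j * co_weight (g i j) else 0"
    define u where "u = (\<lambda>i. \<Sum>j\<in>{j\<in>J. (i, j) \<notin> insert e E}. y (i, j))"
    define v where "v = (\<lambda>j. \<Sum>i\<in>{i\<in>set is. (i, j) \<notin> insert e E}. z (i, j))"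
    let ?m = "mpol ?w u v"
    let ?r = "remove1 i is"
    have cw: "0 \<le> g i j * co_weight (g i j)" if "(i, j) \<in> set is \<times> J" for i j
    proof -
      have "g i j \<le> (\<Sum>j\<in>J. g i j)" using that fin nn by (intro member_le_sum) auto
      then show ?thesis using that row nn by (auto simp: co_weight_def)
    qed
    have w: "0 \<le> ?w i j" for i j using cw insert.prems(1) by auto
    have u: "0 \<le> u i" for i unfolding u_def using insert.prems by (intro sum_nonneg) (auto intro: less_imp_le)
    have v: "0 \<le> v i" for i unfolding v_def using insert.prems by (intro sum_nonneg) (auto intro: less_imp_le)
    have "g i j \<le> (\<Sum>j\<in>J. g i j)" using ij fin nn by (intro member_le_sum) auto
    then have g1: "g i j \<le> 1" using row ij by simp
    have mnn: "0 \<le> ?m is' J'" for is' J' using w u v by (intro mpol_nonneg) auto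
    define X where "X = exp ((\<Sum>e\<in>set is \<times> J - insert e E. G e * (ln (y e) + ln (z e)))
        - (\<Sum>e\<in>set is \<times> J - insert e E. 2 * G e * ln (G e))) * (\<Prod>e\<in>E. co_weight (G e))"
    \<comment> \<open>The induction hypothesis holds for all positive values of the two variables of
      \<open>e\<close>; freeing them gives the hypothesis of \<open>capacity_pair\<close>, and
      \<open>X\<close> collects what does not depend on them.\<close>
    have "X * exp (- 2 * G e * ln (G e)) * exp (g i j * (ln s + ln t))
      \<le> ?m is J + ?m ?r J * s + ?m is (J - {j}) * t + ?m ?r (J - {j}) * s * t" if st: "0 < s" "0 < t" for s t
    proof -
      let ?y = "y(e := s)" and ?z = "z(e := t)"
      have S: "set is \<times> J - E = insert e (set is \<times> J - insert e E)" using ij e insert by auto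
      have s1: "(\<Sum>e\<in>set is \<times> J - E. G e * (ln (?y e) + ln (?z e)))
          = g i j * (ln s + ln t) + (\<Sum>e\<in>set is \<times> J - insert e E. G e * (ln (y e) + ln (z e)))"
        unfolding S using fin by (subst sum.insert) (auto simp: G_def e intro!: sum.cong)
      have s2: "(\<Sum>e\<in>set is \<times> J - E. 2 * G e * ln (G e))
          = 2 * G e * ln (G e) + (\<Sum>e\<in>set is \<times> J - insert e E. 2 * G e * ln (G e))"
        unfolding S using fin by (subst sum.insert) auto
      have "X * exp (- 2 * G e * ln (G e)) * exp (g i j * (ln s + ln t))
        = exp ((\<Sum>e\<in>set is \<times> J - E. G e * (ln (?y e) + ln (?z e))) - (\<Sum>e\<in>set is \<times> J - E. 2 * G e * ln (G e)))
       * (\<Prod>e\<in>E. co_weight (G e))"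
        unfolding s1 s2 X_def by (simp add: exp_add exp_diff exp_minus field_simps)
      also have "\<dots> \<le> mpol ?w (\<lambda>i. \<Sum>j\<in>{j\<in>J. (i, j) \<notin> E}. ?y (i, j)) (\<lambda>j. \<Sum>i\<in>{i\<in>set is. (i, j) \<notin> E}. ?z (i, j)) is J"
        using insert st by (intro insert.IH) auto
      also have "(\<lambda>i. \<Sum>j\<in>{j\<in>J. (i, j) \<notin> E}. ?y (i, j)) = u(i := u i + s)"
      proof
        fix i'
        have "{j'\<in>J. (i, j') \<notin> E} = insert j {j'\<in>J. (i, j') \<notin> insert e E}" using ij e insert by auto
        moreover have "{j\<in>J. (i', j) \<notin> E} = {j\<in>J. (i', j) \<notin> insert e E}" if "i' \<noteq> i" using that e by auto
        ultimately show "(\<Sum>j\<in>{j\<in>J. (i', j) \<notin> E}. ?y (i', j)) = (u(i := u i + s)) i'"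
          unfolding u_def using fin e by (auto intro!: sum.cong)
      qed
      also have "(\<lambda>j. \<Sum>i\<in>{i\<in>set is. (i, j) \<notin> E}. ?z (i, j)) = v(j := v j + t)"
      proof
        fix j'
        have "{i'\<in>set is. (i', j) \<notin> E} = insert i {i'\<in>set is. (i', j) \<notin> insert e E}" using ij e insert by auto
        moreover have "{i\<in>set is. (i, j') \<notin> E} = {i\<in>set is. (i, j') \<notin> insert e E}" if "j' \<noteq> j" using that e by auto
        ultimately show "(\<Sum>i\<in>{i\<in>set is. (i, j') \<notin> E}. ?z (i, j')) = (v(j := v j + t)) j'"
          unfolding v_def using fin e by (auto intro!: sum.cong)
      qed
      also have "mpol ?w (u(i := u i + s)) (v(j := v j + t)) is J
        = ?m is J + ?m ?r J * s + ?m is (J - {j}) * t + ?m ?r (J - {j}) * s * t"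
        by (simp only: mpol_shift_row[OF fin ij(1) dist] mpol_shift_col[OF fin ij(2) dist]
            mpol_shift_col[OF fin ij(2) distinct_remove1[OF dist]] mpol_shift_row[OF finite_Diff[OF fin] ij(1) dist]) (simp add: algebra_simps)
      finally show ?thesis .
    qed
    moreover have "?m ?r J * ?m is (J - {j}) \<le> ?m is J * ?m ?r (J - {j})"
      using mpol_cross(1)[of ?w u v J "is" i j] w u v fin dist ij by auto
    ultimately have "X * exp (- 2 * G e * ln (G e)) * (exp (2 * g i j * ln (g i j)) * co_weight (g i j))
       \<le> ?m is J + g i j * co_weight (g i j) * ?m ?r (J - {j})"
      using mnn nn g1 by (intro capacity_pair) (auto)
    \<comment> \<open>The loss exp (2 g ln g) in \<open>capacity_pair\<close> is exactly the term
      that leaves the entropy sum when \<open>e\<close> is switched on.\<close>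
    also have "X * exp (- 2 * G e * ln (G e)) * (exp (2 * g i j * ln (g i j)) * co_weight (g i j))
      = X * co_weight (G e)"
      by (simp add: G_def e exp_minus)
    also have "?m is J + g i j * co_weight (g i j) * ?m ?r (J - {j})
       = mpol (?w(i := (?w i)(j := ?w i j + g i j * co_weight (g i j)))) u v is J"
      by (rule mpol_add_edge[OF fin ij dist, symmetric])
    also have "?w(i := (?w i)(j := ?w i j + g i j * co_weight (g i j)))
       = (\<lambda>i j. if (i, j) \<in> insert e E then g i j * co_weight (g i j) else 0)"
      using insert e by (auto simp: fun_eq_iff)
    finally show ?case using insert unfolding X_def u_def v_def by (simp add: mult_ac)
  qed
qed

text \<open>The case of \<open>mpol_capacity\<close> with all edges on: the sums of free variables
  are empty, so unmatched rows and columns have weight 0 and only perfect matchings survive.\<close>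

theorem schrijver_inequality:
  fixes g :: "'a \<Rightarrow> 'b \<Rightarrow> real"
  assumes fin: "finite I" "finite J"
    and nn: "\<And>i j. i \<in> I \<Longrightarrow> j \<in> J \<Longrightarrow> 0 \<le> g i j"
    and row: "\<And>i. i \<in> I \<Longrightarrow> (\<Sum>j\<in>J. g i j) = 1"
    and col: "\<And>j. j \<in> J \<Longrightarrow> (\<Sum>i\<in>I. g i j) = 1"
  shows "(\<Prod>i\<in>I. \<Prod>j\<in>J. co_weight (g i j)) \<le> permanent (\<lambda>i j. g i j * co_weight (g i j)) I J"
proof -
  obtain "is" where "is": "set is = I" "distinct is" using fin finite_distinct_list by blast
  \<comment> \<open>Extension by 0, since \<open>mpol_capacity\<close> asks for nonnegative entries
    everywhere.\<close>
  define h where "h i j = (if i \<in> I \<and> j \<in> J then g i j else 0)" for i j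
  have "exp ((\<Sum>e\<in>set is \<times> J - set is \<times> J. h (fst e) (snd e) * (ln 1 + ln 1))
        - (\<Sum>e\<in>set is \<times> J - set is \<times> J. 2 * h (fst e) (snd e) * ln (h (fst e) (snd e))))
       * (\<Prod>e\<in>set is \<times> J. co_weight (h (fst e) (snd e)))
    \<le> mpol (\<lambda>i j. if (i, j) \<in> set is \<times> J then h i j * co_weight (h i j) else 0)
        (\<lambda>i. \<Sum>j\<in>{j\<in>J. (i, j) \<notin> set is \<times> J}. 1) (\<lambda>j. \<Sum>i\<in>{i\<in>set is. (i, j) \<notin> set is \<times> J}. 1) is J"
    using fin "is" nn row col by (intro mpol_capacity) (auto simp: h_def)
  also have "\<dots> = mpol (\<lambda>i j. g i j * co_weight (g i j)) (\<lambda>_. 0) (\<lambda>_. 0) is J"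
    using "is" by (intro mpol_cong) (auto simp: h_def)
  also have "\<dots> = permanent (\<lambda>i j. g i j * co_weight (g i j)) I J"
    using fin "is" by (simp add: mpol_permanent)
  finally have "(\<Prod>e\<in>set is \<times> J. co_weight (h (fst e) (snd e)))
      \<le> permanent (\<lambda>i j. g i j * co_weight (g i j)) I J" by simp
  moreover have "(\<Prod>e\<in>set is \<times> J. co_weight (h (fst e) (snd e))) = (\<Prod>i\<in>I. \<Prod>j\<in>J. co_weight (g i j))"
    using "is" by (auto simp: prod.cartesian_product h_def split_def intro!: prod.cong)
  ultimately show ?thesis by simp
qed

section \<open>The row inequality for the Bethe entropy\<close>

definition xlnx :: "real \<Rightarrow> real" where
  "xlnx x = x * ln x"

lemma xlnx_0 [simp]: "xlnx 0 = 0" and xlnx_1 [simp]: "xlnx 1 = 0"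
  by (simp_all add: xlnx_def)

lemma DERIV_xlnx: "0 < x \<Longrightarrow> (xlnx has_real_derivative ln x + 1) (at x)"
  unfolding xlnx_def[abs_def] by (auto intro!: derivative_eq_intros)

lemma DERIV_xlnx_chain [derivative_intros]:
  "(g has_real_derivative g') (at x within S) \<Longrightarrow> 0 < g x \<Longrightarrow>
    ((\<lambda>x. xlnx (g x)) has_real_derivative (ln (g x) + 1) * g') (at x within S)"
  using DERIV_chain2[OF DERIV_xlnx] by blast

lemma continuous_on_xlnx: "continuous_on {0..} xlnx"
proof -
  have "continuous (at x within {0..}) xlnx" if "0 \<le> x" for x
  proof (cases "x = 0")
    case True
    have "(xlnx \<longlongrightarrow> 0) (at_right 0)" unfolding xlnx_def[abs_def] by real_asymp
    then show ?thesis using True by (simp add: continuous_within at_within_Ici_at_right)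
  next
    case False
    then show ?thesis using that DERIV_xlnx[of x]
      by (auto intro: DERIV_isCont continuous_at_imp_continuous_at_within)
  qed
  then show ?thesis by (simp add: continuous_on_eq_continuous_within)
qed

lemma continuous_on_xlnx_comp [continuous_intros]:
  "continuous_on S g \<Longrightarrow> (\<And>x. x \<in> S \<Longrightarrow> 0 \<le> g x) \<Longrightarrow> continuous_on S (\<lambda>x. xlnx (g x))"
  using continuous_on_compose2[OF continuous_on_xlnx, of S g] by auto

section \<open>Mixed second differences of x ln x\<close>

definition xlnx_diff2 :: "real \<Rightarrow> real \<Rightarrow> real \<Rightarrow> real" where
  "xlnx_diff2 x y z = xlnx (z + x + y) + xlnx z - xlnx (z + x) - xlnx (z + y)"

lemma xlnx_diff2_0 [simp]: "xlnx_diff2 0 y z = 0" "xlnx_diff2 x 0 z = 0"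
  by (simp_all add: xlnx_diff2_def)

text \<open>\<open>xlnx (c * a)\<close> and \<open>c * xlnx a\<close> differ by a linear function of
  \<open>a\<close>, which a mixed second difference annihilates.\<close>

lemma xlnx_diff2_scale:
  assumes "0 < c" "0 \<le> x" "0 \<le> y" "0 \<le> z"
  shows "xlnx_diff2 (c * x) (c * y) (c * z) = c * xlnx_diff2 x y z"
proof -
  have *: "xlnx (c * a) = c * xlnx a + c * ln c * a" if "0 \<le> a" for a
    using that assms(1) by (cases "a = 0") (auto simp: xlnx_def ln_mult algebra_simps)
  have "xlnx (c * z + c * x + c * y) = c * xlnx (z + x + y) + c * ln c * (z + x + y)"
    "xlnx (c * z + c * x) = c * xlnx (z + x) + c * ln c * (z + x)"
    "xlnx (c * z + c * y) = c * xlnx (z + y) + c * ln c * (z + y)"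
    using *[of "z + x + y"] *[of "z + x"] *[of "z + y"] assms by (simp_all add: distrib_left)
  then show ?thesis using *[of z] assms by (simp add: xlnx_diff2_def algebra_simps)
qed

definition xlnx_diff2' :: "real \<Rightarrow> real \<Rightarrow> real \<Rightarrow> real" where
  "xlnx_diff2' x y z = ln (z + x + y) + ln z - ln (z + x) - ln (z + y)"

lemma xlnx_diff2_cont:
  "0 \<le> x \<Longrightarrow> 0 \<le> y \<Longrightarrow> 0 \<le> a \<Longrightarrow> continuous_on {a..b} (xlnx_diff2 x y)"
  unfolding xlnx_diff2_def[abs_def] by (intro continuous_intros) auto

lemma xlnx_diff2_deriv:
  "0 \<le> x \<Longrightarrow> 0 \<le> y \<Longrightarrow> 0 < z \<Longrightarrow> (xlnx_diff2 x y has_real_derivative xlnx_diff2' x y z) (at z)"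
  unfolding xlnx_diff2_def[abs_def] xlnx_diff2'_def
  by (auto intro!: derivative_eq_intros)

text \<open>Convexity of \<open>xlnx_diff2\<close> in the base point. After exponentiation the two
  sides differ by x y times the increment of (z + x + y) z.\<close>

lemma xlnx_diff2'_mono:
  assumes "0 \<le> x" "0 \<le> y" "0 < z" "z \<le> z'"
  shows "xlnx_diff2' x y z \<le> xlnx_diff2' x y z'"
proof -
  have "(z + x + y) * z * ((z' + x) * (z' + y)) \<le> (z' + x + y) * z' * ((z + x) * (z + y))"
  proof -
    have "(z' + x + y) * z' * ((z + x) * (z + y)) - (z + x + y) * z * ((z' + x) * (z' + y))
      = x * y * ((z' + x + y) * z' - (z + x + y) * z)" by algebra
    moreover have "(z + x + y) * z \<le> (z' + x + y) * z'" using assms by (intro mult_mono) auto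
    ultimately show ?thesis using assms by (smt (verit) mult_nonneg_nonneg)
  qed
  then have "ln ((z + x + y) * z * ((z' + x) * (z' + y))) \<le> ln ((z' + x + y) * z' * ((z + x) * (z + y)))"
    using assms by (subst ln_le_cancel_iff) auto
  then show ?thesis using assms by (simp add: xlnx_diff2'_def ln_mult)
qed

lemma xlnx_diff2'_nonpos:
  assumes "0 \<le> x" "0 \<le> y" "0 < z"
  shows "xlnx_diff2' x y z \<le> 0"
proof -
  have "(z + x + y) * z \<le> (z + x) * (z + y)" using assms by (simp add: algebra_simps)
  then have "ln ((z + x + y) * z) \<le> ln ((z + x) * (z + y))"
    using assms by (subst ln_le_cancel_iff) auto
  then show ?thesis using assms by (simp add: xlnx_diff2'_def ln_mult)
qed

lemma xlnx_diff2_antimono: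
  assumes "0 \<le> x" "0 \<le> y" "0 \<le> z" "z \<le> z'"
  shows "xlnx_diff2 x y z' \<le> xlnx_diff2 x y z"
  using assms(4)
proof (rule DERIV_nonpos_imp_decreasing_open)
  show "\<exists>d. (xlnx_diff2 x y has_real_derivative d) (at t) \<and> d \<le> 0" if "z < t" for t
    using that assms xlnx_diff2_deriv[of x y t] xlnx_diff2'_nonpos[of x y t] by auto
qed (use assms in \<open>auto intro: xlnx_diff2_cont\<close>)

lemma xlnx_diff2_tangent:
  assumes "0 \<le> x" "0 \<le> y" "0 \<le> z" "0 < z0"
  shows "xlnx_diff2 x y z0 + xlnx_diff2' x y z0 * (z - z0) \<le> xlnx_diff2 x y z"
proof -
  define g where "g t = xlnx_diff2 x y t - xlnx_diff2' x y z0 * t" for t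
  have d: "(g has_real_derivative xlnx_diff2' x y t - xlnx_diff2' x y z0) (at t)" if "0 < t" for t
    unfolding g_def[abs_def] using that assms by (auto intro!: derivative_eq_intros xlnx_diff2_deriv)
  have c: "continuous_on {a..b} g" if "0 \<le> a" for a b
    unfolding g_def[abs_def] using that assms by (intro continuous_intros xlnx_diff2_cont) auto
  have "g z0 \<le> g z"
  proof (cases "z \<le> z0")
    case True
    then show ?thesis
    proof (rule DERIV_nonpos_imp_decreasing_open)
      show "\<exists>d. (g has_real_derivative d) (at t) \<and> d \<le> 0" if "z < t" "t < z0" for t
        using that assms d[of t] xlnx_diff2'_mono[of x y t z0] by fastforce
    qed (use assms c in auto)
  next
    case False
    then have "z0 \<le> z" by simp
    then show ?thesis
    proof (rule DERIV_nonneg_imp_increasing_open)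
      show "\<exists>d. (g has_real_derivative d) (at t) \<and> 0 \<le> d" if "z0 < t" "t < z" for t
        using that assms d[of t] xlnx_diff2'_mono[of x y z0 t] by fastforce
    qed (use assms c in auto)
  qed
  then show ?thesis by (simp add: g_def algebra_simps)
qed

text \<open>Derivatives are demanded in the open interval only, because \<open>xlnx\<close> has
  infinite slope at 0 and the intervals used below may start there.\<close>

lemma concave_nonneg_between:
  fixes f :: "real \<Rightarrow> real"
  assumes cont: "continuous_on {0..b} f"
    and d1: "\<And>t. 0 < t \<Longrightarrow> t < b \<Longrightarrow> (f has_real_derivative f' t) (at t)"
    and d2: "\<And>t. 0 < t \<Longrightarrow> t < b \<Longrightarrow> (f' has_real_derivative f'' t) (at t)"
    and neg: "\<And>t. 0 < t \<Longrightarrow> t < b \<Longrightarrow> f'' t \<le> 0"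
    and ends: "0 \<le> f 0" "0 \<le> f b" and t: "0 \<le> t" "t \<le> b"
  shows "0 \<le> f t"
proof (rule ccontr)
  assume "\<not> 0 \<le> f t"
  then have ft: "f t < 0" by simp
  then have t': "0 < t" "t < b" using ends t by (auto simp: order.strict_iff_order)
  have diff: "f differentiable (at s)" if "0 < s" "s < b" for s
    using d1[OF that] by (auto simp: real_differentiable_def)
  have "\<exists>l z. 0 < z \<and> z < t \<and> (f has_real_derivative l) (at z) \<and> f t - f 0 = (t - 0) * l"
    using t' diff continuous_on_subset[OF cont, of "{0..t}"] by (intro MVT) auto
  then obtain l z where z: "0 < z" "z < t" "(f has_real_derivative l) (at z)" "f t - f 0 = t * l" by auto
  have "\<exists>m s. t < s \<and> s < b \<and> (f has_real_derivative m) (at s) \<and> f b - f t = (b - t) * m"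
    using t' diff continuous_on_subset[OF cont, of "{t..b}"] by (intro MVT) auto
  then obtain m s where s: "t < s" "s < b" "(f has_real_derivative m) (at s)" "f b - f t = (b - t) * m" by auto
  have "l = f' z" "m = f' s" using DERIV_unique[OF z(3) d1] DERIV_unique[OF s(3) d1] z s t' by auto
  moreover have "f' s \<le> f' z"
  proof (rule DERIV_nonpos_imp_nonincreasing[of z s])
    show "\<exists>y. (f' has_real_derivative y) (at x) \<and> y \<le> 0" if "z \<le> x" "x \<le> s" for x
      using that z s d2[of x] neg[of x] by auto
  qed (use z s in auto)
  moreover have "l < 0" using z(4) ft ends(1) t' by (smt (verit) mult_nonneg_nonneg)
  moreover have "0 < m" using s(4) ft ends(2) t' by (smt (verit) mult_nonneg_nonpos)
  ultimately show False by simp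
qed

lemma divide_le_divide_cross:
  fixes u v P Q :: real
  shows "0 < P \<Longrightarrow> 0 < Q \<Longrightarrow> u * P \<le> v * Q \<Longrightarrow> u / Q \<le> v / P"
  by (simp add: field_simps)

lemma recip_add_neg:
  fixes p q :: real
  shows "p \<noteq> 0 \<Longrightarrow> q \<noteq> 0 \<Longrightarrow> - 1 / p - 1 / q = - ((p + q) / (p * q))"
  by (simp add: field_simps)

text \<open>As a function of \<open>y\<close> the difference vanishes at 0, and \<open>cond\<close>
  makes its second derivative nonpositive; so its sign at y = b decides the whole segment.\<close>

lemma xlnx_diff2_compare_row:
  assumes a: "0 \<le> a" and k: "0 \<le> k" and x: "0 \<le> x"
    and cond: "\<And>y. 0 < y \<Longrightarrow> y < b \<Longrightarrow> k * ((a + y) * (a + x + y)) \<le> (1 + y) * (1 + x + y)"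
    and "0 \<le> xlnx_diff2 x b a - k * xlnx_diff2 x b 1" and y: "0 \<le> y" "y \<le> b"
  shows "0 \<le> xlnx_diff2 x y a - k * xlnx_diff2 x y 1"
proof (rule concave_nonneg_between[where b = b and t = y and
    f' = "\<lambda>y. ln (a + x + y) - ln (a + y) - k * (ln (1 + x + y) - ln (1 + y))" and
    f'' = "\<lambda>y. 1 / (a + x + y) - 1 / (a + y) - k * (1 / (1 + x + y) - 1 / (1 + y))"])
  show "continuous_on {0..b} (\<lambda>y. xlnx_diff2 x y a - k * xlnx_diff2 x y 1)"
    unfolding xlnx_diff2_def using a x by (intro continuous_intros) auto
next
  fix t assume t: "0 < t" "t < b"
  show "((\<lambda>y. xlnx_diff2 x y a - k * xlnx_diff2 x y 1) has_real_derivative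
     ln (a + x + t) - ln (a + t) - k * (ln (1 + x + t) - ln (1 + t))) (at t)"
    unfolding xlnx_diff2_def using a x t by (auto intro!: derivative_eq_intros simp: algebra_simps)
  show "((\<lambda>y. ln (a + x + y) - ln (a + y) - k * (ln (1 + x + y) - ln (1 + y))) has_real_derivative
     1 / (a + x + t) - 1 / (a + t) - k * (1 / (1 + x + t) - 1 / (1 + t))) (at t)"
    using a x t by (auto intro!: derivative_eq_intros)
  have e: "1 / (c + x + t) - 1 / (c + t) = - (x / ((c + t) * (c + x + t)))" if "0 \<le> c" for c
    using that x t by (simp add: field_simps)
  have pos: "0 < (a + t) * (a + x + t)" "0 < (1 + t) * (1 + x + t)" using a x t by (auto intro!: mult_pos_pos)
  have "k * x * ((a + t) * (a + x + t)) \<le> x * ((1 + t) * (1 + x + t))"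
    using mult_left_mono[OF cond[OF t] x] by (simp add: algebra_simps)
  then have "k * x / ((1 + t) * (1 + x + t)) \<le> x / ((a + t) * (a + x + t))"
    by (rule divide_le_divide_cross[OF pos])
  then show "1 / (a + x + t) - 1 / (a + t) - k * (1 / (1 + x + t) - 1 / (1 + t)) \<le> 0"
    unfolding e[OF a] e[OF zero_le_one] by simp
qed (use assms in auto)

lemma xlnx_diff2_compare_square:
  assumes "0 \<le> x" "x \<le> 1" "0 \<le> y" "y \<le> 1"
  shows "5 * xlnx_diff2 x y 1 \<le> 2 * xlnx_diff2 x y 0"
proof -
  have cond: "5 / 2 * ((0 + y) * (0 + x + y)) \<le> (1 + y) * (1 + x + y)"
    if "0 \<le> x" "x \<le> 1" "0 < y" "y < 1" for x y :: real
  proof -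
    have "(2 * y) * (3 / 2 * (x + y)) \<le> (1 + y) * (1 + x + y)" using that by (intro mult_mono) auto
    moreover have "0 \<le> y * (x + y)" using that by simp
    ultimately show ?thesis by (simp add: algebra_simps)
  qed
  have sym: "xlnx_diff2 x y z = xlnx_diff2 y x z" for x y z by (simp add: xlnx_diff2_def algebra_simps)
  \<comment> \<open>The corner x = y = 1, to which two applications of the row comparison reduce the
    square, amounts to 3^15 <= 2^24.\<close>
  have l: "15 * ln 3 \<le> 24 * ln (2::real)"
  proof -
    have "ln ((3::real) ^ 15) \<le> ln (2 ^ 24)" by (subst ln_le_cancel_iff) auto
    moreover have "ln ((3::real) ^ 15) = real 15 * ln 3" "ln ((2::real) ^ 24) = real 24 * ln 2"
      by (rule ln_realpow; simp)+
    ultimately show ?thesis by linarith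
  qed
  have 1: "0 \<le> xlnx_diff2 1 1 0 - 5 / 2 * xlnx_diff2 1 1 1"
    using l by (simp add: xlnx_diff2_def xlnx_def)
  have 2: "0 \<le> xlnx_diff2 1 x 0 - 5 / 2 * xlnx_diff2 1 x 1"
    by (rule xlnx_diff2_compare_row[OF _ _ _ cond[of 1] 1]) (use assms in auto)
  then have 3: "0 \<le> xlnx_diff2 x 1 0 - 5 / 2 * xlnx_diff2 x 1 1"
    by (simp only: sym[of x 1])
  have "0 \<le> xlnx_diff2 x y 0 - 5 / 2 * xlnx_diff2 x y 1"
    by (rule xlnx_diff2_compare_row[OF order_refl _ assms(1) cond[OF assms(1,2)] 3 assms(3,4)]) simp_all
  then show ?thesis by simp
qed

lemma xlnx_diff2_compare_triangle:
  assumes a: "0 \<le> a" "a < 1" and xy: "0 \<le> x" "0 \<le> y" "x + y \<le> 1 - a"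
  shows "(3 - a) / (1 + a) * xlnx_diff2 x y 1 \<le> xlnx_diff2 x y a"
proof -
  define k where "k = (3 - a) / (1 + a)"
  have "0 \<le> k" using a by (simp add: k_def)
  \<comment> \<open>On the hypotenuse y = 1 - a - x the difference vanishes at both ends, where x =
    0 or y = 0, so concavity along it suffices.\<close>
  have ends: "0 \<le> xlnx_diff2 x (1 - a - x) a - k * xlnx_diff2 x (1 - a - x) 1"
  proof (rule concave_nonneg_between[where b = "1 - a" and t = x and
    f' = "\<lambda>x. - ln (a + x) + ln (1 - x) - k * (- ln (1 + x) + ln (2 - a - x))" and
    f'' = "\<lambda>x. - 1 / (a + x) - 1 / (1 - x) - k * (- 1 / (1 + x) - 1 / (2 - a - x))"])
    show "continuous_on {0..1 - a} (\<lambda>x. xlnx_diff2 x (1 - a - x) a - k * xlnx_diff2 x (1 - a - x) 1)"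
      unfolding xlnx_diff2_def using a by (intro continuous_intros) auto
  next
    fix t assume t: "0 < t" "t < 1 - a"
    show "((\<lambda>x. xlnx_diff2 x (1 - a - x) a - k * xlnx_diff2 x (1 - a - x) 1) has_real_derivative
      - ln (a + t) + ln (1 - t) - k * (- ln (1 + t) + ln (2 - a - t))) (at t)"
      unfolding xlnx_diff2_def using a t by (auto intro!: derivative_eq_intros simp: algebra_simps)
    show "((\<lambda>x. - ln (a + x) + ln (1 - x) - k * (- ln (1 + x) + ln (2 - a - x))) has_real_derivative
      - 1 / (a + t) - 1 / (1 - t) - k * (- 1 / (1 + t) - 1 / (2 - a - t))) (at t)"
      using a t by (auto intro!: derivative_eq_intros simp del: minus_divide_left)
    have pos: "0 < (a + t) * (1 - t)" "0 < (1 + t) * (2 - a - t)" using a t by (auto intro!: mult_pos_pos)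
    \<comment> \<open>The square is centred at the midpoint of the hypotenuse. There the concavity
      condition holds with equality, so (3 - a) / (1 + a) is the largest constant for which it can
      hold.\<close>
    have "(1 + a)\<^sup>2 * ((1 + t) * (2 - a - t)) - (3 - a)\<^sup>2 * ((a + t) * (1 - t))
       = ((3 - a)\<^sup>2 - (1 + a)\<^sup>2) * (t - (1 - a) / 2)\<^sup>2"
      by (simp add: power2_eq_square field_simps)
    moreover have "(1 + a)\<^sup>2 \<le> (3 - a)\<^sup>2" using a by (intro power_mono) auto
    ultimately have "(3 - a)\<^sup>2 * ((a + t) * (1 - t)) \<le> (1 + a)\<^sup>2 * ((1 + t) * (2 - a - t))"
      by (smt (verit) mult_nonneg_nonneg zero_le_power2)
    then have "(3 - a)\<^sup>2 / ((1 + t) * (2 - a - t)) \<le> (1 + a)\<^sup>2 / ((a + t) * (1 - t))"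
      by (rule divide_le_divide_cross[OF pos])
    then have "(3 - a)\<^sup>2 / ((1 + t) * (2 - a - t)) / (1 + a) \<le> (1 + a)\<^sup>2 / ((a + t) * (1 - t)) / (1 + a)"
      using a by (intro divide_right_mono) auto
    moreover have "k * (- 1 / (1 + t) - 1 / (2 - a - t)) = - ((3 - a)\<^sup>2 / ((1 + t) * (2 - a - t)) / (1 + a))"
    proof -
      have n: "1 + t \<noteq> 0" "2 - a - t \<noteq> 0" and e: "(1 + t) + (2 - a - t) = 3 - a" using a t by auto
      show ?thesis unfolding k_def recip_add_neg[OF n] e by (simp add: power2_eq_square)
    qed
    moreover have "- 1 / (a + t) - 1 / (1 - t) = - ((1 + a)\<^sup>2 / ((a + t) * (1 - t)) / (1 + a))"
    proof -
      have n: "a + t \<noteq> 0" "1 - t \<noteq> 0" and e: "(a + t) + (1 - t) = 1 + a" and "1 + a \<noteq> 0" using a t by auto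
      then show ?thesis unfolding recip_add_neg[OF n] e by (simp add: power2_eq_square)
    qed
    ultimately show "- 1 / (a + t) - 1 / (1 - t) - k * (- 1 / (1 + t) - 1 / (2 - a - t)) \<le> 0"
      by linarith
  qed (use xy in auto)
  \<comment> \<open>The constant is first replaced by (2 - a)^2, whose two factors are absorbed one
    each by a + s and a + x + s.\<close>
  have cond: "k * ((a + s) * (a + x + s)) \<le> (1 + s) * (1 + x + s)" if s: "0 < s" "s < 1 - a - x" for s
  proof -
    have "0 \<le> (1 - a) * (1 + a * (2 - a))" using a by (intro mult_nonneg_nonneg add_nonneg_nonneg) auto
    then have "3 - a \<le> (2 - a)\<^sup>2 * (1 + a)" by (simp add: power2_eq_square algebra_simps)
    then have "k \<le> (2 - a)\<^sup>2" unfolding k_def using a by (simp add: divide_le_eq)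
    then have "k * ((a + s) * (a + x + s)) \<le> (2 - a)\<^sup>2 * ((a + s) * (a + x + s))"
      using a s xy by (intro mult_right_mono) auto
    also have "\<dots> = ((2 - a) * (a + s)) * ((2 - a) * (a + x + s))" by (simp add: power2_eq_square mult_ac)
    also have "\<dots> \<le> (1 + s) * (1 + x + s)"
    proof -
      have *: "(2 - a) * (a + w) \<le> 1 + w" if "w \<le> 1 - a" for w
      proof -
        have "0 \<le> (1 - a) * (1 - a - w)" using that a by (intro mult_nonneg_nonneg) auto
        then show ?thesis by (simp add: algebra_simps)
      qed
      show ?thesis
        using *[of s] *[of "x + s"] s xy a by (intro mult_mono mult_nonneg_nonneg) (auto simp: add.assoc)
    qed
    finally show ?thesis .
  qed
  have "0 \<le> xlnx_diff2 x y a - k * xlnx_diff2 x y 1"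
    by (rule xlnx_diff2_compare_row[OF a(1) \<open>0 \<le> k\<close> xy(1) cond ends xy(2)]) (use xy in auto)
  then show ?thesis by (simp add: k_def)
qed

section \<open>Averages over random tails\<close>

lemma sum_Pow_insert:
  assumes "finite A" "a \<notin> A"
  shows "(\<Sum>T\<in>Pow (insert a A). F T) = (\<Sum>T\<in>Pow A. F T + F (insert a T))"
proof -
  have "inj_on (insert a) (Pow A)" using assms by (auto simp: inj_on_def)
  then have "(\<Sum>T\<in>insert a ` Pow A. F T) = (\<Sum>T\<in>Pow A. F (insert a T))"
    by (simp add: sum.reindex)
  moreover have "Pow A \<inter> insert a ` Pow A = {}" using assms by auto
  ultimately show ?thesis using assms
    by (simp add: Pow_insert sum.union_disjoint sum.distrib)
qed

lemma sum_Pow_card: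
  assumes "finite A"
  shows "(\<Sum>T\<in>Pow A. \<phi> (card T)) = (\<Sum>t\<le>card A. real (card A choose t) * \<phi> t)"
proof -
  have "(\<Sum>T\<in>Pow A. \<phi> (card T)) = (\<Sum>t\<in>{..card A}. \<Sum>T\<in>{T\<in>Pow A. card T = t}. \<phi> (card T))"
    using assms by (intro sum.group[symmetric]) (auto intro: card_mono)
  also have "\<dots> = (\<Sum>t\<le>card A. real (card A choose t) * \<phi> t)"
  proof (rule sum.cong)
    fix t
    have "{T\<in>Pow A. card T = t} = {T. T \<subseteq> A \<and> card T = t}" by auto
    then show "(\<Sum>T\<in>{T\<in>Pow A. card T = t}. \<phi> (card T)) = real (card A choose t) * \<phi> t"
      using n_subsets[OF assms, of t] by simp
  qed simp
  finally show ?thesis .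
qed

text \<open>Order N + 2 elements at random, two of them being a and b. For a set T of t of the other
  N elements, this is the probability that exactly T follows a, so that b precedes a.\<close>

definition subset_weight :: "nat \<Rightarrow> nat \<Rightarrow> real" where
  "subset_weight N t = fact t * fact (N + 1 - t) / fact (N + 2)"

lemma subset_weight_nonneg [simp]: "0 \<le> subset_weight N t"
  by (simp add: subset_weight_def)

lemma fact_subset_weight:
  "subset_weight (t + s) t = fact t * fact s * real (s + 1) / (real (t + s + 1) * real (t + s + 2) * fact (t + s))"
proof -
  have "fact (t + s + 2) = real (t + s + 1) * real (t + s + 2) * fact (t + s)"
    by (simp add: algebra_simps)
  moreover have "fact (t + s + 1 - t) = real (s + 1) * fact s" by simp
  ultimately show ?thesis by (simp only: subset_weight_def) (simp add: mult_ac)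
qed

text \<open>The total is the probability that b precedes a in the random order behind
  \<open>subset_weight\<close>.\<close>

lemma sum_subset_weight:
  assumes "finite R"
  shows "(\<Sum>T\<in>Pow R. subset_weight (card R) (card T)) = 1 / 2"
proof -
  define N where "N = card R"
  have *: "(\<Sum>t\<le>n. c - real t) = real (n + 1) * c - real n * real (n + 1) / 2" for c n
    by (induction n) (auto simp: field_simps)
  have "(\<Sum>T\<in>Pow R. subset_weight N (card T)) = (\<Sum>t\<le>N. real (N choose t) * subset_weight N t)"
    unfolding N_def by (rule sum_Pow_card[OF assms])
  also have "\<dots> = (\<Sum>t\<le>N. (real (N + 1) - real t) / (real (N + 1) * real (N + 2)))"
  proof (rule sum.cong)
    fix t assume "t \<in> {..N}"
    then have t: "t \<le> N" by simp
    obtain s where s: "N = t + s" using t le_Suc_ex by blast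
    show "real (N choose t) * subset_weight N t = (real (N + 1) - real t) / (real (N + 1) * real (N + 2))"
      unfolding s fact_subset_weight by (simp add: binomial_fact)
  qed simp
  also have "\<dots> = (1 / 2 * (real (N + 1) * real (N + 2))) / (real (N + 1) * real (N + 2))"
    unfolding sum_divide_distrib[symmetric] * by (rule arg_cong2[where f = "(/)"]) (auto simp: field_simps)
  also have "\<dots> = 1 / 2" by (rule nonzero_mult_div_cancel_right) simp
  finally show ?thesis by (simp add: N_def)
qed

text \<open>An element j belongs to the tail exactly when b, a, j occur in this order, one of six
  equally likely ones.\<close>

lemma sum_subset_weight_moment:
  assumes "finite R"
  shows "(\<Sum>T\<in>Pow R. subset_weight (card R) (card T) * sum p T) = sum p R / 6"
proof -
  define N where "N = card R"
  have *: "(\<Sum>t\<le>n. real (t + 1) * (c - real t))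
      = c * real (n + 1) * real (n + 2) / 2 - real n * real (n + 1) * real (n + 2) / 3" for c n
    by (induction n) (auto simp: field_simps)
  have one: "(\<Sum>T\<in>Pow R. if j \<in> T then subset_weight N (card T) else 0) = 1 / 6" if j: "j \<in> R" for j
  proof -
    define S where "S = R - {j}"
    have S: "R = insert j S" "j \<notin> S" "finite S" using j assms by (auto simp: S_def)
    define n where "n = card S"
    have N: "N = n + 1" using S by (simp add: N_def n_def)
    have "(\<Sum>T\<in>Pow R. if j \<in> T then subset_weight N (card T) else 0)
       = (\<Sum>T\<in>Pow S. (if j \<in> T then subset_weight N (card T) else 0) + subset_weight N (card (insert j T)))"
      unfolding S(1) using S by (subst sum_Pow_insert) auto
    also have "\<dots> = (\<Sum>T\<in>Pow S. subset_weight N (card T + 1))"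
    proof (rule sum.cong)
      fix T assume "T \<in> Pow S"
      then have "j \<notin> T" "finite T" using S finite_subset by auto
      then show "(if j \<in> T then subset_weight N (card T) else 0) + subset_weight N (card (insert j T))
        = subset_weight N (card T + 1)" by simp
    qed simp
    also have "\<dots> = (\<Sum>t\<le>n. real (n choose t) * subset_weight N (t + 1))"
      unfolding n_def using S(3) by (rule sum_Pow_card)
    also have "\<dots> = (\<Sum>t\<le>n. real (t + 1) * (real (n + 1) - real t) / (real (n + 1) * real (n + 2) * real (n + 3)))"
    proof (rule sum.cong)
      fix t assume "t \<in> {..n}"
      then have t: "t \<le> n" by simp
      obtain s where s: "n = t + s" using t le_Suc_ex by blast
      have e: "t + s + 1 = (t + 1) + s" by simp
      have f: "fact (t + 1 + s) = real (t + s + 1) * fact (t + s)" "fact (t + 1) = real (t + 1) * fact t"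
        by simp_all
      show "real (n choose t) * subset_weight N (t + 1)
          = real (t + 1) * (real (n + 1) - real t) / (real (n + 1) * real (n + 2) * real (n + 3))"
        unfolding N s e fact_subset_weight f by (simp add: binomial_fact)
    qed simp
    also have "\<dots> = (1 / 6 * (real (n + 1) * real (n + 2) * real (n + 3))) / (real (n + 1) * real (n + 2) * real (n + 3))"
      unfolding sum_divide_distrib[symmetric] * by (rule arg_cong2[where f = "(/)"]) (auto simp: field_simps)
    also have "\<dots> = 1 / 6" by (rule nonzero_mult_div_cancel_right) simp
    finally show ?thesis .
  qed
  have "(\<Sum>T\<in>Pow R. subset_weight N (card T) * sum p T)
     = (\<Sum>T\<in>Pow R. \<Sum>j\<in>R. p j * (if j \<in> T then subset_weight N (card T) else 0))"
  proof (rule sum.cong)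
    fix T assume T: "T \<in> Pow R"
    have "(\<Sum>j\<in>R. p j * (if j \<in> T then subset_weight N (card T) else 0))
       = (\<Sum>j\<in>T. p j * (if j \<in> T then subset_weight N (card T) else 0))"
      using T assms by (intro sum.mono_neutral_right) auto
    also have "\<dots> = subset_weight N (card T) * sum p T"
      by (simp add: sum_distrib_right mult.commute)
    finally show "subset_weight N (card T) * sum p T
      = (\<Sum>j\<in>R. p j * (if j \<in> T then subset_weight N (card T) else 0))" by simp
  qed simp
  also have "\<dots> = (\<Sum>j\<in>R. p j * (\<Sum>T\<in>Pow R. if j \<in> T then subset_weight N (card T) else 0))"
    by (subst sum.swap) (simp add: sum_distrib_left)
  also have "\<dots> = (\<Sum>j\<in>R. p j * (1 / 6))"
    using one by (intro sum.cong) auto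
  finally show ?thesis by (simp add: N_def sum_divide_distrib)
qed

text \<open>
  Merging the two smallest masses \<open>x \<le> y\<close> increases the defect in
  \<open>subset_entropy_le\<close> below, which leaves two masses only. For three or four masses
  the summand \<open>T = {}\<close> and monotonicity are enough; from five on a tangent at one third of the
  remaining mass is needed.
\<close>

lemma merge_gain:
  fixes p :: "'a \<Rightarrow> real"
  assumes fin: "finite R" "R \<noteq> {}" and xy: "0 \<le> x" "x \<le> y" and p: "\<And>j. j \<in> R \<Longrightarrow> y \<le> p j"
    and pos: "0 < sum p R"
  shows "xlnx_diff2 x y (sum p R) \<le> (\<Sum>T\<in>Pow R. subset_weight (card R) (card T) * xlnx_diff2 x y (sum p T))"
proof -
  define r where "r = sum p R"
  define N where "N = card R"
  let ?d = "\<lambda>T :: 'a set. subset_weight N (card T)"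
  let ?f = "xlnx_diff2 x y"
  have y0: "0 \<le> y" using xy by simp
  have pj: "0 \<le> p j" if "j \<in> R" for j using p[OF that] y0 by linarith
  have pT: "0 \<le> sum p T" "sum p T \<le> r" if "T \<subseteq> R" for T
    using that pj fin unfolding r_def by (auto intro!: sum_nonneg sum_mono2)
  have r: "0 < r" using pos by (simp add: r_def)
  have Ny: "real N * y \<le> r"
    using sum_mono[of R "\<lambda>_. y" p] p by (simp add: N_def r_def)
  have scale: "?f (r * z) = r * xlnx_diff2 (x / r) (y / r) z" if "0 \<le> z" for z
    using xlnx_diff2_scale[of r "x / r" "y / r" z] r xy that by simp
  have "N \<noteq> 0" using fin by (simp add: N_def)
  then consider "N = 1" | "N = 2" | "3 \<le> N" by linarith
  then have "?f r \<le> (\<Sum>T\<in>Pow R. ?d T * ?f (sum p T))"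
  proof cases
    case 3
    \<comment> \<open>Conditioned on b before a the mean mass of the tail is (r / 6) / (1 / 2), so
      the linear term of the tangent at this point averages to 0.\<close>
    let ?z = "r / 3"
    have "?f ?z / 2 = (\<Sum>T\<in>Pow R. ?d T * (?f ?z + xlnx_diff2' x y ?z * (sum p T - ?z)))"
    proof -
      have lin: "(\<Sum>T\<in>X. d T * (A + B * (g T - z))) = (A - B * z) * (\<Sum>T\<in>X. d T) + B * (\<Sum>T\<in>X. d T * g T)"
        for X :: "'a set set" and d g :: "'a set \<Rightarrow> real" and A B z
        unfolding sum_distrib_left sum.distrib[symmetric]
        by (intro sum.cong refl) (simp add: algebra_simps)
      show ?thesis
        unfolding lin N_def sum_subset_weight[OF fin(1)] sum_subset_weight_moment[OF fin(1)]
        by (simp add: r_def algebra_simps)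
    qed
    also have "\<dots> \<le> (\<Sum>T\<in>Pow R. ?d T * ?f (sum p T))"
      using pT r xy y0 by (intro sum_mono mult_left_mono xlnx_diff2_tangent) auto
    finally have 1: "?f ?z / 2 \<le> (\<Sum>T\<in>Pow R. ?d T * ?f (sum p T))" .
    \<comment> \<open>Each of at least three masses is at least y and x <= y, so x + y is at most
      two thirds of \<open>r\<close>; this is the triangle comparison at a = 1/3, with constant
      2.\<close>
    have "3 * y \<le> real N * y" using 3 y0 by (intro mult_right_mono) auto
    then have "x / r + y / r \<le> 1 - 1 / 3" using r xy Ny by (simp add: field_simps)
    then have "2 * xlnx_diff2 (x / r) (y / r) 1 \<le> xlnx_diff2 (x / r) (y / r) (1 / 3)"
      using xlnx_diff2_compare_triangle[of "1/3" "x / r" "y / r"] r xy by simp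
    then have "2 * ?f r \<le> ?f ?z"
      using scale[of 1] scale[of "1/3"] r by simp
    then show ?thesis using 1 by simp
  next
    \<comment> \<open>The other summands are only bounded by monotonicity. The empty tail has weight
      1/3 for N = 1 and 1/4 for N = 2, so the value at 0 must exceed the value at \<open>r\<close>
      by the factors 5/2 and 3, which the square and the triangle comparison supply.\<close>
    have "?d {} * (?f (sum p {}) - ?f r) \<le> (\<Sum>T\<in>Pow R. ?d T * (?f (sum p T) - ?f r))"
      by (rule member_le_sum[where f = "\<lambda>T. ?d T * (?f (sum p T) - ?f r)"])
        (use fin pT xy y0 in \<open>auto intro!: mult_nonneg_nonneg xlnx_diff2_antimono\<close>)
    also have "\<dots> = (\<Sum>T\<in>Pow R. ?d T * ?f (sum p T)) - (\<Sum>T\<in>Pow R. ?d T) * ?f r"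
      by (simp add: algebra_simps sum_subtractf sum_distrib_left)
    also have "(\<Sum>T\<in>Pow R. ?d T) = 1 / 2" unfolding N_def by (rule sum_subset_weight[OF fin(1)])
    finally have low: "subset_weight N 0 * (?f 0 - ?f r) + ?f r / 2 \<le> (\<Sum>T\<in>Pow R. ?d T * ?f (sum p T))" by simp
    {
      case 1
      then have "x / r \<le> 1" "y / r \<le> 1" using Ny xy r by auto
      then have "5 * xlnx_diff2 (x / r) (y / r) 1 \<le> 2 * xlnx_diff2 (x / r) (y / r) 0"
        using r xy by (intro xlnx_diff2_compare_square) auto
      then have "5 * ?f r \<le> 2 * ?f 0" using scale[of 1] scale[of 0] r by simp
      moreover have w: "subset_weight N 0 = 1 / 3" using 1 by (simp add: subset_weight_def fact_numeral)
      ultimately show ?thesis using low unfolding w by (simp add: field_simps)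
    next
      case 2
      then have "x / r + y / r \<le> 1 - 0" using Ny xy r by (simp add: field_simps)
      then have "3 * xlnx_diff2 (x / r) (y / r) 1 \<le> xlnx_diff2 (x / r) (y / r) 0"
        using xlnx_diff2_compare_triangle[of 0 "x / r" "y / r"] r xy by simp
      then have "3 * ?f r \<le> ?f 0" using scale[of 1] scale[of 0] r by simp
      moreover have w: "subset_weight N 0 = 1 / 4" using 2 by (simp add: subset_weight_def fact_numeral)
      ultimately show ?thesis using low unfolding w by (simp add: field_simps)
    }
  qed
  then show ?thesis by (simp add: r_def N_def)
qed

text \<open>
  The mean of \<open>\<Sum>j. p j * ln (S j)\<close> over all orderings of \<open>J\<close>, where
  \<open>S j\<close> is the mass of \<open>j\<close> and everything after it; the coefficient of \<open>T\<close> is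
  \<open>1 / card T\<close> times the probability that \<open>T\<close> is a tail of the ordering.
\<close>

definition subset_entropy :: "('a \<Rightarrow> real) \<Rightarrow> 'a set \<Rightarrow> real" where
  "subset_entropy p J = (\<Sum>T\<in>Pow J. fact (card T - 1) * fact (card J - card T) / fact (card J) * xlnx (sum p T))"

text \<open>Subsets are grouped by their trace T on \<open>R\<close>. Passing from card R + 2 to
  card R + 1 elements, the coefficients of T and of T with both points each gain
  \<open>subset_weight\<close>, while sets with just one of the two points, whose coefficient is
  \<open>subset_weight\<close>, disappear: together a mixed second difference.\<close>

lemma subset_entropy_merge:
  fixes p :: "'a \<Rightarrow> real"
  assumes fin: "finite R" and ab: "a \<notin> R" "b \<notin> R" "a \<noteq> b"
  shows "subset_entropy (p(a := p a + p b)) (insert a R) = subset_entropy p (insert a (insert b R))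
    + (\<Sum>T\<in>Pow R. subset_weight (card R) (card T) * xlnx_diff2 (p a) (p b) (sum p T))"
proof -
  define N where "N = card R"
  let ?c = "\<lambda>n t. fact (t - 1) * fact (n - t) / fact n :: real"
  let ?p = "p(a := p a + p b)"
  have "subset_entropy ?p (insert a R)
    = (\<Sum>T\<in>Pow R. ?c (N + 1) (card T) * xlnx (sum ?p T)
         + ?c (N + 1) (card (insert a T)) * xlnx (sum ?p (insert a T)))"
    unfolding subset_entropy_def using fin ab by (simp add: sum_Pow_insert N_def)
  also have "\<dots> = (\<Sum>T\<in>Pow R.
      (?c (N + 2) (card T) * xlnx (sum p T) + ?c (N + 2) (card (insert b T)) * xlnx (sum p (insert b T)))
      + (?c (N + 2) (card (insert a T)) * xlnx (sum p (insert a T))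
        + ?c (N + 2) (card (insert a (insert b T))) * xlnx (sum p (insert a (insert b T))))
     + subset_weight N (card T) * xlnx_diff2 (p a) (p b) (sum p T))"
  proof (rule sum.cong)
    fix T assume "T \<in> Pow R"
    then have T: "a \<notin> T" "b \<notin> T" "finite T" and tN: "card T \<le> N"
      using fin ab finite_subset by (auto simp: N_def intro: card_mono)
    define t where "t = card T"
    obtain s where s: "N = t + s" using tN le_Suc_ex t_def by blast
    have sp: "sum ?p T = sum p T" using T by (intro sum.cong) auto
    define F where "F = (fact (t + s + 1) :: real)"
    have F: "F \<noteq> 0" "fact (t + s + 2) = (real (t + s) + 2) * F" by (simp_all add: F_def)
    have split: "A / F = (x * A) / ((x + y) * F) + (y * A) / ((x + y) * F)" if "x + y \<noteq> 0" for A x y :: real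
      using that F(1) by (simp add: add_divide_distrib[symmetric] distrib_right[symmetric])
    have w1: "?c (N + 1) (t + 1) = ?c (N + 2) (t + 2) + subset_weight N t"
    proof -
      have "fact t * fact s / F = fact (t + 1) * fact s / ((real (t + s) + 2) * F)
         + fact t * fact (s + 1) / ((real (t + s) + 2) * F)"
        using split[of "real (t + 1)" "real (s + 1)" "fact t * fact s"] by (simp add: mult_ac add_ac)
      then show ?thesis unfolding s subset_weight_def F(2) by (simp add: F_def)
    qed
    have w2: "?c (N + 2) (t + 1) = subset_weight N t"
      unfolding s subset_weight_def by simp
    have w3: "?c (N + 1) t * xlnx (sum p T) = (?c (N + 2) t + subset_weight N t) * xlnx (sum p T)"
    \<comment> \<open>For empty T the natural number t - 1 is 0 and the identity of the coefficients
      fails; the claim survives because \<open>xlnx 0\<close> is 0.\<close>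
    proof (cases t)
      case 0
      then show ?thesis using T by (simp add: t_def)
    next
      case (Suc u)
      have "fact u * fact (s + 1) / F = fact u * fact (s + 2) / ((real (t + s) + 2) * F)
         + fact t * fact (s + 1) / ((real (t + s) + 2) * F)"
        using split[of "real (s + 2)" "real (u + 1)" "fact u * fact (s + 1)"]
        by (simp add: mult_ac add_ac Suc)
      then have "?c (N + 1) t = ?c (N + 2) t + subset_weight N t"
        unfolding s subset_weight_def F(2) by (simp add: F_def Suc)
      then show ?thesis by simp
    qed
    have cards: "card (insert a T) = t + 1" "card (insert b T) = t + 1" "card (insert a (insert b T)) = t + 2"
      using T ab by (auto simp: t_def)
    have sums: "sum ?p (insert a T) = sum p T + p a + p b" "sum p (insert a T) = sum p T + p a"
      "sum p (insert b T) = sum p T + p b" "sum p (insert a (insert b T)) = sum p T + p a + p b"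
      using T ab sp by auto
    show "?c (N + 1) (card T) * xlnx (sum ?p T)
         + ?c (N + 1) (card (insert a T)) * xlnx (sum ?p (insert a T)) =
      (?c (N + 2) (card T) * xlnx (sum p T) + ?c (N + 2) (card (insert b T)) * xlnx (sum p (insert b T)))
      + (?c (N + 2) (card (insert a T)) * xlnx (sum p (insert a T))
        + ?c (N + 2) (card (insert a (insert b T))) * xlnx (sum p (insert a (insert b T))))
     + subset_weight N (card T) * xlnx_diff2 (p a) (p b) (sum p T)"
      unfolding cards sums sp t_def[symmetric] w1 w2 w3 xlnx_diff2_def by (simp add: algebra_simps)
  qed simp
  also have "\<dots> = subset_entropy p (insert a (insert b R))
    + (\<Sum>T\<in>Pow R. subset_weight N (card T) * xlnx_diff2 (p a) (p b) (sum p T))"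
    unfolding subset_entropy_def using fin ab
    by (simp add: sum_Pow_insert N_def sum.distrib)
  finally show ?thesis by (simp add: N_def)
qed

text \<open>Since the total mass is 1, merging the two smallest masses raises the right side by
  exactly \<open>xlnx_diff2\<close> at the remaining mass, and \<open>merge_gain\<close> says that
  the left side rises at least as much. So it suffices to treat at most two masses.\<close>

theorem subset_entropy_le:
  fixes p :: "'a \<Rightarrow> real"
  assumes "finite J" "\<And>j. j \<in> J \<Longrightarrow> 0 \<le> p j" "sum p J = 1"
  shows "subset_entropy p J \<le> (\<Sum>j\<in>J. xlnx (1 - p j)) + ln 2 / 2"
  using assms
proof (induction "card J" arbitrary: J p rule: less_induct)
  case less
  have "J \<noteq> {}" using less.prems by auto
  then obtain a where a: "a \<in> J" "\<And>j. j \<in> J \<Longrightarrow> p a \<le> p j"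
    using less.prems arg_min_if_finite[of J p] by (metis not_less)
  show ?case
  proof (cases "J - {a} = {}")
    case True
    then have J: "J = {a}" using a by auto
    then have "p a = 1" using less.prems by simp
    then show ?thesis by (simp add: J subset_entropy_def Pow_insert)
  next
    case False
    then obtain b where b: "b \<in> J - {a}" "\<And>j. j \<in> J - {a} \<Longrightarrow> p b \<le> p j"
      using less.prems arg_min_if_finite[of "J - {a}" p] by (metis finite_Diff not_less)
    define R where "R = J - {a, b}"
    have J: "J = insert a (insert b R)" "a \<notin> R" "b \<notin> R" "a \<noteq> b" "finite R"
      using a b less.prems by (auto simp: R_def)
    have sumJ: "p a + p b + sum p R = 1" using less.prems(3) J by simp
    show ?thesis
    proof (cases "R = {}")
      case True
      have J2: "J = {a, b}" using J True by simp
      have ab: "p a + p b = 1" using sumJ True by simp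
      have "subset_entropy p J = (xlnx (p a) + xlnx (p b)) / 2"
        unfolding J2 subset_entropy_def using J(4) ab by (simp add: Pow_insert)
      \<comment> \<open>The entropy of a two-point distribution is at most ln 2; half of it is the
        constant of the theorem.\<close>
      moreover have "exp (\<Sum>j\<in>J. p j * (ln 1 - ln (p j))) \<le> (\<Sum>j\<in>J. 1)"
        using less.prems by (intro weighted_am_gm) auto
      then have "exp (- xlnx (p a) - xlnx (p b)) \<le> 2"
        using J(4) by (simp add: J2 xlnx_def)
      then have "- xlnx (p a) - xlnx (p b) \<le> ln 2"
        by (subst ln_ge_iff) auto
      moreover have "(\<Sum>j\<in>J. xlnx (1 - p j)) = xlnx (p b) + xlnx (p a)"
      proof -
        have "1 - p a = p b" "1 - p b = p a" using ab by auto
        moreover have "(\<Sum>j\<in>J. xlnx (1 - p j)) = xlnx (1 - p a) + xlnx (1 - p b)" using J(4) by (simp add: J2)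
        ultimately show ?thesis by (simp only:)
      qed
      ultimately show ?thesis by (simp add: field_simps)
    next
      case False
      let ?p = "p(a := p a + p b)"
      let ?r = "sum p R"
      have nn: "0 \<le> p a" "0 \<le> p b" "\<And>j. j \<in> R \<Longrightarrow> p b \<le> p j" "p a \<le> p b"
        using less.prems(2) a b by (simp_all add: R_def)
      have r: "0 < ?r"
      proof (rule ccontr)
        assume "\<not> 0 < ?r"
        moreover have "0 \<le> ?r" using nn by (intro sum_nonneg) (metis order_trans)
        ultimately have "?r = 0" by simp
        then have "p j = 0" if "j \<in> R" for j
          using that nn J(5) by (metis (no_types, lifting) order_trans sum_nonneg_eq_0_iff)
        then have "p b \<le> 0" using False nn(3) by fastforce
        then show False using nn sumJ \<open>?r = 0\<close> by simp
      qed
      have sp: "sum ?p R = sum p R" using J by (intro sum.cong) auto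
      have "subset_entropy ?p (insert a R) \<le> (\<Sum>j\<in>insert a R. xlnx (1 - ?p j)) + ln 2 / 2"
      proof (rule less.hyps)
        show "card (insert a R) < card J" using J by simp
        show "0 \<le> ?p j" if "j \<in> insert a R" for j using that nn less.prems(2) J by auto
        show "sum ?p (insert a R) = 1" using J sp sumJ by simp
      qed (use J in auto)
      also have "(\<Sum>j\<in>insert a R. xlnx (1 - ?p j)) = xlnx ?r + (\<Sum>j\<in>R. xlnx (1 - p j))"
      proof -
        have "(\<Sum>j\<in>R. xlnx (1 - ?p j)) = (\<Sum>j\<in>R. xlnx (1 - p j))" using J by (intro sum.cong) auto
        moreover have "1 - (p a + p b) = ?r" using sumJ by simp
        ultimately show ?thesis using J by simp
      qed
      finally have "subset_entropy p J + xlnx_diff2 (p a) (p b) ?r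
          \<le> xlnx ?r + (\<Sum>j\<in>R. xlnx (1 - p j)) + ln 2 / 2"
        using merge_gain[OF J(5) False nn(1) nn(4) nn(3) r]
        unfolding subset_entropy_merge[OF J(5,2-4)] J(1)[symmetric] by simp
      moreover have "xlnx_diff2 (p a) (p b) ?r = xlnx ?r - xlnx (1 - p b) - xlnx (1 - p a)"
      proof -
        have "?r + p a + p b = 1" "?r + p a = 1 - p b" "?r + p b = 1 - p a" using sumJ by auto
        then show ?thesis by (simp only: xlnx_diff2_def) simp
      qed
      moreover have "(\<Sum>j\<in>J. xlnx (1 - p j)) = xlnx (1 - p a) + xlnx (1 - p b) + (\<Sum>j\<in>R. xlnx (1 - p j))"
        using J by simp
      ultimately show ?thesis by linarith
    qed
  qed
qed

section \<open>Van der Waerden's inequality\<close>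

text \<open>Normalised by the value at 0 instead of the leading coefficient, so that the derivative
  at 0, which is how a variable is removed, becomes a sum over inverse roots.\<close>

lemma complex_poly_root_product:
  fixes P :: "complex poly"
  assumes "poly P 0 \<noteq> 0"
  shows "\<exists>rs. length rs = degree P \<and> (\<forall>r\<in>set rs. r \<noteq> 0 \<and> poly P r = 0) \<and>
    (\<forall>t. poly P t = poly P 0 * (\<Prod>r\<leftarrow>rs. 1 - t / r)) \<and>
    coeff P 1 = poly P 0 * (\<Sum>r\<leftarrow>rs. - 1 / r)"
  using assms
proof (induction "degree P" arbitrary: P)
  case 0
  then obtain c where "P = [:c:]" by (metis degree_0_id)
  then show ?case by (intro exI[of _ "[]"]) auto
next
  case (Suc d)
  then have "\<not> constant (poly P)" by (simp add: constant_degree)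
  then obtain r where r: "poly P r = 0" using fundamental_theorem_of_algebra by blast
  then obtain Q where Q: "P = [:- r, 1:] * Q" by (metis dvdE poly_eq_0_iff_dvd)
  have r0: "r \<noteq> 0" using r Suc.prems by auto
  have "Q \<noteq> 0" using Q Suc.prems by auto
  then have d: "degree P = Suc (degree Q)" unfolding Q by (subst degree_mult_eq) auto
  have Q0: "poly Q 0 \<noteq> 0" using Q Suc.prems by auto
  have "\<exists>rs. length rs = degree Q \<and> (\<forall>r\<in>set rs. r \<noteq> 0 \<and> poly Q r = 0) \<and>
    (\<forall>t. poly Q t = poly Q 0 * (\<Prod>r\<leftarrow>rs. 1 - t / r)) \<and>
    coeff Q 1 = poly Q 0 * (\<Sum>r\<leftarrow>rs. - 1 / r)"
    by (rule Suc.hyps(1)) (use d Suc.hyps(2) Q0 in simp_all)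
  then obtain rs where rs: "length rs = degree Q" "\<forall>r\<in>set rs. r \<noteq> 0 \<and> poly Q r = 0"
    "\<forall>t. poly Q t = poly Q 0 * (\<Prod>r\<leftarrow>rs. 1 - t / r)"
    "coeff Q 1 = poly Q 0 * (\<Sum>r\<leftarrow>rs. - 1 / r)"
    by blast
  have "poly P t = poly P 0 * (\<Prod>r\<leftarrow>r # rs. 1 - t / r)" for t
    using rs(3)[rule_format, of t] r0 by (simp add: Q field_simps)
  moreover have "coeff P 1 = poly P 0 * (\<Sum>r\<leftarrow>r # rs. - 1 / r)"
  proof -
    define X where "X = (\<Sum>r\<leftarrow>rs. - 1 / r)"
    have "coeff P 1 = - r * coeff Q 1 + coeff Q 0" by (simp add: Q)
    also have "\<dots> = poly P 0 * (- 1 / r + X)"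
      using r0 unfolding rs(4) X_def[symmetric] by (simp add: Q poly_0_coeff_0 field_simps)
    finally show ?thesis by (simp add: X_def)
  qed
  moreover have "\<forall>s\<in>set (r # rs). s \<noteq> 0 \<and> poly P s = 0" using rs(2) r r0 by (auto simp: Q)
  moreover have "length (r # rs) = degree P" using d rs(1) by simp
  ultimately show ?case by blast
qed

lemma prod_linear_polys:
  fixes b d :: "'b \<Rightarrow> 'a::field"
  assumes "finite S"
  shows "coeff (\<Prod>k\<in>S. [:b k, d k:]) 1 = (\<Sum>k\<in>S. d k * (\<Prod>l\<in>S - {k}. b l))"
    and "degree (\<Prod>k\<in>S. [:b k, d k:]) \<le> card S"
    and "coeff (\<Prod>k\<in>S. [:b k, d k:]) (card S) = (\<Prod>k\<in>S. d k)"
proof -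
  have "coeff (\<Prod>k\<in>S. [:b k, d k:]) 1 = poly (pderiv (\<Prod>k\<in>S. [:b k, d k:])) 0"
    by (simp add: poly_0_coeff_0 coeff_pderiv)
  also have "\<dots> = (\<Sum>k\<in>S. d k * (\<Prod>l\<in>S - {k}. b l))"
    by (simp add: pderiv_prod poly_sum poly_prod pderiv_pCons mult.commute)
  finally show "coeff (\<Prod>k\<in>S. [:b k, d k:]) 1 = (\<Sum>k\<in>S. d k * (\<Prod>l\<in>S - {k}. b l))" .
  have deg: "degree (\<Prod>k\<in>S. [:b k, d k:]) \<le> card S" if "finite S" for S
  proof -
    have "degree (\<Prod>k\<in>S. [:b k, d k:]) \<le> sum (degree \<circ> (\<lambda>k. [:b k, d k:])) S"
      using that by (rule degree_prod_sum_le)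
    also have "\<dots> \<le> (\<Sum>k\<in>S. 1)" by (rule sum_mono) simp
    finally show ?thesis by simp
  qed
  show "degree (\<Prod>k\<in>S. [:b k, d k:]) \<le> card S" using deg assms .
  show "coeff (\<Prod>k\<in>S. [:b k, d k:]) (card S) = (\<Prod>k\<in>S. d k)"
    using assms
  proof (induction S rule: finite_induct)
    case (insert x S)
    have "coeff (\<Prod>k\<in>S. [:b k, d k:]) (Suc (card S)) = 0"
      by (rule coeff_eq_0) (use deg[OF insert.hyps(1)] in simp)
    then show ?case using insert by simp
  qed simp
qed

text \<open>
  Gurvits' polynomials: \<open>gform a n K m\<close> is \<open>\<Prod>k\<in>K. \<Sum>j\<in>{1..n}. a j k * z j\<close>
  differentiated once in each of \<open>z (m + 1), \<dots>, z n\<close> at 0. As a polynomial in its last variable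
  it is \<open>gpoly\<close>.
\<close>

definition gform :: "(nat \<Rightarrow> 'b \<Rightarrow> real) \<Rightarrow> nat \<Rightarrow> 'b set \<Rightarrow> nat \<Rightarrow> (nat \<Rightarrow> 'c::real_field) \<Rightarrow> 'c" where
  "gform a n K m z = (\<Sum>S\<in>{S. S \<subseteq> K \<and> card S = m}.
     of_real (permanent a {Suc m..n} (K - S)) * (\<Prod>k\<in>S. \<Sum>j\<in>{1..m}. of_real (a j k) * z j))"

definition gpoly :: "(nat \<Rightarrow> 'b \<Rightarrow> real) \<Rightarrow> nat \<Rightarrow> 'b set \<Rightarrow> nat \<Rightarrow> (nat \<Rightarrow> complex) \<Rightarrow> complex poly" where
  "gpoly a n K m z = (\<Sum>S\<in>{S. S \<subseteq> K \<and> card S = Suc m}.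
     smult (of_real (permanent a {Suc (Suc m)..n} (K - S)))
       (\<Prod>k\<in>S. [:\<Sum>j\<in>{1..m}. of_real (a j k) * z j, of_real (a (Suc m) k):]))"

lemma permanent_pos:
  fixes a :: "'a \<Rightarrow> 'b \<Rightarrow> real"
  assumes "finite I" "finite J" "card I = card J" "\<And>i j. i \<in> I \<Longrightarrow> j \<in> J \<Longrightarrow> 0 < a i j"
  shows "0 < permanent a I J"
proof -
  obtain f where f: "bij_betw f I J" using assms finite_same_card_bij by blast
  then have "restrict f I \<in> bijections I J"
    by (auto simp: bijections_def bij_betw_def)
  then have "bijections I J \<noteq> {}" by blast
  then show ?thesis unfolding permanent_def
    using assms by (intro sum_pos finite_bijections) (auto intro!: prod_pos dest: bijections_mem)
qed

lemma gform_cong: "(\<And>j. j \<in> {1..m} \<Longrightarrow> z j = z' j) \<Longrightarrow> gform a n K m z = gform a n K m z'"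
  unfolding gform_def by (intro sum.cong prod.cong arg_cong2[where f = "(*)"] refl) auto

lemma gform_scale:
  assumes "finite K"
  shows "gform a n K m (\<lambda>j. c * z j) = c ^ m * gform a n K m z"
proof -
  have lin: "(\<Sum>j\<in>{1..m}. of_real (a j k) * (c * z j)) = c * (\<Sum>j\<in>{1..m}. of_real (a j k) * z j)" for k
    by (simp add: sum_distrib_left mult_ac)
  show ?thesis unfolding gform_def lin prod.distrib
    by (subst sum_distrib_left, rule sum.cong) auto
qed

lemma gform_of_real:
  "gform a n K m (\<lambda>j. of_real (x j) :: complex) = of_real (gform a n K m x)"
  unfolding gform_def by simp

lemma poly_gpoly: "finite K \<Longrightarrow> poly (gpoly a n K m z) t = gform a n K (Suc m) (z(Suc m := t))"
proof -
  assume "finite K"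
  have "(\<Sum>j\<in>{1..Suc m}. of_real (a j k) * (z(Suc m := t)) j)
      = (\<Sum>j\<in>{1..m}. of_real (a j k) * z j) + t * of_real (a (Suc m) k)" for k
    by (simp add: mult.commute)
  then show ?thesis
    unfolding gpoly_def gform_def by (simp add: poly_sum poly_prod mult.commute)
qed

text \<open>Linear terms arise by choosing one k in S that contributes the last variable. Grouping
  by S - {k} turns the sum over k into the expansion of the permanent along row
  \<open>Suc m\<close>.\<close>

lemma coeff_gpoly_1:
  assumes K: "finite K" and m: "Suc m \<le> n"
  shows "coeff (gpoly a n K m z) 1 = gform a n K m z"
proof -
  let ?c = "\<lambda>S. of_real (permanent a {Suc (Suc m)..n} (K - S)) :: complex"
  let ?b = "\<lambda>k. \<Sum>j\<in>{1..m}. of_real (a j k) * z j"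
  let ?F = "\<lambda>m. {S. S \<subseteq> K \<and> card S = m}"
  have fin: "finite (?F m)" for m using K by simp
  have finS: "finite S" if "S \<in> ?F m" for S m using that K finite_subset by auto
  have "coeff (gpoly a n K m z) 1
     = (\<Sum>S\<in>?F (Suc m). ?c S * coeff (\<Prod>k\<in>S. [:?b k, of_real (a (Suc m) k):]) 1)"
    by (simp add: gpoly_def coeff_sum)
  also have "\<dots> = (\<Sum>S\<in>?F (Suc m). \<Sum>k\<in>S. ?c S * (of_real (a (Suc m) k) * (\<Prod>l\<in>S - {k}. ?b l)))"
    by (rule sum.cong) (simp_all only: prod_linear_polys(1)[OF finS] sum_distrib_left)
  also have "\<dots> = (\<Sum>(S, k)\<in>(SIGMA S:?F (Suc m). S). ?c S * (of_real (a (Suc m) k) * (\<Prod>l\<in>S - {k}. ?b l)))"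
    by (rule sum.Sigma) (use fin finS in blast)+
  also have "\<dots> = (\<Sum>(S, k)\<in>(SIGMA S:?F m. K - S). ?c (insert k S) * (of_real (a (Suc m) k) * (\<Prod>l\<in>S. ?b l)))"
  proof (rule sum.reindex_bij_witness[where i = "\<lambda>(S, k). (insert k S, k)" and j = "\<lambda>(S, k). (S - {k}, k)"])
    fix x assume "x \<in> (SIGMA S:?F (Suc m). S)"
    then obtain S k where x: "x = (S, k)" "S \<subseteq> K" "card S = Suc m" "k \<in> S" by auto
    then show "(case case x of (S, k) \<Rightarrow> (S - {k}, k) of (S, k) \<Rightarrow> (insert k S, k)) = x"
      "(case x of (S, k) \<Rightarrow> (S - {k}, k)) \<in> (SIGMA S:?F m. K - S)"
      "(case case x of (S, k) \<Rightarrow> (S - {k}, k) of (S, k) \<Rightarrow> ?c (insert k S) * (of_real (a (Suc m) k) * (\<Prod>l\<in>S. ?b l)))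
        = (case x of (S, k) \<Rightarrow> ?c S * (of_real (a (Suc m) k) * (\<Prod>l\<in>S - {k}. ?b l)))"
      by (auto simp: insert_absorb)
  next
    fix x assume "x \<in> (SIGMA S:?F m. K - S)"
    then obtain S k where x: "x = (S, k)" "S \<subseteq> K" "card S = m" "k \<in> K - S" by auto
    moreover have "finite S" using x K finite_subset by auto
    ultimately show "(case case x of (S, k) \<Rightarrow> (insert k S, k) of (S, k) \<Rightarrow> (S - {k}, k)) = x"
      "(case x of (S, k) \<Rightarrow> (insert k S, k)) \<in> (SIGMA S:?F (Suc m). S)"
      by auto
  qed
  also have "\<dots> = (\<Sum>S\<in>?F m. \<Sum>k\<in>K - S. ?c (insert k S) * (of_real (a (Suc m) k) * (\<Prod>l\<in>S. ?b l)))"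
    by (rule sum.Sigma[symmetric]) (use fin K in auto)
  also have "\<dots> = gform a n K m z" unfolding gform_def
  proof (rule sum.cong)
    fix S assume "S \<in> ?F m"
    have "{Suc m..n} = insert (Suc m) {Suc (Suc m)..n}" using m by auto
    then have "permanent a {Suc m..n} (K - S)
        = (\<Sum>k\<in>K - S. a (Suc m) k * permanent a {Suc (Suc m)..n} (K - S - {k}))"
      using K by (simp add: permanent_insert)
    moreover have "K - insert k S = K - S - {k}" for k by auto
    ultimately show "(\<Sum>k\<in>K - S. ?c (insert k S) * (of_real (a (Suc m) k) * (\<Prod>l\<in>S. ?b l)))
       = of_real (permanent a {Suc m..n} (K - S)) * (\<Prod>k\<in>S. ?b k)"
      by (simp add: sum_distrib_left mult_ac)
  qed simp
  finally show ?thesis .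
qed

text \<open>Strict positivity of \<open>a\<close> makes the leading coefficient positive whatever z
  is, so the number of roots is known exactly.\<close>

lemma degree_gpoly:
  assumes K: "finite K" "card K = n" and m: "Suc m \<le> n"
    and pos: "\<And>j k. j \<in> {1..n} \<Longrightarrow> k \<in> K \<Longrightarrow> 0 < a j k"
  shows "degree (gpoly a n K m z) = Suc m"
proof (rule antisym)
  have finS: "finite S" if "S \<subseteq> K" for S using that K finite_subset by auto
  have "degree (\<Prod>k\<in>S. [:\<Sum>j\<in>{1..m}. of_real (a j k) * z j, of_real (a (Suc m) k):]) \<le> Suc m"
    if "S \<subseteq> K" "card S = Suc m" for S
    unfolding that(2)[symmetric] by (rule prod_linear_polys(2)[OF finS[OF that(1)]])
  then show "degree (gpoly a n K m z) \<le> Suc m" unfolding gpoly_def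
    using K by (intro degree_sum_le) (auto intro: order_trans[OF degree_smult_le])
  have "coeff (gpoly a n K m z) (Suc m)
    = (\<Sum>S\<in>{S. S \<subseteq> K \<and> card S = Suc m}. of_real (permanent a {Suc (Suc m)..n} (K - S)) *
       coeff (\<Prod>k\<in>S. [:\<Sum>j\<in>{1..m}. of_real (a j k) * z j, of_real (a (Suc m) k):]) (card S))"
    unfolding gpoly_def by (simp add: coeff_sum)
  also have "\<dots> = (\<Sum>S\<in>{S. S \<subseteq> K \<and> card S = Suc m}. of_real (permanent a {Suc (Suc m)..n} (K - S)) *
       (\<Prod>k\<in>S. of_real (a (Suc m) k)))"
  proof (rule sum.cong)
    fix S assume "S \<in> {S. S \<subseteq> K \<and> card S = Suc m}"
    then have "finite S" using finS by blast
    then show "of_real (permanent a {Suc (Suc m)..n} (K - S)) *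
       coeff (\<Prod>k\<in>S. [:\<Sum>j\<in>{1..m}. of_real (a j k) * z j, of_real (a (Suc m) k):]) (card S)
      = of_real (permanent a {Suc (Suc m)..n} (K - S)) * (\<Prod>k\<in>S. of_real (a (Suc m) k))"
      by (simp only: prod_linear_polys(3))
  qed simp
  also have "\<dots> = of_real (\<Sum>S\<in>{S. S \<subseteq> K \<and> card S = Suc m}. permanent a {Suc (Suc m)..n} (K - S) *
       (\<Prod>k\<in>S. a (Suc m) k))" (is "_ = of_real ?Y")
    by simp
  finally have c: "coeff (gpoly a n K m z) (Suc m) = of_real ?Y" .
  have "?Y > 0"
  proof (rule sum_pos)
    show "finite {S. S \<subseteq> K \<and> card S = Suc m}" using K by simp
    obtain T where "T \<subseteq> K" "card T = Suc m"
      by (rule obtain_subset_with_card_n[of "Suc m" K]) (use m K in auto)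
    then show "{S. S \<subseteq> K \<and> card S = Suc m} \<noteq> {}" by blast
    fix S assume "S \<in> {S. S \<subseteq> K \<and> card S = Suc m}"
    then have S: "S \<subseteq> K" "card S = Suc m" "finite S" using finS by auto
    then have "card {Suc (Suc m)..n} = card (K - S)" using K by (simp add: card_Diff_subset)
    then have "0 < permanent a {Suc (Suc m)..n} (K - S)"
      by (rule permanent_pos[rotated 2]) (use K pos in auto)
    moreover have "0 < (\<Prod>k\<in>S. a (Suc m) k)" using S m by (intro prod_pos) (auto intro!: pos)
    ultimately show "0 < permanent a {Suc (Suc m)..n} (K - S) * (\<Prod>k\<in>S. a (Suc m) k)" by simp
  qed
  then have "coeff (gpoly a n K m z) (Suc m) \<noteq> 0"
    unfolding c by (simp only: of_real_eq_0_iff)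
  then show "Suc m \<le> degree (gpoly a n K m z)" by (rule le_degree)
qed

text \<open>
  Zeros are allowed among the coordinates so that setting a variable to 0 stays inside the region, and
  the rotation makes the region open; with a fixed closed half-plane \<open>gform_nonzero\<close>
  would fail at \<open>(\<i>, - \<i>)\<close>.
\<close>

definition rotated_halfplane :: "nat \<Rightarrow> (nat \<Rightarrow> complex) \<Rightarrow> bool" where
  "rotated_halfplane m z \<longleftrightarrow> (\<exists>w. \<forall>j\<in>{1..m}. z j = 0 \<or> 0 < Re (w * z j)) \<and> (\<exists>j\<in>{1..m}. z j \<noteq> 0)"

text \<open>A value on the boundary line, Re (w t) = 0, is brought into the half-plane by a small
  rotation of w, which preserves the finitely many strict inequalities at the other
  coordinates.\<close>

lemma rotated_halfplane_root:
  assumes w: "\<forall>j\<in>{1..m}. z j = 0 \<or> 0 < Re (w * z j)" and z: "\<exists>j\<in>{1..m}. z j \<noteq> 0"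
    and t: "\<not> rotated_halfplane (Suc m) (z(Suc m := t))"
  shows "Re (w * t) < 0"
proof (rule ccontr)
  have ex: "\<exists>j\<in>{1..Suc m}. (z(Suc m := t)) j \<noteq> 0"
  proof -
    obtain j where "j \<in> {1..m}" "z j \<noteq> 0" using z by blast
    then show ?thesis by (intro bexI[of _ j]) auto
  qed
  assume "\<not> Re (w * t) < 0"
  then consider "Re (w * t) > 0" | "Re (w * t) = 0" by linarith
  then show False
  proof cases
    case 1
    then have "\<forall>j\<in>{1..Suc m}. (z(Suc m := t)) j = 0 \<or> 0 < Re (w * (z(Suc m := t)) j)"
      using w by auto
    then show False using t ex by (auto simp: rotated_halfplane_def)
  next
    case 2
    \<comment> \<open>The sign is chosen so that Re (s w t) is the absolute value of Im (w
      t).\<close>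
    define s where "s = (if Im (w * t) > 0 then - \<i> else \<i>)"
    have "eventually (\<lambda>e. \<forall>j\<in>{1..m}. z j \<noteq> 0 \<longrightarrow> 0 < Re ((w + of_real e * s * w) * z j)) (at_right 0)"
    proof (rule eventually_ball_finite)
      show "\<forall>j\<in>{1..m}. eventually (\<lambda>e. z j \<noteq> 0 \<longrightarrow> 0 < Re ((w + of_real e * s * w) * z j)) (at_right 0)"
      proof
        fix j assume j: "j \<in> {1..m}"
        have "((\<lambda>e. Re ((w + of_real e * s * w) * z j)) \<longlongrightarrow> Re ((w + of_real 0 * s * w) * z j)) (at_right 0)"
          by (intro tendsto_intros)
        then have "eventually (\<lambda>e. 0 < Re ((w + of_real e * s * w) * z j)) (at_right 0)" if "z j \<noteq> 0"
          using w j that by (intro order_tendstoD(1)) auto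
        then show "eventually (\<lambda>e. z j \<noteq> 0 \<longrightarrow> 0 < Re ((w + of_real e * s * w) * z j)) (at_right 0)"
          by (cases "z j = 0") auto
      qed
    qed simp
    then have "eventually (\<lambda>e. 0 < e \<and> (\<forall>j\<in>{1..m}. z j \<noteq> 0 \<longrightarrow> 0 < Re ((w + of_real e * s * w) * z j))) (at_right 0)"
      by (intro eventually_conj eventually_at_right_less)
    then obtain e :: real where e: "0 < e" "\<forall>j\<in>{1..m}. z j \<noteq> 0 \<longrightarrow> 0 < Re ((w + of_real e * s * w) * z j)"
      using eventually_happens'[OF trivial_limit_at_right_real] by blast
    have "t = 0 \<or> 0 < Re ((w + of_real e * s * w) * t)"
    proof (cases "w * t = 0")
      case True
      have "w \<noteq> 0" using w z by fastforce
      then show ?thesis using True by simp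
    next
      case False
      then have "Im (w * t) \<noteq> 0" using 2 by (simp add: complex_eq_iff)
      have "Re ((w + of_real e * s * w) * t) = Re (w * t) + e * Re (s * (w * t))"
        by (simp add: algebra_simps)
      also have "\<dots> = e * \<bar>Im (w * t)\<bar>" using 2 by (auto simp: s_def algebra_simps)
      finally show ?thesis using e \<open>Im (w * t) \<noteq> 0\<close> by simp
    qed
    then have "\<forall>j\<in>{1..Suc m}. (z(Suc m := t)) j = 0 \<or> 0 < Re ((w + of_real e * s * w) * (z(Suc m := t)) j)"
      using e(2) by auto
    then show False using t ex unfolding rotated_halfplane_def by blast
  qed
qed

lemma sum_list_map_pos:
  fixes f :: "'a \<Rightarrow> real"
  assumes "xs \<noteq> []" "\<And>x. x \<in> set xs \<Longrightarrow> 0 < f x"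
  shows "0 < (\<Sum>x\<leftarrow>xs. f x)"
  using assms
proof (induction xs rule: list_nonempty_induct)
  case (cons x xs)
  then have "0 < f x" "0 < (\<Sum>x\<leftarrow>xs. f x)" by auto
  then show ?case by simp
qed simp

text \<open>Half-plane stability survives differentiation at 0, as in the Gauss-Lucas theorem: all
  roots r in the last variable satisfy Re (w r) < 0, so all -1 / r lie in one common open half-plane
  and their sum, the logarithmic derivative at 0, cannot vanish.\<close>

lemma gform_nonzero:
  assumes K: "finite K" "card K = n"
    and pos: "\<And>j k. j \<in> {1..n} \<Longrightarrow> k \<in> K \<Longrightarrow> 0 < a j k"
    and m: "m \<le> n" and z: "rotated_halfplane m z"
  shows "gform a n K m z \<noteq> 0"
  using m z
proof (induction m arbitrary: z rule: inc_induct)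
  case base
  obtain w where w: "\<forall>j\<in>{1..n}. z j = 0 \<or> 0 < Re (w * z j)" and ex: "\<exists>j\<in>{1..n}. z j \<noteq> 0"
    using base by (auto simp: rotated_halfplane_def)
  have S: "{S. S \<subseteq> K \<and> card S = n} = {K}" using K card_subset_eq by auto
  have "(\<Sum>j\<in>{1..n}. of_real (a j k) * z j) \<noteq> 0" if k: "k \<in> K" for k
  proof
    assume 0: "(\<Sum>j\<in>{1..n}. of_real (a j k) * z j) = 0"
    have "Re (w * (\<Sum>j\<in>{1..n}. of_real (a j k) * z j)) = (\<Sum>j\<in>{1..n}. a j k * Re (w * z j))"
      unfolding sum_distrib_left Re_sum by (intro sum.cong refl) (simp add: algebra_simps)
    also have "\<dots> > 0"
    proof -
      obtain i where i: "i \<in> {1..n}" "z i \<noteq> 0" using ex by blast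
      show ?thesis
      proof (rule sum_pos2[of _ i])
        show "0 < a i k * Re (w * z i)" using i w pos k by auto
        show "0 \<le> a j k * Re (w * z j)" if "j \<in> {1..n}" for j
          using that w pos[OF that k] by (cases "z j = 0") auto
      qed (use i in auto)
    qed
    finally have "0 < Re (w * (\<Sum>j\<in>{1..n}. of_real (a j k) * z j))" .
    then show False unfolding 0 by simp
  qed
  then show ?case using K by (simp add: gform_def S permanent_empty)
next
  case (step m)
  obtain w where w: "\<forall>j\<in>{1..m}. z j = 0 \<or> 0 < Re (w * z j)" and ex: "\<exists>j\<in>{1..m}. z j \<noteq> 0"
    using step.prems by (auto simp: rotated_halfplane_def)
  let ?P = "gpoly a n K m z"
  have neg: "Re (w * r) < 0" if "poly ?P r = 0" for r
  proof (rule rotated_halfplane_root[OF w ex])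
    show "\<not> rotated_halfplane (Suc m) (z(Suc m := r))"
      using step.IH[of "z(Suc m := r)"] that unfolding poly_gpoly[OF K(1)] by blast
  qed
  have P0: "poly ?P 0 \<noteq> 0" using neg[of 0] by auto
  obtain rs where rs: "length rs = degree ?P" "\<forall>r\<in>set rs. r \<noteq> 0 \<and> poly ?P r = 0"
    "coeff ?P 1 = poly ?P 0 * (\<Sum>r\<leftarrow>rs. - 1 / r)"
    using complex_poly_root_product[OF P0] by blast
  have ne: "rs \<noteq> []" using rs(1) degree_gpoly[OF K _ pos] step.hyps by auto
  have "Re ((\<Sum>r\<leftarrow>rs. - 1 / r) / w) > 0"
  proof -
    have *: "0 < Re (- 1 / r / w)" if "r \<in> set rs" for r
    proof -
      have "Re (w * r) < 0" using neg rs(2) that by blast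
      then have "Re (w * r) / ((Re (w * r))\<^sup>2 + (Im (w * r))\<^sup>2) < 0"
        by (intro divide_neg_pos) (auto simp: sum_power2_gt_zero_iff)
      then have "Re (inverse (w * r)) < 0" by (simp only: inverse_complex.simps)
      moreover have "- 1 / r / w = - inverse (w * r)" by (simp add: field_simps)
      ultimately show ?thesis by simp
    qed
    have "Re ((\<Sum>r\<leftarrow>rs. - 1 / r) / w) = (\<Sum>r\<leftarrow>rs. Re (- 1 / r / w))"
      by (induction rs) (simp_all add: add_divide_distrib diff_divide_distrib)
    also have "\<dots> > 0" using ne * by (rule sum_list_map_pos)
    finally show ?thesis .
  qed
  then have "(\<Sum>r\<leftarrow>rs. - 1 / r) \<noteq> 0" by auto
  then show ?case using rs(3) P0 coeff_gpoly_1[OF K(1), of m n a z] step.hyps by auto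
qed

section \<open>Capacity under differentiation at 0\<close>

lemma am_gm_list:
  fixes ys :: "real list"
  assumes "\<And>y. y \<in> set ys \<Longrightarrow> 0 < y" "ys \<noteq> []"
  shows "prod_list ys \<le> (sum_list ys / length ys) ^ length ys"
proof -
  define u where "u = sum_list ys / length ys"
  have "0 < (\<Sum>y\<leftarrow>ys. y)" by (rule sum_list_map_pos[OF assms(2,1)])
  then have "0 < sum_list ys" by simp
  then have u: "0 < u" using assms by (simp add: u_def)
  have "prod_list ys \<le> u ^ length ys * exp (sum_list ys / u - length ys)" using assms(1)
  proof (induction ys)
    case (Cons y ys)
    have y: "0 < y" using Cons.prems by simp
    have "0 \<le> prod_list zs" if "\<forall>y\<in>set zs. 0 < y" for zs :: "real list"
      using that by (induction zs) auto
    then have "0 \<le> prod_list ys" using Cons.prems by simp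
    \<comment> \<open>Polya's proof: these inequalities are multiplied over the list, and for the
      mean \<open>u\<close> the exponents add up to 0.\<close>
    moreover have "y / u \<le> exp (y / u - 1)" using exp_ge_add_one_self[of "y / u - 1"] by simp
    then have "y \<le> u * exp (y / u - 1)" using u by (simp add: field_simps)
    ultimately have "y * prod_list ys \<le> (u * exp (y / u - 1)) * (u ^ length ys * exp (sum_list ys / u - length ys))"
      using Cons y u by (intro mult_mono) auto
    also have "\<dots> = u ^ length (y # ys) * exp ((y / u - 1) + (sum_list ys / u - length ys))"
      by (simp add: exp_add)
    also have "(y / u - 1) + (sum_list ys / u - length ys) = sum_list (y # ys) / u - length (y # ys)"
      by (simp add: add_divide_distrib)
    finally show ?case by simp
  qed simp
  also have "sum_list ys / u = length ys" using u assms(2) by (auto simp: u_def field_simps)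
  finally show ?thesis by (simp add: u_def)
qed

text \<open>In the last variable the form is p with p t = p 0 times the product of 1 - t / r over
  negative real roots r. With d roots and s the sum of -1 / r, the inequality of means gives C t <=
  p t <= p 0 (1 + t s / d)^d, while the differentiated form is p 0 s; optimising t compares the
  two.\<close>

lemma gform_capacity_step:
  assumes K: "finite K" "card K = n"
    and pos: "\<And>j k. j \<in> {1..n} \<Longrightarrow> k \<in> K \<Longrightarrow> 0 < a j k"
    and m: "Suc m \<le> n" and c: "0 \<le> c"
    and cap: "\<And>x. (\<And>j. j \<in> {1..Suc m} \<Longrightarrow> 0 < x j) \<Longrightarrow> c * (\<Prod>j\<in>{1..Suc m}. x j) \<le> gform a n K (Suc m) x"
    and x: "\<And>j. j \<in> {1..m} \<Longrightarrow> 0 < x j"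
  shows "c * (real m / real (Suc m)) ^ m * (\<Prod>j\<in>{1..m}. x j) \<le> (gform a n K m x :: real)"
proof -
  let ?z = "\<lambda>j. complex_of_real (x j)"
  define P where "P = gpoly a n K m ?z"
  define p where "p t = gform a n K (Suc m) (x(Suc m := t))" for t :: real
  define C where "C = c * (\<Prod>j\<in>{1..m}. x j)"
  have "0 \<le> (\<Prod>j\<in>{1..m}. x j)" by (rule prod_nonneg) (use x in \<open>simp add: less_imp_le\<close>)
  then have C0: "0 \<le> C" using c by (simp add: C_def)
  have Pp: "poly P (of_real t) = of_real (p t)" for t
  proof -
    have "(?z(Suc m := of_real t)) = (\<lambda>j. of_real ((x(Suc m := t)) j))" by auto
    then show ?thesis unfolding P_def p_def poly_gpoly[OF K(1)] by (simp only: gform_of_real)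
  qed
  have P1: "coeff P 1 = of_real (gform a n K m x)"
    unfolding P_def coeff_gpoly_1[OF K(1) m] by (rule gform_of_real)
  have deg: "degree P = Suc m" unfolding P_def by (rule degree_gpoly[OF K m pos])
  have pt: "C * t \<le> p t" if "0 < t" for t
  proof -
    have "c * (\<Prod>j\<in>{1..Suc m}. (x(Suc m := t)) j) \<le> p t"
      unfolding p_def by (rule cap) (use x that in auto)
    also have "(\<Prod>j\<in>{1..Suc m}. (x(Suc m := t)) j) = (\<Prod>j\<in>{1..m}. x j) * t"
      by (simp add: prod.atLeast_Suc_atMost_Suc_shift)
    finally show ?thesis by (simp add: C_def mult.assoc)
  qed
  show ?thesis
  \<comment> \<open>The optimal t below divides by m. For m = 0 the polynomial is linear and has no
    constant term by homogeneity, so no optimisation takes place.\<close>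
  proof (cases "m = 0")
    case True
    have "p 0 = 0"
      using gform_scale[OF K(1), of a n "Suc m" 0 "x(Suc m := 0)"]
        gform_cong[of "Suc m" "x(Suc m := 0)" "\<lambda>j. 0 * (x(Suc m := 0)) j" a n K] True
      by (simp add: p_def)
    then have "coeff P 0 = 0" using Pp[of 0] by (simp add: poly_0_coeff_0)
    moreover have "poly P 1 = (\<Sum>i\<le>1. coeff P i)" using deg True by (simp add: poly_altdef)
    ultimately have "poly P 1 = coeff P 1" by simp
    then have "p 1 = gform a n K m x" using Pp[of 1] P1 by simp
    then show ?thesis using pt[of 1] True by (simp add: C_def)
  next
    case False
    have rh: "poly P r \<noteq> 0" if "rotated_halfplane (Suc m) (?z(Suc m := r))" for r
      using gform_nonzero[OF K pos m that] by (simp add: P_def poly_gpoly[OF K(1)])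
    have ex: "\<exists>j\<in>{1..m}. ?z j \<noteq> 0" using False x by (intro bexI[of _ 1]) fastforce+
    have neg: "Re (w * r) < 0" if "poly P r = 0" "0 < Re w" for r w
      using rotated_halfplane_root[OF _ ex, of w r] rh that x by auto
    have real: "r = of_real (Re r) \<and> Re r < 0" if r: "poly P r = 0" for r
    proof
      have "Im r = 0"
      proof (rule ccontr)
        assume "Im r \<noteq> 0"
        \<comment> \<open>As the coordinates are positive reals, every direction w with Re w > 0 is
          admissible; this one makes Re (w r) = 0.\<close>
        then show False using neg[OF r, of "Complex 1 (Re r / Im r)"] by simp
      qed
      then show "r = of_real (Re r)" by (simp add: complex_eq_iff)
      show "Re r < 0" using neg[OF r, of 1] by simp
    qed
    have P0: "poly P 0 \<noteq> 0" using real[of 0] by auto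
    obtain rs where rs: "length rs = Suc m" "\<forall>r\<in>set rs. r \<noteq> 0 \<and> poly P r = 0"
      "\<forall>t. poly P t = poly P 0 * (\<Prod>r\<leftarrow>rs. 1 - t / r)"
      "coeff P 1 = poly P 0 * (\<Sum>r\<leftarrow>rs. - 1 / r)"
      using complex_poly_root_product[OF P0] deg by metis
    define s where "s = (\<Sum>r\<leftarrow>rs. - 1 / Re r)"
    have rr: "\<forall>r\<in>set rs. r = of_real (Re r) \<and> Re r < 0" using rs(2) real by blast
    have rs_real: "map (\<lambda>r. complex_of_real (Re r)) rs = rs"
      by (rule map_idI) (use rr in metis)
    have prod: "(\<Prod>r\<leftarrow>rs. 1 - of_real t / r) = of_real (\<Prod>r\<leftarrow>rs. 1 - t / Re r)" for t
    proof -
      have "(\<Prod>r\<leftarrow>map of_real ss. 1 - of_real t / r) = complex_of_real (\<Prod>r\<leftarrow>ss. 1 - t / r)" for ss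
        by (induction ss) simp_all
      from this[of "map Re rs"] show ?thesis by (simp add: o_def rs_real)
    qed
    have sum: "(\<Sum>r\<leftarrow>rs. - 1 / r) = of_real s"
    proof -
      have "(\<Sum>r\<leftarrow>map of_real ss. - 1 / r) = complex_of_real (\<Sum>r\<leftarrow>ss. - 1 / r)" for ss
        by (induction ss) simp_all
      from this[of "map Re rs"] show ?thesis by (simp add: o_def rs_real s_def)
    qed
    have pr: "p t = p 0 * (\<Prod>r\<leftarrow>rs. 1 - t / Re r)" for t
    proof -
      have "complex_of_real (p t) = poly P 0 * of_real (\<Prod>r\<leftarrow>rs. 1 - t / Re r)"
        unfolding Pp[symmetric] prod[symmetric] by (rule rs(3)[rule_format])
      also have "poly P 0 = of_real (p 0)" using Pp[of 0] by simp
      finally have "complex_of_real (p t) = of_real (p 0 * (\<Prod>r\<leftarrow>rs. 1 - t / Re r))"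
        by simp
      then show ?thesis by (simp only: of_real_eq_iff)
    qed
    have gm: "gform a n K m x = p 0 * s"
    proof -
      have "complex_of_real (gform a n K m x) = of_real (p 0) * of_real s"
        unfolding P1[symmetric] rs(4) sum using Pp[of 0] by simp
      then have "complex_of_real (gform a n K m x) = of_real (p 0 * s)" by simp
      then show ?thesis by (simp only: of_real_eq_iff)
    qed
    have ypos: "0 < 1 - t / Re r" if "r \<in> set rs" "0 \<le> t" for t r
      using rr that by (auto simp: field_simps intro: add_pos_nonneg)
    have ne: "rs \<noteq> []" using rs(1) by auto
    have "0 < s" unfolding s_def by (rule sum_list_map_pos[OF ne]) (use rr in \<open>auto simp: divide_neg_neg\<close>)
    have prodpos: "0 < (\<Prod>r\<leftarrow>rs. 1 - 1 / Re r)"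
      using ypos[of _ 1] by (induction rs) auto
    have "0 \<le> p 1" using pt[of 1] C0 by simp
    then have "0 \<le> p 0" using pr[of 1] prodpos by (simp add: zero_le_mult_iff)
    then have p0: "0 < p 0" using P0 Pp[of 0] by (simp add: order.strict_iff_order)
    define d where "d = real (Suc m)"
    \<comment> \<open>The minimiser of (1 + t s / d)^d / t, where d = m + 1.\<close>
    define t where "t = d / (real m * s)"
    have t: "0 < t" using False \<open>0 < s\<close> by (simp add: t_def d_def)
    have "(\<Prod>r\<leftarrow>rs. 1 - t / Re r) \<le> ((\<Sum>r\<leftarrow>rs. 1 - t / Re r) / d) ^ Suc m"
    proof -
      let ?ys = "map (\<lambda>r. 1 - t / Re r) rs"
      have "prod_list ?ys \<le> (sum_list ?ys / length ?ys) ^ length ?ys"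
      proof (rule am_gm_list)
        show "0 < y" if "y \<in> set ?ys" for y using that ypos[of _ t] t by auto
      qed (use ne in simp)
      then show ?thesis by (simp only: length_map rs(1) d_def)
    qed
    also have "(\<Sum>r\<leftarrow>rs. 1 - t / Re r) = d + t * s"
    proof -
      have "(\<Sum>r\<leftarrow>rs. 1 - t / Re r) = real (length rs) + t * (\<Sum>r\<leftarrow>rs. - 1 / Re r)" for rs
        by (induction rs) (auto simp: algebra_simps)
      then show ?thesis unfolding s_def d_def rs(1)[symmetric] .
    qed
    also have "(d + t * s) / d = d / real m"
    proof -
      have "t * s = d / real m" using \<open>0 < s\<close> by (simp add: t_def)
      then have "d + t * s = d * (d / real m)" using False by (simp add: d_def field_simps)
      then show ?thesis by (simp add: d_def)
    qed
    finally have "p t \<le> p 0 * (d / real m) ^ Suc m"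
      unfolding pr[of t] by (rule mult_left_mono) (use p0 in simp)
    then have "C * (d / (real m * s)) \<le> p 0 * (d / real m) ^ Suc m"
      using pt[OF t] by (simp add: t_def)
    then have "C * (d / (real m * s)) * (s * (real m / d)) \<le> p 0 * (d / real m) ^ Suc m * (s * (real m / d))"
      using \<open>0 < s\<close> by (intro mult_right_mono) (auto simp: d_def)
    also have "C * (d / (real m * s)) * (s * (real m / d)) = C"
      using False \<open>0 < s\<close> by (simp add: d_def)
    also have "p 0 * (d / real m) ^ Suc m * (s * (real m / d)) = gform a n K m x * (d / real m) ^ m"
      using False unfolding gm by (simp add: d_def)
    finally have "C * (real m / d) ^ m \<le> gform a n K m x * (d / real m) ^ m * (real m / d) ^ m"
      by (intro mult_right_mono) (auto simp: d_def)
    also have "\<dots> = gform a n K m x"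
      using False by (simp add: mult.assoc power_mult_distrib[symmetric] d_def)
    finally show ?thesis by (simp add: C_def d_def mult_ac)
  qed
qed

text \<open>The bound on the capacity, the infimum of the form divided by the product of the
  variables, is 1 for m = n, and each differentiation costs one factor.\<close>

lemma gform_capacity:
  fixes x :: "nat \<Rightarrow> real"
  assumes K: "finite K" "card K = n"
    and pos: "\<And>j k. j \<in> {1..n} \<Longrightarrow> k \<in> K \<Longrightarrow> 0 < a j k"
    and row: "\<And>j. j \<in> {1..n} \<Longrightarrow> (\<Sum>k\<in>K. a j k) = 1"
    and col: "\<And>k. k \<in> K \<Longrightarrow> (\<Sum>j\<in>{1..n}. a j k) = 1"
    and m: "m \<le> n" and x: "\<And>j. j \<in> {1..m} \<Longrightarrow> 0 < x j"
  shows "(\<Prod>i\<in>{m..<n}. (real i / real (Suc i)) ^ i) * (\<Prod>j\<in>{1..m}. x j) \<le> gform a n K m x"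
  using m x
proof (induction m arbitrary: x rule: inc_induct)
  case base
  have S: "{S. S \<subseteq> K \<and> card S = n} = {K}" using K card_subset_eq by auto
  \<comment> \<open>Row sums 1 distribute the exponent of each variable over the linear forms;
    column sums 1 then allow the inequality of means in each form.\<close>
  have "(\<Prod>j\<in>{1..n}. x j) = exp (\<Sum>j\<in>{1..n}. (\<Sum>k\<in>K. a j k) * ln (x j))"
    using base row by (simp add: exp_sum)
  also have "\<dots> = (\<Prod>k\<in>K. exp (\<Sum>j\<in>{1..n}. a j k * ln (x j)))"
    unfolding sum_distrib_right by (subst sum.swap) (simp add: exp_sum K)
  also have "\<dots> \<le> (\<Prod>k\<in>K. \<Sum>j\<in>{1..n}. a j k * x j)"
  proof (intro prod_mono conjI)
    fix k assume k: "k \<in> K"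
    have "(\<Sum>j\<in>{1..n}. a j k * ln (x j)) = (\<Sum>j\<in>{1..n}. a j k * (ln (a j k * x j) - ln (a j k)))"
    proof (rule sum.cong)
      fix j assume "j \<in> {1..n}"
      then show "a j k * ln (x j) = a j k * (ln (a j k * x j) - ln (a j k))"
        using pos[OF _ k, of j] base[of j] by (simp add: ln_mult)
    qed simp
    also have "exp \<dots> \<le> (\<Sum>j\<in>{1..n}. a j k * x j)"
      by (rule weighted_am_gm) (use pos[OF _ k] base col[OF k] in \<open>auto intro: less_imp_le\<close>)
    finally show "exp (\<Sum>j\<in>{1..n}. a j k * ln (x j)) \<le> (\<Sum>j\<in>{1..n}. a j k * x j)" .
  qed simp
  finally show ?case by (simp add: gform_def S permanent_empty)
next
  case (step m)
  let ?c = "\<Prod>i\<in>{Suc m..<n}. (real i / real (Suc i)) ^ i"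
  have "?c * (real m / real (Suc m)) ^ m * (\<Prod>j\<in>{1..m}. x j) \<le> gform a n K m x"
    by (rule gform_capacity_step[OF K pos _ _ step.IH]) (use step in \<open>auto intro!: prod_nonneg\<close>)
  moreover have "{m..<n} = insert m {Suc m..<n}" using step.hyps by auto
  ultimately show ?case by (simp add: mult_ac)
qed

lemma prod_capacity_factors: "(\<Prod>i\<in>{0..<n}. (real i / real (Suc i)) ^ i) = fact n / real n ^ n"
proof (induction n)
  case (Suc n)
  have "(\<Prod>i\<in>{0..<Suc n}. (real i / real (Suc i)) ^ i) = fact n / real n ^ n * (real n / real (Suc n)) ^ n"
    using Suc.IH by simp
  also have "\<dots> = fact n / real (Suc n) ^ n"
    by (cases "n = 0") (simp_all add: power_divide del: of_nat_Suc)
  also have "\<dots> = fact (Suc n) / real (Suc n) ^ Suc n"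
    by (simp del: of_nat_Suc)
  finally show ?case .
qed simp

text \<open>For m = 0 the form is the permanent. The strict positivity required by the root argument
  comes from mixing with the uniform matrix, and the limit removes it.\<close>

theorem van_der_waerden_permanent:
  fixes a :: "nat \<Rightarrow> 'b \<Rightarrow> real"
  assumes K: "finite K" "card K = n"
    and nn: "\<And>j k. j \<in> {1..n} \<Longrightarrow> k \<in> K \<Longrightarrow> 0 \<le> a j k"
    and row: "\<And>j. j \<in> {1..n} \<Longrightarrow> (\<Sum>k\<in>K. a j k) = 1"
    and col: "\<And>k. k \<in> K \<Longrightarrow> (\<Sum>j\<in>{1..n}. a j k) = 1"
  shows "fact n / real n ^ n \<le> permanent a {1..n} K"
proof (cases "n = 0")
  case True
  then show ?thesis using K by (simp add: permanent_empty)
next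
  case False
  define b where "b e = (\<lambda>j k. (1 - e) * a j k + e / real n)" for e :: real
  have "fact n / real n ^ n \<le> permanent (b e) {1..n} K" if e: "0 < e" "e < 1" for e
  proof -
    have "(\<Prod>i\<in>{0..<n}. (real i / real (Suc i)) ^ i) * (\<Prod>j\<in>{1..0::nat}. 1) \<le> gform (b e) n K 0 (\<lambda>_. 1 :: real)"
    proof (rule gform_capacity[OF K, where x = "\<lambda>_. 1"])
      show "0 < b e j k" if "j \<in> {1..n}" "k \<in> K" for j k
        unfolding b_def using nn[OF that] e False by (intro add_nonneg_pos) auto
      show "(\<Sum>k\<in>K. b e j k) = 1" if "j \<in> {1..n}" for j
        using row[OF that] K False by (simp add: b_def sum.distrib sum_distrib_left[symmetric])
      show "(\<Sum>j\<in>{1..n}. b e j k) = 1" if "k \<in> K" for k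
        using col[OF that] False by (simp add: b_def sum.distrib sum_distrib_left[symmetric])
    qed auto
    moreover have "{S. S \<subseteq> K \<and> card S = 0} = {{}}" using K(1) by (auto simp: card_eq_0_iff dest: finite_subset)
    ultimately show ?thesis unfolding prod_capacity_factors by (simp add: gform_def)
  qed
  then have "eventually (\<lambda>e. fact n / real n ^ n \<le> permanent (b e) {1..n} K) (at_right 0)"
    by (auto intro: eventually_at_rightI[of 0 1])
  moreover have "((\<lambda>e. permanent (b e) {1..n} K) \<longlongrightarrow> permanent (b 0) {1..n} K) (at_right 0)"
    unfolding permanent_def b_def using False by (intro tendsto_intros) auto
  ultimately have "fact n / real n ^ n \<le> permanent (b 0) {1..n} K"
    by (auto intro: tendsto_lowerbound)
  then show ?thesis by (simp add: b_def)
qed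

section \<open>The entropy bound for permutations\<close>

text \<open>
  The mean over all orderings of \<open>J\<close> of the logarithm of the mass of \<open>j\<close> and everything
  after it.
\<close>

definition mean_tail_ln :: "('a \<Rightarrow> real) \<Rightarrow> 'a \<Rightarrow> 'a set \<Rightarrow> real" where
  "mean_tail_ln b j J = (\<Sum>T\<in>{T. T \<subseteq> J \<and> j \<in> T}.
     fact (card T - 1) * fact (card J - card T) / fact (card J) * ln (sum b T))"

text \<open>Conditioning on the first element of the ordering: if it is \<open>j\<close>, the tail
  is all of \<open>J\<close>; if it is another k, the rest is a random ordering of J - {k}.\<close>

lemma mean_tail_ln_rec:
  assumes "finite J" "j \<in> J"
  shows "real (card J) * mean_tail_ln b j J = ln (sum b J) + (\<Sum>k\<in>J - {j}. mean_tail_ln b j (J - {k}))"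
proof -
  let ?F = "{T. T \<subseteq> J \<and> j \<in> T}"
  define n where "n = card J"
  let ?c = "\<lambda>n t. fact (t - 1) * fact (n - t) / fact n :: real"
  have fin: "finite ?F" using assms by simp
  have n: "0 < n" using assms by (auto simp: n_def card_gt_0_iff)
  have "(\<Sum>k\<in>J - {j}. mean_tail_ln b j (J - {k}))
    = (\<Sum>k\<in>J - {j}. \<Sum>T\<in>{T\<in>?F. k \<notin> T}. ?c (n - 1) (card T) * ln (sum b T))"
  proof (rule sum.cong)
    fix k assume k: "k \<in> J - {j}"
    have "{T. T \<subseteq> J - {k} \<and> j \<in> T} = {T\<in>?F. k \<notin> T}" using k by auto
    moreover have "card (J - {k}) = n - 1" using k assms by (simp add: n_def)
    ultimately show "mean_tail_ln b j (J - {k}) = (\<Sum>T\<in>{T\<in>?F. k \<notin> T}. ?c (n - 1) (card T) * ln (sum b T))"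
      by (simp add: mean_tail_ln_def)
  qed simp
  also have "\<dots> = (\<Sum>T\<in>?F. \<Sum>k\<in>{k\<in>J - {j}. k \<notin> T}. ?c (n - 1) (card T) * ln (sum b T))"
    by (rule sum.swap_restrict) (use assms fin in auto)
  finally have rec: "(\<Sum>k\<in>J - {j}. mean_tail_ln b j (J - {k}))
    = (\<Sum>T\<in>?F. \<Sum>k\<in>{k\<in>J - {j}. k \<notin> T}. ?c (n - 1) (card T) * ln (sum b T))" .
  have "ln (sum b J) + (\<Sum>k\<in>J - {j}. mean_tail_ln b j (J - {k})) = (\<Sum>T\<in>?F. (if T = J then ln (sum b J) else 0)
     + (\<Sum>k\<in>{k\<in>J - {j}. k \<notin> T}. ?c (n - 1) (card T) * ln (sum b T)))"
  proof -
    have "J \<in> ?F" using assms(2) by simp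
    then have "(\<Sum>T\<in>?F. if T = J then ln (sum b J) else 0) = ln (sum b J)"
      using sum.delta[OF fin, of J "\<lambda>_. ln (sum b J)"] by (simp only: if_True)
    then show ?thesis unfolding sum.distrib rec by (simp only:)
  qed
  also have "\<dots> = (\<Sum>T\<in>?F. real n * (?c n (card T) * ln (sum b T)))"
  proof (rule sum.cong)
    fix T assume T: "T \<in> ?F"
    then have finT: "finite T" using assms(1) by (auto dest: finite_subset)
    have "{k\<in>J - {j}. k \<notin> T} = J - T" using T by auto
    then have card: "card {k\<in>J - {j}. k \<notin> T} = n - card T"
      using T finT by (simp add: card_Diff_subset n_def)
    have t0: "0 < card T" using T finT by (auto simp: card_gt_0_iff)
    show "(if T = J then ln (sum b J) else 0)
     + (\<Sum>k\<in>{k\<in>J - {j}. k \<notin> T}. ?c (n - 1) (card T) * ln (sum b T))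
      = real n * (?c n (card T) * ln (sum b T))"
    proof (cases "T = J")
      case True
      then show ?thesis using n card by (cases n) (simp_all add: n_def)
    next
      case False
      then have lt: "card T < n" using T assms psubset_card_mono[of J T] by (auto simp: n_def)
      define s where "s = n - card T - 1"
      have e: "real (n - card T) * ?c (n - 1) (card T) = real n * ?c n (card T)"
      proof -
        have n': "n = Suc (card T + s)" using lt by (simp add: s_def)
        have "n - card T = Suc s" "n - 1 - card T = s" "n - 1 = card T + s" using n' by auto
        then show ?thesis by (simp add: n' del: of_nat_Suc of_nat_add)
      qed
      have "(\<Sum>k\<in>{k\<in>J - {j}. k \<notin> T}. ?c (n - 1) (card T) * ln (sum b T))
        = real (n - card T) * ?c (n - 1) (card T) * ln (sum b T)"
        unfolding sum_constant card by (simp only: mult.assoc)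
      also have "\<dots> = real n * (?c n (card T) * ln (sum b T))" unfolding e by (simp only: mult.assoc)
      finally show ?thesis using False by simp
    qed
  qed simp
  also have "\<dots> = real n * mean_tail_ln b j J"
    by (simp add: mean_tail_ln_def n_def sum_distrib_left)
  finally show ?thesis by (simp add: n_def)
qed

lemma sum_mean_tail_ln:
  assumes "finite J"
  shows "(\<Sum>j\<in>J. b j * mean_tail_ln b j J) = subset_entropy b J"
proof -
  let ?c = "\<lambda>T. fact (card T - 1) * fact (card J - card T) / fact (card J) :: real"
  have "(\<Sum>j\<in>J. b j * mean_tail_ln b j J)
     = (\<Sum>j\<in>J. \<Sum>T\<in>{T\<in>Pow J. j \<in> T}. b j * (?c T * ln (sum b T)))"
    by (simp add: mean_tail_ln_def sum_distrib_left)
  also have "\<dots> = (\<Sum>T\<in>Pow J. \<Sum>j\<in>{j\<in>J. j \<in> T}. b j * (?c T * ln (sum b T)))"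
    using assms by (intro sum.swap_restrict) auto
  also have "\<dots> = (\<Sum>T\<in>Pow J. ?c T * xlnx (sum b T))"
  proof (rule sum.cong)
    fix T assume "T \<in> Pow J"
    then have "{j\<in>J. j \<in> T} = T" by auto
    moreover have "(\<Sum>j\<in>T. b j * (?c T * ln (sum b T))) = sum b T * (?c T * ln (sum b T))"
      by (rule sum_distrib_right[symmetric])
    ultimately show "(\<Sum>j\<in>{j\<in>J. j \<in> T}. b j * (?c T * ln (sum b T))) = ?c T * xlnx (sum b T)"
      by (simp only: xlnx_def mult_ac)
  qed simp
  finally show ?thesis by (simp add: subset_entropy_def)
qed

lemma exp_mean_le:
  fixes x :: "'a \<Rightarrow> real"
  assumes "finite I" "I \<noteq> {}"
  shows "exp ((\<Sum>i\<in>I. x i) / card I) \<le> (\<Sum>i\<in>I. exp (x i)) / card I"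
proof -
  have "exp (\<Sum>i\<in>I. (1 / card I) *\<^sub>R x i) \<le> (\<Sum>i\<in>I. (1 / card I) * exp (x i))"
    using assms by (intro convex_on_sum[OF _ _ exp_convex]) auto
  then show ?thesis by (simp add: sum_divide_distrib)
qed

text \<open>
  Revealing the rows in a fixed order and sampling each column among the free ones with probability
  proportional to \<open>b\<close> is a distribution on permutations; the summand on the left is the geometric
  mean of its weights over all orders. The induction picks the first row at random and applies the
  convexity of \<open>exp\<close>.
\<close>

theorem sequential_sampling_permanent_le:
  fixes b :: "'a \<Rightarrow> 'b \<Rightarrow> real"
  assumes "finite I" "finite J" "card I = card J" "\<And>i j. i \<in> I \<Longrightarrow> j \<in> J \<Longrightarrow> 0 \<le> b i j"
  shows "permanent (\<lambda>i j. b i j * exp (- mean_tail_ln (b i) j J)) I J \<le> 1"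
  using assms
proof (induction "card I" arbitrary: I J)
  case 0
  then show ?case by (simp add: permanent_empty)
next
  case (Suc d)
  define m where "m = card I"
  have m: "0 < m" "I \<noteq> {}" using Suc.hyps(2) by (auto simp: m_def)
  let ?g = "\<lambda>J i j. b i j * exp (- mean_tail_ln (b i) j J)"
  \<comment> \<open>Row \<open>i\<close> is sampled first, and the remaining rows carry geometric
    means over their own orders.\<close>
  let ?R = "\<lambda>f i. b i (f i) / sum (b i) J * (\<Prod>i'\<in>I - {i}. ?g (J - {f i}) i' (f i'))"
  have bnn: "0 \<le> sum (b i) J" if "i \<in> I" for i using that Suc.prems by (intro sum_nonneg) auto
  have "(\<Prod>i\<in>I. ?g J i (f i)) \<le> (\<Sum>i\<in>I. ?R f i) / m" if f: "f \<in> bijections I J" for f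
  proof (cases "\<exists>i\<in>I. b i (f i) = 0")
    case True
    then have "(\<Prod>i\<in>I. ?g J i (f i)) = 0" using Suc.prems(1) by (auto simp: prod_zero_iff)
    moreover have "0 \<le> (\<Sum>i\<in>I. ?R f i) / m"
      using bijections_mem[OF f] Suc.prems bnn
      by (intro divide_nonneg_nonneg sum_nonneg mult_nonneg_nonneg prod_nonneg) auto
    ultimately show ?thesis by simp
  next
    case False
    have bp: "0 < b i (f i)" if "i \<in> I" for i
      using False that bijections_mem[OF f that] Suc.prems(4)[OF that] by (metis order.order_iff_strict)
    have sp: "0 < sum (b i) J" if "i \<in> I" for i
      using bp[OF that] Suc.prems that bijections_mem[OF f that] by (intro sum_pos2[of J "f i"]) auto
    have fJ: "f ` I = J" and inj: "inj_on f I" using f by (auto simp: bijections_def bij_betw_def)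
    define L where "L i = ln (b i (f i))" for i
    define t where "t i i' = mean_tail_ln (b i) (f i) (J - {f i'})" for i i'
    \<comment> \<open>Pulled back along \<open>f\<close>, an ordering of the columns becomes an
      ordering of the rows, and the tail from f i on consists of the columns still free when row
      \<open>i\<close> is revealed.\<close>
    have tail: "m * mean_tail_ln (b i) (f i) J = ln (sum (b i) J) + (\<Sum>i'\<in>I - {i}. t i i')" if i: "i \<in> I" for i
    proof -
      have "f ` (I - {i}) = J - {f i}" using fJ inj i by (auto simp: inj_on_def)
      then have "(\<Sum>k\<in>J - {f i}. mean_tail_ln (b i) (f i) (J - {k})) = (\<Sum>k\<in>f ` (I - {i}). mean_tail_ln (b i) (f i) (J - {k}))"
        by simp
      also have "\<dots> = (\<Sum>i'\<in>I - {i}. t i i')"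
        using inj by (subst sum.reindex) (auto simp: t_def inj_on_def)
      finally show ?thesis
        using mean_tail_ln_rec[OF Suc.prems(2) bijections_mem[OF f i], of "b i"] Suc.prems(3) by (simp add: m_def)
    qed
    have "(\<Prod>i\<in>I. ?g J i (f i)) = exp (\<Sum>i\<in>I. L i - mean_tail_ln (b i) (f i) J)"
      unfolding exp_sum[OF Suc.prems(1)] using bp by (intro prod.cong) (auto simp: L_def exp_diff exp_minus field_simps)
    also have "(\<Sum>i\<in>I. L i - mean_tail_ln (b i) (f i) J)
       = (\<Sum>i\<in>I. L i - ln (sum (b i) J) + (\<Sum>i'\<in>I - {i}. L i' - t i' i)) / m"
    proof -
      have "m * (\<Sum>i\<in>I. L i - mean_tail_ln (b i) (f i) J)
         = (\<Sum>i\<in>I. m * L i - (ln (sum (b i) J) + (\<Sum>i'\<in>I - {i}. t i i')))"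
        unfolding sum_distrib_left by (intro sum.cong refl) (simp add: right_diff_distrib tail)
      also have "\<dots> = (\<Sum>i\<in>I. (L i - ln (sum (b i) J)) + (\<Sum>i'\<in>I - {i}. L i - t i i'))"
      proof (rule sum.cong)
        fix i assume "i \<in> I"
        then have "real m = 1 + real (card (I - {i}))" using Suc.prems(1) m by (simp add: m_def)
        then show "m * L i - (ln (sum (b i) J) + (\<Sum>i'\<in>I - {i}. t i i'))
          = (L i - ln (sum (b i) J)) + (\<Sum>i'\<in>I - {i}. L i - t i i')"
          by (simp add: sum_subtractf algebra_simps del: card_Diff_insert card_Diff_singleton)
      qed simp
      also have "\<dots> = (\<Sum>i\<in>I. L i - ln (sum (b i) J)) + (\<Sum>i\<in>I. \<Sum>i'\<in>I - {i}. L i - t i i')"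
        by (rule sum.distrib)
      \<comment> \<open>Exchanging the roles makes the outer index the row that is revealed
        first.\<close>
      also have "(\<Sum>i\<in>I. \<Sum>i'\<in>I - {i}. L i - t i i') = (\<Sum>i\<in>I. \<Sum>i'\<in>I - {i}. L i' - t i' i)"
        by (rule sum_swap_distinct[OF Suc.prems(1)])
      also have "(\<Sum>i\<in>I. L i - ln (sum (b i) J)) + \<dots>
         = (\<Sum>i\<in>I. L i - ln (sum (b i) J) + (\<Sum>i'\<in>I - {i}. L i' - t i' i))"
        by (rule sum.distrib[symmetric])
      finally show ?thesis using m(1) by (simp add: field_simps)
    qed
    also have "exp \<dots> \<le> (\<Sum>i\<in>I. exp (L i - ln (sum (b i) J) + (\<Sum>i'\<in>I - {i}. L i' - t i' i))) / m"
      unfolding m_def by (rule exp_mean_le[OF Suc.prems(1) m(2)])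
    also have "(\<Sum>i\<in>I. exp (L i - ln (sum (b i) J) + (\<Sum>i'\<in>I - {i}. L i' - t i' i))) = (\<Sum>i\<in>I. ?R f i)"
    proof (rule sum.cong)
      fix i assume i: "i \<in> I"
      have "exp (\<Sum>i'\<in>I - {i}. L i' - t i' i) = (\<Prod>i'\<in>I - {i}. ?g (J - {f i}) i' (f i'))"
        using Suc.prems(1) bp by (subst exp_sum) (auto simp: L_def t_def exp_diff exp_minus field_simps intro!: prod.cong)
      moreover have "exp (L i - ln (sum (b i) J)) = b i (f i) / sum (b i) J"
        using bp[OF i] sp[OF i] by (simp add: L_def exp_diff)
      ultimately show "exp (L i - ln (sum (b i) J) + (\<Sum>i'\<in>I - {i}. L i' - t i' i)) = ?R f i"
        by (simp add: exp_add)
    qed simp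
    finally show ?thesis .
  qed
  then have "permanent (?g J) I J \<le> (\<Sum>f\<in>bijections I J. (\<Sum>i\<in>I. ?R f i) / m)"
    unfolding permanent_def by (rule sum_mono)
  also have "\<dots> = (\<Sum>i\<in>I. \<Sum>f\<in>bijections I J. ?R f i) / m"
    unfolding sum_divide_distrib[symmetric] by (subst sum.swap) simp
  also have "\<dots> \<le> (\<Sum>i\<in>I. 1) / m"
  proof (intro divide_right_mono sum_mono)
    fix i assume i: "i \<in> I"
    have "(\<Sum>f\<in>bijections I J. ?R f i)
       = (\<Sum>k\<in>J. \<Sum>f\<in>bijections (I - {i}) (J - {k}). ?R (f(i := k)) i)"
      using sum_bijections_insert[of "I - {i}" J i "\<lambda>f. ?R f i"] Suc.prems i by (simp add: insert_absorb)
    also have "\<dots> = (\<Sum>k\<in>J. b i k / sum (b i) J * permanent (?g (J - {k})) (I - {i}) (J - {k}))"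
      unfolding permanent_def sum_distrib_left
      by (intro sum.cong refl) (auto intro!: arg_cong2[where f = "(*)"] prod.cong)
    also have "\<dots> \<le> (\<Sum>k\<in>J. b i k / sum (b i) J * 1)"
    proof (intro sum_mono mult_left_mono)
      fix k assume k: "k \<in> J"
      show "permanent (?g (J - {k})) (I - {i}) (J - {k}) \<le> 1"
        using Suc.hyps(2) Suc.prems i k by (intro Suc.hyps(1)) auto
      show "0 \<le> b i k / sum (b i) J" using bnn[OF i] Suc.prems(4)[OF i k] by simp
    qed
    also have "\<dots> \<le> 1" by (simp add: sum_divide_distrib[symmetric])
    finally show "(\<Sum>f\<in>bijections I J. ?R f i) \<le> 1" .
  qed simp
  also have "\<dots> = 1" using m by (simp add: m_def)
  finally show ?case .
qed

section \<open>Gibbs' inequality with prescribed marginals\<close>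

lemma co_weight_pos: "g \<le> 1 \<Longrightarrow> 0 < co_weight g"
  by (auto simp: co_weight_def)

lemma xlnx_co_weight: "(1 - g) * ln (co_weight g) = xlnx (1 - g)"
  by (simp add: co_weight_def xlnx_def)

text \<open>F / N is a distribution with marginals g, and the sampling weights W have total at most
  1. Gibbs' inequality bounds the mean of ln (F / (N W)) from below by 0; by \<open>bound\<close>
  the mean of ln (F / W) is at most that of a sum of functions of single pairs (i, \<sigma> i),
  which depends on the marginals only.\<close>

theorem entropy_count_bound:
  fixes g :: "'a \<Rightarrow> 'a \<Rightarrow> real" and F :: "('a \<Rightarrow> 'a) \<Rightarrow> real"
  assumes I: "finite I"
    and nn: "\<And>i j. i \<in> I \<Longrightarrow> j \<in> I \<Longrightarrow> 0 \<le> g i j"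
    and row: "\<And>i. i \<in> I \<Longrightarrow> (\<Sum>j\<in>I. g i j) = 1"
    and F: "\<And>\<sigma>. \<sigma> permutes I \<Longrightarrow> 0 \<le> F \<sigma>"
    and N: "(\<Sum>\<sigma>\<in>{\<sigma>. \<sigma> permutes I}. F \<sigma>) = N" "0 < N"
    and marg: "\<And>i j. i \<in> I \<Longrightarrow> j \<in> I \<Longrightarrow> (\<Sum>\<sigma>\<in>{\<sigma>. \<sigma> permutes I \<and> \<sigma> i = j}. F \<sigma>) = g i j * N"
    and D: "0 < D"
    and bound: "\<And>\<sigma>. \<sigma> permutes I \<Longrightarrow> 0 < F \<sigma> \<Longrightarrow>
      F \<sigma> \<le> D * (\<Prod>i\<in>I. g i (\<sigma> i) * co_weight (g i (\<sigma> i))) / (\<Prod>i\<in>I. \<Prod>j\<in>I. co_weight (g i j))"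
  shows "N \<le> D * exp (real (card I) * (ln 2 / 2))"
proof -
  let ?S = "{\<sigma>. \<sigma> permutes I}"
  have finS: "finite ?S" using I by (rule finite_permutations)
  have in_I: "\<sigma> i \<in> I" if "\<sigma> permutes I" "i \<in> I" for \<sigma> i using that by (simp add: permutes_in_image)
  have g1: "g i j \<le> 1" if "i \<in> I" "j \<in> I" for i j
    using member_le_sum[of j I "g i"] that nn row I by simp
  have cw: "0 < co_weight (g i j)" if "i \<in> I" "j \<in> I" for i j
    using g1[OF that] by (rule co_weight_pos)
  \<comment> \<open>What \<open>bound\<close> and \<open>W\<close> leave behind in row
    \<open>i\<close>: their factors g i (\<sigma> i) cancel.\<close>
  define c where "c i j = ln (co_weight (g i j)) + mean_tail_ln (g i) j I" for i j
  define Z where "Z = (\<Sum>i\<in>I. \<Sum>j\<in>I. ln (co_weight (g i j)))"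
  define W where "W \<sigma> = (\<Prod>i\<in>I. g i (\<sigma> i) * exp (- mean_tail_ln (g i) (\<sigma> i) I))" for \<sigma>
  have W1: "(\<Sum>\<sigma>\<in>?S. W \<sigma>) \<le> 1"
    using sequential_sampling_permanent_le[OF I I refl nn] by (simp add: permanent_permutes W_def)
  have step: "F \<sigma> / N * (ln N - ln D - ((\<Sum>i\<in>I. c i (\<sigma> i)) - Z)) \<le> W \<sigma> - F \<sigma> / N"
    if s: "\<sigma> permutes I" for \<sigma>
  proof (cases "F \<sigma> = 0")
    case True
    have "0 \<le> W \<sigma>" unfolding W_def using nn in_I[OF s] by (intro prod_nonneg) auto
    then show ?thesis using True by simp
  next
    case False
    then have Fp: "0 < F \<sigma>" using F[OF s] by simp
    have gp: "0 < g i (\<sigma> i)" if i: "i \<in> I" for i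
    proof -
      have "F \<sigma> \<le> (\<Sum>\<tau>\<in>{\<tau>. \<tau> permutes I \<and> \<tau> i = \<sigma> i}. F \<tau>)"
        using s F finS by (intro member_le_sum) auto
      also have "\<dots> = g i (\<sigma> i) * N" by (rule marg[OF i in_I[OF s i]])
      finally have "0 < g i (\<sigma> i) * N" using Fp by linarith
      then show ?thesis using N(2) by (simp add: zero_less_mult_iff)
    qed
    have gn: "g i (\<sigma> i) \<noteq> 0" if "i \<in> I" for i using gp[OF that] by simp
    have cn: "co_weight (g i j) \<noteq> 0" if "i \<in> I" "j \<in> I" for i j using cw[OF that] by simp
    have lnW: "ln (W \<sigma>) = (\<Sum>i\<in>I. ln (g i (\<sigma> i)) - mean_tail_ln (g i) (\<sigma> i) I)"
    proof -
      have "ln (W \<sigma>) = (\<Sum>i\<in>I. ln (g i (\<sigma> i) * exp (- mean_tail_ln (g i) (\<sigma> i) I)))"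
        unfolding W_def by (rule ln_prod) (use I gn in auto)
      also have "\<dots> = (\<Sum>i\<in>I. ln (g i (\<sigma> i)) - mean_tail_ln (g i) (\<sigma> i) I)"
      proof (rule sum.cong)
        fix i assume i: "i \<in> I"
        show "ln (g i (\<sigma> i) * exp (- mean_tail_ln (g i) (\<sigma> i) I)) = ln (g i (\<sigma> i)) - mean_tail_ln (g i) (\<sigma> i) I"
          using ln_mult_pos[OF gp[OF i] exp_gt_zero] by simp
      qed simp
      finally show ?thesis .
    qed
    have Wp: "0 < W \<sigma>" unfolding W_def using gp by (intro prod_pos) auto
    define A where "A = (\<Prod>i\<in>I. g i (\<sigma> i) * co_weight (g i (\<sigma> i)))"
    define B where "B = (\<Prod>i\<in>I. \<Prod>j\<in>I. co_weight (g i j))"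
    have lnA: "ln A = (\<Sum>i\<in>I. ln (g i (\<sigma> i)) + ln (co_weight (g i (\<sigma> i))))"
    proof -
      have "ln A = (\<Sum>i\<in>I. ln (g i (\<sigma> i) * co_weight (g i (\<sigma> i))))"
        unfolding A_def by (rule ln_prod) (use I gn cn in_I[OF s] in auto)
      also have "\<dots> = (\<Sum>i\<in>I. ln (g i (\<sigma> i)) + ln (co_weight (g i (\<sigma> i))))"
      proof (rule sum.cong)
        fix i assume i: "i \<in> I"
        show "ln (g i (\<sigma> i) * co_weight (g i (\<sigma> i))) = ln (g i (\<sigma> i)) + ln (co_weight (g i (\<sigma> i)))"
          by (rule ln_mult_pos[OF gp[OF i] cw[OF i in_I[OF s i]]])
      qed simp
      finally show ?thesis .
    qed
    have lnB: "ln B = Z"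
    proof -
      have "ln B = (\<Sum>i\<in>I. ln (\<Prod>j\<in>I. co_weight (g i j)))"
        unfolding B_def by (rule ln_prod) (use I cn in auto)
      also have "\<dots> = Z" unfolding Z_def by (intro sum.cong refl ln_prod I cn)
      finally show ?thesis .
    qed
    have Ap: "0 < A" and Bp: "0 < B" unfolding A_def B_def
      using gp cw in_I[OF s] by (auto intro!: prod_pos mult_pos_pos)
    have "ln (F \<sigma>) \<le> ln (D * A / B)"
      using bound[OF s Fp] Fp Ap Bp D unfolding A_def[symmetric] B_def[symmetric]
      by (subst ln_le_cancel_iff) auto
    also have "\<dots> = ln D + ln A - ln B" using D Ap Bp by (simp add: ln_div ln_mult)
    finally have "ln (F \<sigma>) - ln (W \<sigma>) \<le> ln D + ((\<Sum>i\<in>I. c i (\<sigma> i)) - Z)"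
      unfolding lnA lnB lnW by (simp add: c_def sum.distrib sum_subtractf)
    then have "F \<sigma> / N * (ln N - ln D - ((\<Sum>i\<in>I. c i (\<sigma> i)) - Z))
       \<le> F \<sigma> / N * (ln N + ln (W \<sigma>) - ln (F \<sigma>))"
      using Fp N(2) by (intro mult_left_mono) auto
    also have "ln N + ln (W \<sigma>) - ln (F \<sigma>) = ln (W \<sigma> * N / F \<sigma>)"
      using Fp N(2) Wp by (simp add: ln_div ln_mult)
    also have "F \<sigma> / N * \<dots> \<le> F \<sigma> / N * (W \<sigma> * N / F \<sigma> - 1)"
      using Fp N(2) Wp by (intro mult_left_mono ln_le_minus_one) auto
    also have "\<dots> = W \<sigma> - F \<sigma> / N" using Fp N(2) by (simp add: field_simps)
    finally show ?thesis .
  qed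
  have mean: "(\<Sum>\<sigma>\<in>?S. F \<sigma> / N * c i (\<sigma> i)) = (\<Sum>j\<in>I. g i j * c i j)" if i: "i \<in> I" for i
  proof -
    have "(\<Sum>\<sigma>\<in>?S. F \<sigma> / N * c i (\<sigma> i))
       = (\<Sum>j\<in>I. \<Sum>\<sigma>\<in>{\<sigma>\<in>?S. \<sigma> i = j}. F \<sigma> / N * c i (\<sigma> i))"
      using finS I in_I[OF _ i] by (intro sum.group[symmetric]) auto
    also have "\<dots> = (\<Sum>j\<in>I. g i j * c i j)"
    proof (rule sum.cong)
      fix j assume j: "j \<in> I"
      have "(\<Sum>\<sigma>\<in>{\<sigma>\<in>?S. \<sigma> i = j}. F \<sigma> / N * c i (\<sigma> i)) = (\<Sum>\<sigma>\<in>{\<sigma>. \<sigma> permutes I \<and> \<sigma> i = j}. F \<sigma>) * (c i j / N)"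
        unfolding sum_distrib_right by (rule sum.cong) auto
      then show "(\<Sum>\<sigma>\<in>{\<sigma>\<in>?S. \<sigma> i = j}. F \<sigma> / N * c i (\<sigma> i)) = g i j * c i j"
        unfolding marg[OF i j] using N(2) by simp
    qed simp
    finally show ?thesis .
  qed
  \<comment> \<open>The weights g from the mean and 1 - g from \<open>subset_entropy_le\<close> add
    up to 1 in front of every ln (co_weight), so the rows together reproduce \<open>Z\<close>, which
    cancels.\<close>
  have row_le: "(\<Sum>j\<in>I. g i j * c i j) \<le> (\<Sum>j\<in>I. ln (co_weight (g i j))) + ln 2 / 2" if i: "i \<in> I" for i
  proof -
    have "(\<Sum>j\<in>I. g i j * c i j) = (\<Sum>j\<in>I. g i j * ln (co_weight (g i j))) + subset_entropy (g i) I"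
      unfolding sum_mean_tail_ln[OF I, symmetric] by (simp add: c_def algebra_simps sum.distrib)
    also have "subset_entropy (g i) I \<le> (\<Sum>j\<in>I. xlnx (1 - g i j)) + ln 2 / 2"
      using subset_entropy_le[OF I, of "g i"] nn row i by blast
    also have "(\<Sum>j\<in>I. g i j * ln (co_weight (g i j))) + ((\<Sum>j\<in>I. xlnx (1 - g i j)) + ln 2 / 2)
      = (\<Sum>j\<in>I. ln (co_weight (g i j))) + ln 2 / 2"
      unfolding xlnx_co_weight[symmetric] by (simp add: algebra_simps sum_subtractf)
    finally show ?thesis by simp
  qed
  have alg: "q * (a - b - (s - z)) = (a - b + z) * q - q * s" for q a b s z :: real
    by (simp add: algebra_simps)
  have one: "(\<Sum>\<sigma>\<in>?S. F \<sigma> / N) = 1" using N by (simp add: sum_divide_distrib[symmetric])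
  have "(\<Sum>\<sigma>\<in>?S. F \<sigma> / N * (ln N - ln D - ((\<Sum>i\<in>I. c i (\<sigma> i)) - Z))) \<le> (\<Sum>\<sigma>\<in>?S. W \<sigma> - F \<sigma> / N)"
    by (rule sum_mono) (use step in auto)
  also have "\<dots> \<le> 0" using W1 one by (simp add: sum_subtractf)
  also have "(\<Sum>\<sigma>\<in>?S. F \<sigma> / N * (ln N - ln D - ((\<Sum>i\<in>I. c i (\<sigma> i)) - Z)))
     = (ln N - ln D + Z) * (\<Sum>\<sigma>\<in>?S. F \<sigma> / N) - (\<Sum>\<sigma>\<in>?S. \<Sum>i\<in>I. F \<sigma> / N * c i (\<sigma> i))"
    unfolding sum_distrib_left[of "ln N - ln D + Z"] sum_subtractf[symmetric]
      sum_distrib_left[symmetric, of "F \<sigma> / N" for \<sigma>]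
    by (rule sum.cong[OF refl]) (rule alg)
  also have "(\<Sum>\<sigma>\<in>?S. \<Sum>i\<in>I. F \<sigma> / N * c i (\<sigma> i)) = (\<Sum>i\<in>I. \<Sum>\<sigma>\<in>?S. F \<sigma> / N * c i (\<sigma> i))"
    by (rule sum.swap)
  also have "\<dots> = (\<Sum>i\<in>I. \<Sum>j\<in>I. g i j * c i j)" by (rule sum.cong[OF refl]) (rule mean)
  finally have "ln N \<le> ln D - Z + (\<Sum>i\<in>I. \<Sum>j\<in>I. g i j * c i j)" unfolding one by simp
  also have "(\<Sum>i\<in>I. \<Sum>j\<in>I. g i j * c i j) \<le> (\<Sum>i\<in>I. (\<Sum>j\<in>I. ln (co_weight (g i j))) + ln 2 / 2)"
    by (rule sum_mono) (rule row_le)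
  also have "\<dots> = Z + real (card I) * (ln 2 / 2)" by (simp add: Z_def sum.distrib)
  finally have "ln N \<le> ln D + real (card I) * (ln 2 / 2)" by simp
  then have "exp (ln N) \<le> exp (ln D + real (card I) * (ln 2 / 2))" by simp
  then show ?thesis using N(2) D by (simp add: exp_add)
qed

section \<open>Counting decompositions\<close>

definition decompositions :: "nat \<Rightarrow> nat \<Rightarrow> (nat \<Rightarrow> nat \<Rightarrow> nat) \<Rightarrow> (nat \<Rightarrow> nat \<Rightarrow> nat) set" where
  "decompositions n M K = {s \<in> {1..M} \<rightarrow>\<^sub>E {\<sigma>. \<sigma> permutes {1..n}}.
     \<forall>i\<in>{1..n}. \<forall>j\<in>{1..n}. K i j = (\<Sum>m\<in>{1..M}. if s m i = j then 1 else 0)}"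

text \<open>Truncated subtraction; it is exact on rows in {1..n} for the permutations in
  \<open>supported\<close>.\<close>

definition peel :: "(nat \<Rightarrow> nat \<Rightarrow> nat) \<Rightarrow> (nat \<Rightarrow> nat) \<Rightarrow> nat \<Rightarrow> nat \<Rightarrow> nat" where
  "peel K \<sigma> i j = K i j - (if \<sigma> i = j then 1 else 0)"

definition supported :: "nat \<Rightarrow> (nat \<Rightarrow> nat \<Rightarrow> nat) \<Rightarrow> (nat \<Rightarrow> nat) set" where
  "supported n K = {\<sigma>. \<sigma> permutes {1..n} \<and> (\<forall>i\<in>{1..n}. 0 < K i (\<sigma> i))}"

definition line_sums :: "nat \<Rightarrow> nat \<Rightarrow> (nat \<Rightarrow> nat \<Rightarrow> nat) \<Rightarrow> bool" where
  "line_sums n M K \<longleftrightarrow> (\<forall>i\<in>{1..n}. (\<Sum>j\<in>{1..n}. K i j) = M) \<and> (\<forall>j\<in>{1..n}. (\<Sum>i\<in>{1..n}. K i j) = M)"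

lemma finite_perms: "finite {\<sigma>. \<sigma> permutes {1..n::nat}}"
  by (simp add: finite_permutations)

lemma finite_supported: "finite (supported n K)"
  unfolding supported_def by (rule finite_subset[OF _ finite_perms[of n]]) auto

lemma finite_decompositions: "finite (decompositions n M K)"
  unfolding decompositions_def
  by (rule finite_subset[of _ "{1..M} \<rightarrow>\<^sub>E {\<sigma>. \<sigma> permutes {1..n}}"]) (auto intro!: finite_PiE simp: finite_permutations)

lemma decompositions_0: "decompositions n 0 K = (if \<forall>i\<in>{1..n}. \<forall>j\<in>{1..n}. K i j = 0 then {\<lambda>_. undefined} else {})"
  by (auto simp: decompositions_def)

text \<open>Tuples are sorted by their last component, which must be supported because it
  contributes to \<open>K\<close> itself.\<close>

lemma card_decompositions_Suc:
  "card (decompositions n (Suc M) K) = (\<Sum>\<sigma>\<in>supported n K. card (decompositions n M (peel K \<sigma>)))"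
proof -
  let ?D = "decompositions n (Suc M) K"
  have ins: "{1..Suc M} = insert (Suc M) {1..M}" by auto
  have mem: "s \<in> ?D \<longleftrightarrow> s \<in> {1..Suc M} \<rightarrow>\<^sub>E {\<sigma>. \<sigma> permutes {1..n}} \<and> (\<forall>i\<in>{1..n}. \<forall>j\<in>{1..n}.
      K i j = (if s (Suc M) i = j then 1 else 0) + (\<Sum>m\<in>{1..M}. if s m i = j then 1 else 0))" for s
    unfolding decompositions_def ins by simp
  have img: "(\<lambda>s. s (Suc M)) ` ?D \<subseteq> supported n K"
  proof
    fix \<sigma> assume "\<sigma> \<in> (\<lambda>s. s (Suc M)) ` ?D"
    then obtain s where s: "s \<in> ?D" "\<sigma> = s (Suc M)" by auto
    then have p: "\<sigma> permutes {1..n}" by (auto simp: mem PiE_iff)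
    moreover have "0 < K i (\<sigma> i)" if "i \<in> {1..n}" for i
    proof -
      have "\<sigma> i \<in> {1..n}" using p that by (simp only: permutes_in_image)
      then show ?thesis using s that unfolding mem by simp
    qed
    ultimately show "\<sigma> \<in> supported n K" by (simp add: supported_def)
  qed
  have fiber: "card {s\<in>?D. s (Suc M) = \<sigma>} = card (decompositions n M (peel K \<sigma>))" if \<sigma>: "\<sigma> \<in> supported n K" for \<sigma>
  proof (rule bij_betw_same_card[of "\<lambda>s. s(Suc M := undefined)"], rule bij_betw_byWitness[where f' = "\<lambda>s. s(Suc M := \<sigma>)"])
    have p: "\<sigma> permutes {1..n}" and pos: "\<And>i. i \<in> {1..n} \<Longrightarrow> 0 < K i (\<sigma> i)"
      using \<sigma> by (auto simp: supported_def)
    have peq: "K i j = (if \<sigma> i = j then 1 else 0) + x \<longleftrightarrow> peel K \<sigma> i j = x" if "i \<in> {1..n}" for i j x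
      using pos[OF that] by (auto simp: peel_def)
    have same: "(\<Sum>m\<in>{1..M}. if (s(Suc M := t)) m i = j then 1 else 0 :: nat) = (\<Sum>m\<in>{1..M}. if s m i = j then 1 else 0)"
      for s :: "nat \<Rightarrow> nat \<Rightarrow> nat" and t i j by (intro sum.cong) auto
    show "\<forall>s\<in>{s \<in> ?D. s (Suc M) = \<sigma>}. (s(Suc M := undefined))(Suc M := \<sigma>) = s" by auto
    show "\<forall>s\<in>decompositions n M (peel K \<sigma>). (s(Suc M := \<sigma>))(Suc M := undefined) = s"
      by (auto simp: decompositions_def PiE_iff extensional_def fun_eq_iff)
    show "(\<lambda>s. s(Suc M := undefined)) ` {s \<in> ?D. s (Suc M) = \<sigma>} \<subseteq> decompositions n M (peel K \<sigma>)"
    proof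
      fix t assume "t \<in> (\<lambda>s. s(Suc M := undefined)) ` {s \<in> ?D. s (Suc M) = \<sigma>}"
      then obtain s where s: "s \<in> ?D" "s (Suc M) = \<sigma>" "t = s(Suc M := undefined)" by auto
      have "t \<in> {1..M} \<rightarrow>\<^sub>E {\<sigma>. \<sigma> permutes {1..n}}"
        using s(1) unfolding mem s(3) by (auto simp: PiE_iff extensional_def)
      moreover have "\<forall>i\<in>{1..n}. \<forall>j\<in>{1..n}. peel K \<sigma> i j = (\<Sum>m\<in>{1..M}. if t m i = j then 1 else 0)"
        using s(1) peq unfolding mem s(3) same s(2) by blast
      ultimately show "t \<in> decompositions n M (peel K \<sigma>)" by (simp add: decompositions_def)
    qed
    show "(\<lambda>s. s(Suc M := \<sigma>)) ` decompositions n M (peel K \<sigma>) \<subseteq> {s \<in> ?D. s (Suc M) = \<sigma>}"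
    proof
      fix t assume "t \<in> (\<lambda>s. s(Suc M := \<sigma>)) ` decompositions n M (peel K \<sigma>)"
      then obtain s where s: "s \<in> decompositions n M (peel K \<sigma>)" "t = s(Suc M := \<sigma>)" by auto
      then have s1: "s \<in> {1..M} \<rightarrow>\<^sub>E {\<sigma>. \<sigma> permutes {1..n}}"
        and s2: "\<forall>i\<in>{1..n}. \<forall>j\<in>{1..n}. peel K \<sigma> i j = (\<Sum>m\<in>{1..M}. if s m i = j then 1 else 0)"
        by (auto simp: decompositions_def)
      have "t \<in> {1..Suc M} \<rightarrow>\<^sub>E {\<sigma>. \<sigma> permutes {1..n}}"
        using s1 p unfolding s(2) by (auto simp: PiE_iff extensional_def)
      moreover have "t (Suc M) = \<sigma>" using s by simp
      moreover have "\<forall>i\<in>{1..n}. \<forall>j\<in>{1..n}. K i j = (if \<sigma> i = j then 1 else 0) + (\<Sum>m\<in>{1..M}. if t m i = j then 1 else 0)"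
        using s2 peq unfolding s(2) same by blast
      ultimately show "t \<in> {s \<in> ?D. s (Suc M) = \<sigma>}" by (simp add: mem)
    qed
  qed
  have "card ?D = (\<Sum>\<sigma>\<in>supported n K. card {s\<in>?D. s (Suc M) = \<sigma>})"
    using sum.group[OF finite_decompositions finite_supported img, of "\<lambda>_. 1 :: nat"] by simp
  also have "\<dots> = (\<Sum>\<sigma>\<in>supported n K. card (decompositions n M (peel K \<sigma>)))"
    by (rule sum.cong) (use fiber in auto)
  finally show ?thesis .
qed

lemma line_sums_peel:
  assumes K: "line_sums n (Suc M) K" and \<sigma>: "\<sigma> \<in> supported n K"
  shows "line_sums n M (peel K \<sigma>)"
proof -
  have p: "\<sigma> permutes {1..n}" and pos: "\<And>i. i \<in> {1..n} \<Longrightarrow> 0 < K i (\<sigma> i)"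
    using \<sigma> by (auto simp: supported_def)
  have add: "K i j = peel K \<sigma> i j + (if \<sigma> i = j then 1 else 0)" if "i \<in> {1..n}" for i j
    using pos[OF that] by (auto simp: peel_def)
  have r: "(\<Sum>j\<in>{1..n}. if \<sigma> i = j then 1 else 0 :: nat) = 1" if "i \<in> {1..n}" for i
    using permutes_in_image[OF p, of i] that by simp
  have c: "(\<Sum>i\<in>{1..n}. if \<sigma> i = j then 1 else 0 :: nat) = 1" if "j \<in> {1..n}" for j
  proof -
    have "\<sigma> i = j \<longleftrightarrow> i = inv \<sigma> j" for i using permutes_inv_eq[OF p, of j i] by auto
    then have "(\<Sum>i\<in>{1..n}. if \<sigma> i = j then 1 else 0 :: nat) = (\<Sum>i\<in>{1..n}. if i = inv \<sigma> j then 1 else 0)"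
      by (simp only:)
    then show ?thesis using permutes_in_image[OF permutes_inv[OF p], of j] that by simp
  qed
  have "(\<Sum>j\<in>{1..n}. peel K \<sigma> i j) = M" if i: "i \<in> {1..n}" for i
  proof -
    have "Suc M = (\<Sum>j\<in>{1..n}. K i j)" using K i by (simp add: line_sums_def)
    also have "\<dots> = (\<Sum>j\<in>{1..n}. peel K \<sigma> i j + (if \<sigma> i = j then 1 else 0))"
      by (rule sum.cong[OF refl]) (rule add[OF i])
    also have "\<dots> = (\<Sum>j\<in>{1..n}. peel K \<sigma> i j) + 1" by (simp only: sum.distrib r[OF i])
    finally show ?thesis by simp
  qed
  moreover have "(\<Sum>i\<in>{1..n}. peel K \<sigma> i j) = M" if j: "j \<in> {1..n}" for j
  proof -
    have "Suc M = (\<Sum>i\<in>{1..n}. K i j)" using K j by (simp add: line_sums_def)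
    also have "\<dots> = (\<Sum>i\<in>{1..n}. peel K \<sigma> i j + (if \<sigma> i = j then 1 else 0))"
      by (rule sum.cong[OF refl]) (rule add)
    also have "\<dots> = (\<Sum>i\<in>{1..n}. peel K \<sigma> i j) + 1" by (simp only: sum.distrib c[OF j])
    finally show ?thesis by simp
  qed
  ultimately show ?thesis by (simp add: line_sums_def)
qed

lemma line_sums_le: "line_sums n M K \<Longrightarrow> i \<in> {1..n} \<Longrightarrow> j \<in> {1..n} \<Longrightarrow> K i j \<le> M"
  using member_le_sum[of j "{1..n}" "K i"] by (simp add: line_sums_def)

text \<open>The tuples are exchangeable, so the first permutation of a uniformly random one has marginals
  \<open>K / (M + 1)\<close>.\<close>

lemma card_decompositions_marginal:
  assumes "i \<in> {1..n}" "j \<in> {1..n}"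
  shows "Suc M * (\<Sum>\<sigma>\<in>{\<sigma>\<in>supported n K. \<sigma> i = j}. card (decompositions n M (peel K \<sigma>)))
    = K i j * card (decompositions n (Suc M) K)"
proof (induction M arbitrary: K)
  case 0
  have "card (decompositions n 0 (peel K \<sigma>)) * (if \<sigma> i = j then 1 else 0) = K i j * card (decompositions n 0 (peel K \<sigma>))"
    if "\<sigma> \<in> supported n K" for \<sigma>
  proof (cases "\<forall>i\<in>{1..n}. \<forall>j\<in>{1..n}. peel K \<sigma> i j = 0")
    case True
    then have "peel K \<sigma> i j = 0" using assms by blast
    moreover have "0 < K i (\<sigma> i)" using that assms by (simp add: supported_def)
    ultimately have "K i j = (if \<sigma> i = j then 1 else 0)"
      by (auto simp: peel_def split: if_splits)
    then show ?thesis by simp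
  next
    case False
    then have "decompositions n 0 (peel K \<sigma>) = {}" by (simp only: decompositions_0 if_False)
    then show ?thesis by simp
  qed
  then have "(\<Sum>\<sigma>\<in>supported n K. card (decompositions n 0 (peel K \<sigma>)) * (if \<sigma> i = j then 1 else 0))
    = K i j * card (decompositions n (Suc 0) K)"
    unfolding card_decompositions_Suc sum_distrib_left by (rule sum.cong[OF refl])
  moreover have "(\<Sum>\<sigma>\<in>{\<sigma>\<in>supported n K. \<sigma> i = j}. card (decompositions n 0 (peel K \<sigma>)))
     = (\<Sum>\<sigma>\<in>supported n K. card (decompositions n 0 (peel K \<sigma>)) * (if \<sigma> i = j then 1 else 0))"
    using finite_supported by (intro sum.mono_neutral_cong_left) auto
  ultimately show ?case by simp
next
  case (Suc M)
  let ?d = "\<lambda>M K. card (decompositions n M K)"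
  let ?X = "\<Sum>\<sigma>\<in>{\<sigma>\<in>supported n K. \<sigma> i = j}. ?d (Suc M) (peel K \<sigma>)"
  have swap: "\<tau> \<in> supported n (peel K \<sigma>) \<and> \<sigma> \<in> supported n K \<longleftrightarrow> \<sigma> \<in> supported n (peel K \<tau>) \<and> \<tau> \<in> supported n K" for \<sigma> \<tau>
  proof -
    have "(\<forall>i\<in>{1..n}. 0 < peel K \<sigma> i (\<tau> i) \<and> 0 < K i (\<sigma> i)) \<longleftrightarrow> (\<forall>i\<in>{1..n}. 0 < peel K \<tau> i (\<sigma> i) \<and> 0 < K i (\<tau> i))"
      by (intro ball_cong refl) (auto simp: peel_def)
    then show ?thesis by (auto simp: supported_def)
  qed
  have comm: "peel (peel K \<sigma>) \<tau> = peel (peel K \<tau>) \<sigma>" for \<sigma> \<tau> by (auto simp: peel_def fun_eq_iff)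
  let ?S = "{\<sigma>. \<sigma> permutes {1..n}}"
  have supp: "supported n L \<subseteq> ?S" for L by (auto simp: supported_def)
  \<comment> \<open>Two permutations are removed and their order exchanged, so that the constraint
    at (i, j) falls on the inner one, where the induction hypothesis applies.\<close>
  have "?X = (\<Sum>\<sigma>\<in>{\<sigma>\<in>supported n K. \<sigma> i = j}. \<Sum>\<tau>\<in>{\<tau>\<in>?S. \<tau> \<in> supported n (peel K \<sigma>)}. ?d M (peel (peel K \<sigma>) \<tau>))"
  proof (rule sum.cong[OF refl])
    fix \<sigma>
    have "{\<tau>\<in>?S. \<tau> \<in> supported n (peel K \<sigma>)} = supported n (peel K \<sigma>)" using supp by blast
    then show "?d (Suc M) (peel K \<sigma>) = (\<Sum>\<tau>\<in>{\<tau>\<in>?S. \<tau> \<in> supported n (peel K \<sigma>)}. ?d M (peel (peel K \<sigma>) \<tau>))"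
      by (simp only: card_decompositions_Suc)
  qed
  also have "\<dots> = (\<Sum>\<tau>\<in>?S. \<Sum>\<sigma>\<in>{\<sigma>\<in>{\<sigma>\<in>supported n K. \<sigma> i = j}. \<tau> \<in> supported n (peel K \<sigma>)}. ?d M (peel (peel K \<sigma>) \<tau>))"
    by (rule sum.swap_restrict) (use finite_supported finite_perms in auto)
  also have "\<dots> = (\<Sum>\<tau>\<in>supported n K. \<Sum>\<sigma>\<in>{\<sigma>\<in>supported n (peel K \<tau>). \<sigma> i = j}. ?d M (peel (peel K \<tau>) \<sigma>))"
  proof (rule sum.mono_neutral_cong_right)
    show "\<forall>\<tau>\<in>?S - supported n K. (\<Sum>\<sigma>\<in>{\<sigma>\<in>{\<sigma>\<in>supported n K. \<sigma> i = j}. \<tau> \<in> supported n (peel K \<sigma>)}. ?d M (peel (peel K \<sigma>) \<tau>)) = 0"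
    proof
      fix \<tau> assume "\<tau> \<in> ?S - supported n K"
      then have "{\<sigma>\<in>{\<sigma>\<in>supported n K. \<sigma> i = j}. \<tau> \<in> supported n (peel K \<sigma>)} = {}" using swap by blast
      then show "(\<Sum>\<sigma>\<in>{\<sigma>\<in>{\<sigma>\<in>supported n K. \<sigma> i = j}. \<tau> \<in> supported n (peel K \<sigma>)}. ?d M (peel (peel K \<sigma>) \<tau>)) = 0"
        by (simp only: sum.empty)
    qed
    fix \<tau> assume "\<tau> \<in> supported n K"
    then have "{\<sigma>\<in>{\<sigma>\<in>supported n K. \<sigma> i = j}. \<tau> \<in> supported n (peel K \<sigma>)} = {\<sigma>\<in>supported n (peel K \<tau>). \<sigma> i = j}"
      using swap by blast
    then show "(\<Sum>\<sigma>\<in>{\<sigma>\<in>{\<sigma>\<in>supported n K. \<sigma> i = j}. \<tau> \<in> supported n (peel K \<sigma>)}. ?d M (peel (peel K \<sigma>) \<tau>))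
      = (\<Sum>\<sigma>\<in>{\<sigma>\<in>supported n (peel K \<tau>). \<sigma> i = j}. ?d M (peel (peel K \<tau>) \<sigma>))"
      by (rule sum.cong) (simp only: comm)
  qed (use supp finite_perms in auto)
  finally have X: "?X = (\<Sum>\<tau>\<in>supported n K. \<Sum>\<sigma>\<in>{\<sigma>\<in>supported n (peel K \<tau>). \<sigma> i = j}. ?d M (peel (peel K \<tau>) \<sigma>))" .
  \<comment> \<open>The induction hypothesis supplies all components but the last, whose own share
    is ?X; adding it restores the entry that \<open>peel\<close> diminished.\<close>
  have "Suc M * ?X = (\<Sum>\<tau>\<in>supported n K. peel K \<tau> i j * ?d (Suc M) (peel K \<tau>))"
    unfolding X sum_distrib_left Suc.IH[symmetric] by simp
  moreover have "?X = (\<Sum>\<tau>\<in>supported n K. (if \<tau> i = j then 1 else 0) * ?d (Suc M) (peel K \<tau>))"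
    using finite_supported by (intro sum.mono_neutral_cong_left) auto
  ultimately have "Suc M * ?X + ?X = (\<Sum>\<tau>\<in>supported n K. peel K \<tau> i j * ?d (Suc M) (peel K \<tau>))
     + (\<Sum>\<tau>\<in>supported n K. (if \<tau> i = j then 1 else 0) * ?d (Suc M) (peel K \<tau>))"
    by (rule arg_cong2[where f = "(+)"])
  also have "(\<Sum>\<tau>\<in>supported n K. peel K \<tau> i j * ?d (Suc M) (peel K \<tau>))
     + (\<Sum>\<tau>\<in>supported n K. (if \<tau> i = j then 1 else 0) * ?d (Suc M) (peel K \<tau>))
     = (\<Sum>\<tau>\<in>supported n K. K i j * ?d (Suc M) (peel K \<tau>))"
    unfolding sum.distrib[symmetric]
  proof (rule sum.cong[OF refl])
    fix \<tau> assume "\<tau> \<in> supported n K"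
    then have "0 < K i (\<tau> i)" using assms by (simp add: supported_def)
    then have "peel K \<tau> i j + (if \<tau> i = j then 1 else 0) = K i j"
      by (auto simp: peel_def)
    then show "peel K \<tau> i j * ?d (Suc M) (peel K \<tau>) + (if \<tau> i = j then 1 else 0) * ?d (Suc M) (peel K \<tau>)
      = K i j * ?d (Suc M) (peel K \<tau>)" by (simp only: add_mult_distrib[symmetric])
  qed
  also have "\<dots> = K i j * ?d (Suc (Suc M)) K"
    by (simp only: card_decompositions_Suc[of n "Suc M" K] sum_distrib_left)
  finally show ?case by simp
qed

section \<open>Closed formulas under removal of a permutation\<close>

lemma permanent_le_prod_row_sums:
  fixes w :: "'a \<Rightarrow> 'b \<Rightarrow> real"
  assumes "finite I" "finite J" "\<And>i j. i \<in> I \<Longrightarrow> j \<in> J \<Longrightarrow> 0 \<le> w i j"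
  shows "permanent w I J \<le> (\<Prod>i\<in>I. \<Sum>j\<in>J. w i j)"
  using assms
proof (induction I arbitrary: J rule: finite_induct)
  case (insert i I)
  have "permanent w (insert i I) J = (\<Sum>k\<in>J. w i k * permanent w I (J - {k}))"
    using insert by (simp add: permanent_insert)
  also have "\<dots> \<le> (\<Sum>k\<in>J. w i k * (\<Prod>i\<in>I. \<Sum>j\<in>J. w i j))"
  proof (intro sum_mono mult_left_mono)
    fix k assume "k \<in> J"
    have "permanent w I (J - {k}) \<le> (\<Prod>i\<in>I. \<Sum>j\<in>J - {k}. w i j)"
      using insert.prems by (intro insert.IH) auto
    also have "\<dots> \<le> (\<Prod>i\<in>I. \<Sum>j\<in>J. w i j)"
      using insert.prems by (intro prod_mono conjI sum_nonneg sum_mono2) auto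
    finally show "permanent w I (J - {k}) \<le> (\<Prod>i\<in>I. \<Sum>j\<in>J. w i j)" .
  qed (use insert in auto)
  also have "\<dots> = (\<Prod>i\<in>insert i I. \<Sum>j\<in>J. w i j)"
    using insert by (simp add: sum_distrib_right)
  finally show ?case .
qed (simp add: permanent_empty)

lemma permanent_scale:
  "permanent (\<lambda>i j. c * w i j) I J = c ^ card I * permanent w I J"
  by (simp add: permanent_def prod.distrib sum_distrib_left)

text \<open>\<open>C_scSinkhorn\<close> times (M^M / M!)^n. For line sums M it is a product of
  multinomial coefficients, one per row: the number of M-tuples of arbitrary self-maps of {1..n}
  with count matrix \<open>K\<close>.\<close>

definition sinkhorn_value :: "nat \<Rightarrow> nat \<Rightarrow> (nat \<Rightarrow> nat \<Rightarrow> nat) \<Rightarrow> real" where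
  "sinkhorn_value n M K = fact M ^ n / (\<Prod>i\<in>{1..n}. \<Prod>j\<in>{1..n}. fact (K i j))"

text \<open>One factor 1 / M! is attached to each of the n^2 entries, which absorbs the negative
  exponent in \<open>C_Bethe\<close>.\<close>

definition bethe_factor :: "nat \<Rightarrow> nat \<Rightarrow> real" where
  "bethe_factor M k = fact (M - k) / (fact k * fact M)"

definition bethe_value :: "nat \<Rightarrow> nat \<Rightarrow> (nat \<Rightarrow> nat \<Rightarrow> nat) \<Rightarrow> real" where
  "bethe_value n M K = fact M ^ (2 * n) * (\<Prod>i\<in>{1..n}. \<Prod>j\<in>{1..n}. bethe_factor M (K i j))"

lemma sinkhorn_value_pos: "0 < sinkhorn_value n M K"
  unfolding sinkhorn_value_def by (intro divide_pos_pos prod_pos) auto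

lemma bethe_value_pos: "0 < bethe_value n M K"
  unfolding bethe_value_def bethe_factor_def by (intro mult_pos_pos prod_pos) auto

lemma sum_supported_permanent:
  fixes w :: "nat \<Rightarrow> nat \<Rightarrow> real"
  assumes "\<And>i j. K i j = 0 \<Longrightarrow> w i j = 0"
  shows "(\<Sum>\<sigma>\<in>supported n K. \<Prod>i\<in>{1..n}. w i (\<sigma> i)) = permanent w {1..n} {1..n}"
  unfolding permanent_permutes
proof (rule sum.mono_neutral_left[OF finite_perms])
  show "supported n K \<subseteq> {\<sigma>. \<sigma> permutes {1..n}}" by (auto simp: supported_def)
  show "\<forall>\<sigma>\<in>{\<sigma>. \<sigma> permutes {1..n}} - supported n K. (\<Prod>i\<in>{1..n}. w i (\<sigma> i)) = 0"
  proof
    fix \<sigma> assume "\<sigma> \<in> {\<sigma>. \<sigma> permutes {1..n}} - supported n K"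
    then obtain i where "i \<in> {1..n}" "K i (\<sigma> i) = 0" by (auto simp: supported_def)
    then show "(\<Prod>i\<in>{1..n}. w i (\<sigma> i)) = 0" using assms by (intro prod_zero bexI[of _ i]) simp_all
  qed
qed

lemma sinkhorn_value_peel:
  assumes \<sigma>: "\<sigma> \<in> supported n K"
  shows "sinkhorn_value n M (peel K \<sigma>)
    = fact M ^ n / (\<Prod>i\<in>{1..n}. \<Prod>j\<in>{1..n}. fact (K i j)) * (\<Prod>i\<in>{1..n}. real (K i (\<sigma> i)))"
proof -
  have row: "(\<Prod>j\<in>{1..n}. fact (K i j) :: real) = real (K i (\<sigma> i)) * (\<Prod>j\<in>{1..n}. fact (peel K \<sigma> i j))"
    if i: "i \<in> {1..n}" for i
  proof -
    have s: "\<sigma> i \<in> {1..n}" and k: "0 < K i (\<sigma> i)"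
      using \<sigma> i permutes_in_image[of \<sigma> "{1..n}" i] by (auto simp: supported_def)
    have "(\<Prod>j\<in>{1..n} - {\<sigma> i}. fact (K i j) :: real) = (\<Prod>j\<in>{1..n} - {\<sigma> i}. fact (peel K \<sigma> i j))"
      by (intro prod.cong) (auto simp: peel_def)
    moreover have "(fact (K i (\<sigma> i)) :: real) = real (K i (\<sigma> i)) * fact (peel K \<sigma> i (\<sigma> i))"
      using k by (simp add: peel_def fact_reduce)
    ultimately show ?thesis
      using s by (simp add: prod.remove[of "{1..n}" "\<sigma> i"] del: One_nat_def)
  qed
  have "(\<Prod>i\<in>{1..n}. \<Prod>j\<in>{1..n}. fact (K i j) :: real)
     = (\<Prod>i\<in>{1..n}. real (K i (\<sigma> i))) * (\<Prod>i\<in>{1..n}. \<Prod>j\<in>{1..n}. fact (peel K \<sigma> i j))"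
    unfolding prod.distrib[symmetric] by (rule prod.cong[OF refl]) (rule row)
  moreover have "(\<Prod>i\<in>{1..n}. real (K i (\<sigma> i))) \<noteq> 0" using \<sigma> by (auto simp: supported_def)
  ultimately show ?thesis by (simp add: sinkhorn_value_def)
qed

lemma bethe_factor_keep:
  assumes "k \<le> M"
  shows "bethe_factor M k * co_weight (real k / real (Suc M)) = bethe_factor (Suc M) k"
proof -
  obtain r where M: "M = k + r" using assms le_Suc_ex by blast
  have "co_weight (real k / real (Suc M)) = real (Suc r) / real (Suc M)"
    by (auto simp: co_weight_def M field_simps)
  then show ?thesis by (simp add: bethe_factor_def M Suc_diff_le mult_ac)
qed

lemma bethe_factor_drop:
  assumes "0 < k" "k \<le> Suc M"
  shows "bethe_factor M (k - 1) = bethe_factor (Suc M) k * (real k / real (Suc M)) * (real (Suc M))\<^sup>2"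
proof -
  obtain l where k: "k = Suc l" using assms(1) gr0_implies_Suc by blast
  show ?thesis by (simp add: bethe_factor_def k power2_eq_square del: of_nat_Suc)
qed

text \<open>A kept entry changes the formula by 1 / (1 - g), with g < 1 because its row also
  contains the positive removed entry. The removed entry contributes g times (M + 1)^2, and these
  squares are absorbed by the power of M!. Completing the denominator to all entries puts the extra
  \<open>co_weight\<close> into the numerator.\<close>

lemma bethe_value_peel:
  fixes K M
  defines "g \<equiv> \<lambda>i j. real (K i j) / real (Suc M)"
  assumes K: "line_sums n (Suc M) K" and \<sigma>: "\<sigma> \<in> supported n K"
  shows "bethe_value n M (peel K \<sigma>) = bethe_value n (Suc M) K
    * (\<Prod>i\<in>{1..n}. g i (\<sigma> i) * co_weight (g i (\<sigma> i))) / (\<Prod>i\<in>{1..n}. \<Prod>j\<in>{1..n}. co_weight (g i j))"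
proof -
  let ?m = "real (Suc M)"
  have row: "(\<Prod>j\<in>{1..n}. bethe_factor M (peel K \<sigma> i j)) * (\<Prod>j\<in>{1..n}. co_weight (g i j))
     = (\<Prod>j\<in>{1..n}. bethe_factor (Suc M) (K i j)) * (g i (\<sigma> i) * co_weight (g i (\<sigma> i))) * ?m\<^sup>2"
    if i: "i \<in> {1..n}" for i
  proof -
    have s: "\<sigma> i \<in> {1..n}" and k: "0 < K i (\<sigma> i)"
      using \<sigma> i permutes_in_image[of \<sigma> "{1..n}" i] by (auto simp: supported_def)
    have "(\<Prod>j\<in>{1..n} - {\<sigma> i}. bethe_factor M (peel K \<sigma> i j) * co_weight (g i j))
        = (\<Prod>j\<in>{1..n} - {\<sigma> i}. bethe_factor (Suc M) (K i j))"
    proof (rule prod.cong[OF refl])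
      fix j assume j: "j \<in> {1..n} - {\<sigma> i}"
      have "K i j + K i (\<sigma> i) = (\<Sum>j\<in>{j, \<sigma> i}. K i j)" using j by simp
      also have "\<dots> \<le> (\<Sum>j\<in>{1..n}. K i j)" using j s by (intro sum_mono2) auto
      also have "\<dots> = Suc M" using K i by (simp add: line_sums_def)
      finally have "K i j \<le> M" using k by simp
      then show "bethe_factor M (peel K \<sigma> i j) * co_weight (g i j) = bethe_factor (Suc M) (K i j)"
        using j bethe_factor_keep by (auto simp: peel_def g_def)
    qed
    moreover have "bethe_factor M (peel K \<sigma> i (\<sigma> i)) = bethe_factor (Suc M) (K i (\<sigma> i)) * g i (\<sigma> i) * ?m\<^sup>2"
      using bethe_factor_drop[OF k line_sums_le[OF K i s]] by (simp add: peel_def g_def)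
    ultimately show ?thesis
      using s unfolding prod.distrib[symmetric]
      by (simp add: prod.remove[of "{1..n}" "\<sigma> i"] mult_ac del: One_nat_def of_nat_Suc)
  qed
  have c0: "(\<Prod>i\<in>{1..n}. \<Prod>j\<in>{1..n}. co_weight (g i j)) \<noteq> 0"
  proof -
    have "0 < co_weight (g i j)" if "i \<in> {1..n}" "j \<in> {1..n}" for i j
      using line_sums_le[OF K that] by (intro co_weight_pos) (simp add: g_def)
    then have "0 < (\<Prod>i\<in>{1..n}. \<Prod>j\<in>{1..n}. co_weight (g i j))" by (intro prod_pos) auto
    then show ?thesis by (rule less_imp_neq[symmetric])
  qed
  have "(\<Prod>i\<in>{1..n}. \<Prod>j\<in>{1..n}. bethe_factor M (peel K \<sigma> i j)) * (\<Prod>i\<in>{1..n}. \<Prod>j\<in>{1..n}. co_weight (g i j))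
    = (\<Prod>i\<in>{1..n}. \<Prod>j\<in>{1..n}. bethe_factor (Suc M) (K i j))
      * (\<Prod>i\<in>{1..n}. g i (\<sigma> i) * co_weight (g i (\<sigma> i))) * ?m ^ (2 * n)"
  proof -
    have "(\<Prod>i\<in>{1..n}. (\<Prod>j\<in>{1..n}. bethe_factor M (peel K \<sigma> i j)) * (\<Prod>j\<in>{1..n}. co_weight (g i j)))
      = (\<Prod>i\<in>{1..n}. (\<Prod>j\<in>{1..n}. bethe_factor (Suc M) (K i j)) * (g i (\<sigma> i) * co_weight (g i (\<sigma> i))) * ?m\<^sup>2)"
      by (rule prod.cong[OF refl]) (rule row)
    moreover have "(\<Prod>i\<in>{1..n}. ?m\<^sup>2) = ?m ^ (2 * n)" by (simp add: power_mult)
    ultimately show ?thesis by (simp only: prod.distrib)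
  qed
  moreover have "(fact (Suc M) :: real) ^ (2 * n) = fact M ^ (2 * n) * ?m ^ (2 * n)"
    by (simp add: power_mult_distrib mult.commute)
  ultimately have "bethe_value n M (peel K \<sigma>) * (\<Prod>i\<in>{1..n}. \<Prod>j\<in>{1..n}. co_weight (g i j))
    = bethe_value n (Suc M) K * (\<Prod>i\<in>{1..n}. g i (\<sigma> i) * co_weight (g i (\<sigma> i)))"
    unfolding bethe_value_def by (simp only: mult.assoc) (simp only: mult_ac)
  then show ?thesis using c0 by (simp only: nonzero_eq_divide_eq not_False_eq_True)
qed

lemma line_sums_stochastic:
  fixes K M
  defines "g \<equiv> \<lambda>i j. real (K i j) / real (Suc M)"
  assumes K: "line_sums n (Suc M) K"
  shows "\<And>i j. 0 \<le> g i j" and "\<And>i. i \<in> {1..n} \<Longrightarrow> (\<Sum>j\<in>{1..n}. g i j) = 1"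
    and "\<And>j. j \<in> {1..n} \<Longrightarrow> (\<Sum>i\<in>{1..n}. g i j) = 1"
  using K unfolding g_def line_sums_def
  by (simp_all add: sum_divide_distrib[symmetric] of_nat_sum[symmetric] del: of_nat_sum of_nat_Suc)

lemma line_sums_1_le: "line_sums n 1 K \<Longrightarrow> i \<in> {1..n} \<Longrightarrow> j \<in> {1..n} \<Longrightarrow> K i j = 0 \<or> K i j = 1"
  using line_sums_le[of n 1 K i j] by linarith

lemma sinkhorn_value_1: "line_sums n 1 K \<Longrightarrow> sinkhorn_value n 1 K = 1"
proof -
  assume K: "line_sums n 1 K"
  have "(\<Prod>i\<in>{1..n}. \<Prod>j\<in>{1..n}. fact (K i j) :: real) = 1"
    by (intro prod.neutral ballI) (use line_sums_1_le[OF K] in fastforce)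
  then show ?thesis by (simp add: sinkhorn_value_def)
qed

lemma bethe_value_1: "line_sums n 1 K \<Longrightarrow> bethe_value n 1 K = 1"
proof -
  assume K: "line_sums n 1 K"
  have "(\<Prod>i\<in>{1..n}. \<Prod>j\<in>{1..n}. bethe_factor 1 (K i j)) = 1"
    by (intro prod.neutral ballI) (use line_sums_1_le[OF K] in \<open>fastforce simp: bethe_factor_def\<close>)
  then show ?thesis by (simp add: bethe_value_def)
qed

section \<open>The four bounds for integer matrices\<close>

lemma card_decompositions_le_sinkhorn:
  "line_sums n M K \<Longrightarrow> real (card (decompositions n M K)) \<le> sinkhorn_value n M K"
proof (induction M arbitrary: K)
  case 0
  have "(\<Prod>i\<in>{1..n}. \<Prod>j\<in>{1..n}. fact (K i j) :: real) = 1"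
    by (intro prod.neutral ballI) (use line_sums_le[OF 0] in fastforce)
  then show ?case by (simp add: sinkhorn_value_def decompositions_0)
next
  case (Suc M)
  let ?c = "fact M ^ n / (\<Prod>i\<in>{1..n}. \<Prod>j\<in>{1..n}. fact (K i j)) :: real"
  have "real (card (decompositions n (Suc M) K))
    = (\<Sum>\<sigma>\<in>supported n K. real (card (decompositions n M (peel K \<sigma>))))"
    by (simp add: card_decompositions_Suc)
  also have "\<dots> \<le> (\<Sum>\<sigma>\<in>supported n K. sinkhorn_value n M (peel K \<sigma>))"
    by (intro sum_mono Suc.IH line_sums_peel[OF Suc.prems])
  also have "\<dots> = ?c * (\<Sum>\<sigma>\<in>supported n K. \<Prod>i\<in>{1..n}. real (K i (\<sigma> i)))"
    unfolding sum_distrib_left by (rule sum.cong[OF refl]) (rule sinkhorn_value_peel)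
  also have "\<dots> = ?c * permanent (\<lambda>i j. real (K i j)) {1..n} {1..n}"
    by (subst sum_supported_permanent) auto
  also have "\<dots> \<le> ?c * (\<Prod>i\<in>{1..n}. \<Sum>j\<in>{1..n}. real (K i j))"
    by (intro mult_left_mono permanent_le_prod_row_sums divide_nonneg_nonneg prod_nonneg) auto
  also have "(\<Prod>i\<in>{1..n}. \<Sum>j\<in>{1..n}. real (K i j)) = (\<Prod>i\<in>{1..n}. real (Suc M))"
    using Suc.prems by (intro prod.cong) (auto simp: line_sums_def of_nat_sum[symmetric] simp del: of_nat_sum of_nat_Suc)
  also have "?c * \<dots> = sinkhorn_value n (Suc M) K"
    by (simp add: sinkhorn_value_def power_mult_distrib mult.commute del: of_nat_Suc)
  finally show ?case .
qed

lemma bethe_le_card_decompositions: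
  "line_sums n M K \<Longrightarrow> bethe_value n M K \<le> real (card (decompositions n M K))"
proof (induction M arbitrary: K)
  case 0
  have K0: "K i j = 0" if "i \<in> {1..n}" "j \<in> {1..n}" for i j using line_sums_le[OF 0 that] by simp
  have "(\<Prod>i\<in>{1..n}. \<Prod>j\<in>{1..n}. bethe_factor 0 (K i j)) = 1"
    by (intro prod.neutral ballI) (simp add: K0 bethe_factor_def)
  then show ?case using K0 by (simp add: bethe_value_def decompositions_0)
next
  case (Suc M)
  define g where "g i j = real (K i j) / real (Suc M)" for i j
  let ?P = "\<Prod>i\<in>{1..n}. \<Prod>j\<in>{1..n}. co_weight (g i j)"
  note st = line_sums_stochastic[OF Suc.prems, folded g_def]
  have "g i j \<le> 1" if "i \<in> {1..n}" "j \<in> {1..n}" for i j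
    using line_sums_le[OF Suc.prems that] by (simp add: g_def)
  then have P: "0 < ?P" by (intro prod_pos ballI co_weight_pos)
  have "?P \<le> permanent (\<lambda>i j. g i j * co_weight (g i j)) {1..n} {1..n}"
    by (rule schrijver_inequality) (use st in auto)
  then have "bethe_value n (Suc M) K \<le> bethe_value n (Suc M) K / ?P * permanent (\<lambda>i j. g i j * co_weight (g i j)) {1..n} {1..n}"
    using P bethe_value_pos[of n "Suc M" K] by (simp add: field_simps)
  also have "\<dots> = (\<Sum>\<sigma>\<in>supported n K. bethe_value n (Suc M) K / ?P * (\<Prod>i\<in>{1..n}. g i (\<sigma> i) * co_weight (g i (\<sigma> i))))"
    unfolding sum_distrib_left[symmetric] by (subst sum_supported_permanent) (auto simp: g_def)
  also have "\<dots> = (\<Sum>\<sigma>\<in>supported n K. bethe_value n M (peel K \<sigma>))"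
    by (rule sum.cong[OF refl]) (simp add: bethe_value_peel[OF Suc.prems, folded g_def])
  also have "\<dots> \<le> (\<Sum>\<sigma>\<in>supported n K. real (card (decompositions n M (peel K \<sigma>))))"
    by (intro sum_mono Suc.IH line_sums_peel[OF Suc.prems])
  also have "\<dots> = real (card (decompositions n (Suc M) K))"
    by (simp add: card_decompositions_Suc)
  finally show ?case .
qed

text \<open>Stated for \<open>Suc M\<close> so that the induction starts at a single permutation,
  where the count is at most 1 and the Bethe value is 1; only the other M removals cost a
  factor.\<close>

lemma card_decompositions_le_bethe:
  "line_sums n (Suc M) K \<Longrightarrow> real (card (decompositions n (Suc M) K))
    \<le> exp (real n * (ln 2 / 2)) ^ M * bethe_value n (Suc M) K"
proof (induction M arbitrary: K)
  case 0
  then show ?case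
    using card_decompositions_le_sinkhorn[OF 0] sinkhorn_value_1[of n K] bethe_value_1[of n K] by simp
next
  case (Suc M)
  define g where "g i j = real (K i j) / real (Suc (Suc M))" for i j
  let ?E = "exp (real n * (ln 2 / 2))"
  let ?N = "real (card (decompositions n (Suc (Suc M)) K))"
  let ?d = "\<lambda>\<sigma>. real (card (decompositions n (Suc M) (peel K \<sigma>)))"
  define F where "F \<sigma> = (if \<sigma> \<in> supported n K then ?d \<sigma> else 0)" for \<sigma>
  note st = line_sums_stochastic[OF Suc.prems, folded g_def]
  have supp: "supported n K \<subseteq> {\<sigma>. \<sigma> permutes {1..n}}" by (auto simp: supported_def)
  show ?case
  proof (cases "?N = 0")
    case True
    then show ?thesis using bethe_value_pos[of n "Suc (Suc M)" K] by simp
  next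
    case False
    have "?N \<le> (?E ^ M * bethe_value n (Suc (Suc M)) K) * exp (real (card {1..n}) * (ln 2 / 2))"
    proof (rule entropy_count_bound[where g = g and F = F])
      show "(\<Sum>\<sigma>\<in>{\<sigma>. \<sigma> permutes {1..n}}. F \<sigma>) = ?N"
        unfolding F_def using finite_perms supp
        by (subst sum.inter_restrict[symmetric]) (auto simp: card_decompositions_Suc[of n "Suc M"] Int_absorb1)
      show "0 < ?N" using False by linarith
      show "0 < ?E ^ M * bethe_value n (Suc (Suc M)) K" by (simp add: bethe_value_pos)
      show "F \<sigma> \<le> ?E ^ M * bethe_value n (Suc (Suc M)) K * (\<Prod>i\<in>{1..n}. g i (\<sigma> i) * co_weight (g i (\<sigma> i)))
          / (\<Prod>i\<in>{1..n}. \<Prod>j\<in>{1..n}. co_weight (g i j))" if "0 < F \<sigma>" for \<sigma>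
      proof -
        have s: "\<sigma> \<in> supported n K" using that by (auto simp: F_def split: if_splits)
        then have "F \<sigma> \<le> ?E ^ M * bethe_value n (Suc M) (peel K \<sigma>)"
          using Suc.IH[OF line_sums_peel[OF Suc.prems s]] by (simp add: F_def)
        then show ?thesis
          unfolding bethe_value_peel[OF Suc.prems s, folded g_def] by (simp add: mult.assoc)
      qed
      fix i j assume ij: "i \<in> {1..n}" "j \<in> {1..n}"
      have "(\<Sum>\<sigma>\<in>{\<sigma>. \<sigma> permutes {1..n} \<and> \<sigma> i = j}. F \<sigma>) = (\<Sum>\<sigma>\<in>{\<sigma>\<in>supported n K. \<sigma> i = j}. ?d \<sigma>)"
        using supp finite_perms[of n] by (intro sum.mono_neutral_cong_right) (auto simp: F_def)
      moreover have "real (Suc (Suc M)) * (\<Sum>\<sigma>\<in>{\<sigma>\<in>supported n K. \<sigma> i = j}. ?d \<sigma>) = real (K i j) * ?N"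
        using arg_cong[OF card_decompositions_marginal[OF ij, of "Suc M" K], of real]
        by (simp only: of_nat_mult of_nat_sum)
      ultimately show "(\<Sum>\<sigma>\<in>{\<sigma>. \<sigma> permutes {1..n} \<and> \<sigma> i = j}. F \<sigma>) = g i j * ?N"
        by (simp add: g_def field_simps del: of_nat_Suc)
    qed (use st in \<open>auto simp: F_def\<close>)
    then show ?thesis by (simp add: mult_ac)
  qed
qed

lemma sinkhorn_le_card_decompositions:
  "line_sums n (Suc M) K \<Longrightarrow> (fact n / real n ^ n) ^ M * sinkhorn_value n (Suc M) K
    \<le> real (card (decompositions n (Suc M) K))"
proof (induction M arbitrary: K)
  case 0
  \<comment> \<open>Existence of a decomposition of a permutation matrix is borrowed from the lower
    Bethe bound, whose value is 1 here.\<close>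
  then show ?case
    using bethe_le_card_decompositions[OF 0] sinkhorn_value_1[of n K] bethe_value_1[of n K] by simp
next
  case (Suc M)
  define g where "g i j = real (K i j) / real (Suc (Suc M))" for i j
  let ?v = "fact n / real n ^ n"
  let ?m = "real (Suc (Suc M))"
  let ?c = "fact (Suc M) ^ n / (\<Prod>i\<in>{1..n}. \<Prod>j\<in>{1..n}. fact (K i j)) :: real"
  note st = line_sums_stochastic[OF Suc.prems, folded g_def]
  have "?v \<le> permanent g {1..n} {1..n}"
    by (rule van_der_waerden_permanent) (use st in auto)
  then have "?m ^ n * ?v \<le> ?m ^ n * permanent g {1..n} {1..n}" by (rule mult_left_mono) simp
  also have "?m ^ n * permanent g {1..n} {1..n} = permanent (\<lambda>i j. real (K i j)) {1..n} {1..n}"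
  proof -
    have "(\<lambda>i j. real (K i j)) = (\<lambda>i j. ?m * g i j)" by (simp add: g_def fun_eq_iff del: of_nat_Suc)
    then show ?thesis using permanent_scale[of ?m g "{1..n}" "{1..n}"] by simp
  qed
  finally have perm: "?m ^ n * ?v \<le> permanent (\<lambda>i j. real (K i j)) {1..n} {1..n}" .
  have "sinkhorn_value n (Suc (Suc M)) K = ?c * ?m ^ n"
    unfolding sinkhorn_value_def fact_Suc[of "Suc M"] by (simp add: power_mult_distrib del: of_nat_Suc fact_Suc)
  then have "?v ^ Suc M * sinkhorn_value n (Suc (Suc M)) K = ?v ^ M * ?c * (?m ^ n * ?v)"
    by (simp add: mult_ac del: of_nat_Suc fact_Suc)
  also have "\<dots> \<le> ?v ^ M * ?c * permanent (\<lambda>i j. real (K i j)) {1..n} {1..n}"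
    by (intro mult_left_mono perm mult_nonneg_nonneg divide_nonneg_nonneg prod_nonneg zero_le_power) auto
  also have "permanent (\<lambda>i j. real (K i j)) {1..n} {1..n} = (\<Sum>\<sigma>\<in>supported n K. \<Prod>i\<in>{1..n}. real (K i (\<sigma> i)))"
    by (subst sum_supported_permanent) auto
  also have "?v ^ M * ?c * \<dots> = (\<Sum>\<sigma>\<in>supported n K. ?v ^ M * sinkhorn_value n (Suc M) (peel K \<sigma>))"
    unfolding sum_distrib_left by (rule sum.cong[OF refl]) (simp only: sinkhorn_value_peel mult.assoc)
  also have "\<dots> \<le> (\<Sum>\<sigma>\<in>supported n K. real (card (decompositions n (Suc M) (peel K \<sigma>))))"
    by (intro sum_mono Suc.IH line_sums_peel[OF Suc.prems])
  also have "\<dots> = real (card (decompositions n (Suc (Suc M)) K))"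
    by (simp add: card_decompositions_Suc[of n "Suc M"])
  finally show ?case .
qed

section \<open>Translation between \<gamma> and the integer matrix M \<gamma>\<close>

theorem theorem3:
  fixes n M :: nat and \<gamma> :: "nat \<Rightarrow> nat \<Rightarrow> real"
  assumes "n \<ge> 1" and "M \<ge> 1" and "\<gamma> \<in> Gamma_set M n"
  shows "1 \<le> real (C_coeff M n \<gamma>) / C_Bethe M n \<gamma>
    \<and> real (C_coeff M n \<gamma>) / C_Bethe M n \<gamma> \<le> (2 powr (real n / 2)) ^ (M - 1)
    \<and> (real M ^ M / fact M) ^ n * (fact n / real n ^ n) ^ (M - 1)
        \<le> real (C_coeff M n \<gamma>) / C_scSinkhorn M n \<gamma>
    \<and> real (C_coeff M n \<gamma>) / C_scSinkhorn M n \<gamma> \<le> (real M ^ M / fact M) ^ n"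
proof -
  define K where "K i j = nat \<lfloor>real M * \<gamma> i j\<rfloor>" for i j
  have ds: "doubly_stochastic n \<gamma>" using assms(3) by (simp add: Gamma_set_def)
  have K: "real (K i j) = real M * \<gamma> i j" if "i \<in> {1..n}" "j \<in> {1..n}" for i j
  proof -
    obtain k :: int where "\<gamma> i j = of_int k * (1 / real M)"
      using assms(3) \<open>i \<in> {1..n}\<close> \<open>j \<in> {1..n}\<close> unfolding Gamma_set_def by blast
    then have k: "real M * \<gamma> i j = of_int k" using assms(2) by simp
    moreover have "0 \<le> real M * \<gamma> i j" using ds that by (simp add: doubly_stochastic_def)
    ultimately show ?thesis by (simp add: K_def)
  qed
  have lines: "line_sums n M K"
  proof -
    have "real (\<Sum>j\<in>{1..n}. K i j) = real M" if i: "i \<in> {1..n}" for i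
    proof -
      have "real (\<Sum>j\<in>{1..n}. K i j) = (\<Sum>j\<in>{1..n}. real M * \<gamma> i j)"
        unfolding of_nat_sum by (rule sum.cong[OF refl]) (rule K[OF i])
      then show ?thesis using ds i by (simp add: doubly_stochastic_def sum_distrib_left[symmetric])
    qed
    moreover have "real (\<Sum>i\<in>{1..n}. K i j) = real M" if j: "j \<in> {1..n}" for j
    proof -
      have "real (\<Sum>i\<in>{1..n}. K i j) = (\<Sum>i\<in>{1..n}. real M * \<gamma> i j)"
        unfolding of_nat_sum by (rule sum.cong[OF refl]) (rule K[OF _ j])
      then show ?thesis using ds j by (simp add: doubly_stochastic_def sum_distrib_left[symmetric])
    qed
    ultimately show ?thesis unfolding line_sums_def of_nat_eq_iff by blast
  qed
  have C: "C_coeff M n \<gamma> = card (decompositions n M K)"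
  proof -
    have "\<gamma> i j = 1 / real M * (\<Sum>m\<in>{1..M}. perm_matrix (s m) i j)
      \<longleftrightarrow> K i j = (\<Sum>m\<in>{1..M}. if s m i = j then 1 else 0)" if "i \<in> {1..n}" "j \<in> {1..n}" for s :: "nat \<Rightarrow> nat \<Rightarrow> nat" and i j
    proof -
      have "(\<Sum>m\<in>{1..M}. perm_matrix (s m) i j) = real (\<Sum>m\<in>{1..M}. if s m i = j then 1 else 0)"
        unfolding of_nat_sum by (rule sum.cong[OF refl]) (simp add: perm_matrix_def)
      moreover have "\<gamma> i j = 1 / real M * x \<longleftrightarrow> real (K i j) = x" for x
        using K[OF that] assms(2) by (auto simp: field_simps)
      ultimately show ?thesis by (simp only: of_nat_eq_iff)
    qed
    then show ?thesis unfolding C_coeff_def decompositions_def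
      by (intro arg_cong[where f = card] Collect_cong conj_cong refl ball_cong) blast
  qed
  have KM: "nat \<lfloor>real M - real M * \<gamma> i j\<rfloor> = M - K i j" if "i \<in> {1..n}" "j \<in> {1..n}" for i j
  proof -
    have "real M - real M * \<gamma> i j = real (M - K i j)"
      using K[OF that] line_sums_le[OF lines that] by (simp add: of_nat_diff)
    then show ?thesis by simp
  qed
  have B: "C_Bethe M n \<gamma> = bethe_value n M K"
  proof -
    have "(\<Prod>i\<in>{1..n}. \<Prod>j\<in>{1..n}. fact (nat \<lfloor>real M - real M * \<gamma> i j\<rfloor>) / fact (nat \<lfloor>real M * \<gamma> i j\<rfloor>) :: real)
       = (\<Prod>i\<in>{1..n}. \<Prod>j\<in>{1..n}. bethe_factor M (K i j) * fact M)"
    proof (intro prod.cong refl)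
      fix i j assume "i \<in> {1..n}" "j \<in> {1..n}"
      then show "fact (nat \<lfloor>real M - real M * \<gamma> i j\<rfloor>) / fact (nat \<lfloor>real M * \<gamma> i j\<rfloor>) = bethe_factor M (K i j) * fact M"
        unfolding KM[OF \<open>i \<in> {1..n}\<close> \<open>j \<in> {1..n}\<close>] K_def[symmetric] by (simp add: bethe_factor_def)
    qed
    also have "\<dots> = (\<Prod>i\<in>{1..n}. \<Prod>j\<in>{1..n}. bethe_factor M (K i j)) * fact M ^ (n * n)"
      by (simp add: prod.distrib power_mult)
    finally have "C_Bethe M n \<gamma> = (fact M powi (2 * int n - (int n)\<^sup>2) * fact M ^ (n * n))
        * (\<Prod>i\<in>{1..n}. \<Prod>j\<in>{1..n}. bethe_factor M (K i j))"
      by (simp add: C_Bethe_def mult_ac)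
    \<comment> \<open>The n^2 factors M! split off from the entries cancel the negative part of the
      exponent 2 n - n^2.\<close>
    also have "(fact M :: real) ^ (n * n) = fact M powi ((int n)\<^sup>2)"
      by (simp add: power2_eq_square power_int_of_nat[symmetric])
    also have "(fact M :: real) powi (2 * int n - (int n)\<^sup>2) * fact M powi ((int n)\<^sup>2) = fact M powi (2 * int n)"
      by (subst power_int_add[symmetric]) auto
    also have "(fact M :: real) powi (2 * int n) = fact M ^ (2 * n)"
      using power_int_of_nat[of "fact M :: real" "2 * n"] by simp
    finally show ?thesis by (simp add: bethe_value_def)
  qed
  have S: "C_scSinkhorn M n \<gamma> = sinkhorn_value n M K / (real M ^ M / fact M) ^ n"
  proof -
    have "real M powi (- (int n * int M)) = 1 / real M ^ (M * n)"
      using power_int_of_nat[of "real M" "n * M"] by (simp add: power_int_minus divide_inverse mult.commute)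
    then show ?thesis
      unfolding C_scSinkhorn_def sinkhorn_value_def K_def
      by (simp add: power_divide power_mult mult_2 power_add)
  qed
  obtain m where m: "M = Suc m" using assms(2) not0_implies_Suc by (metis not_one_le_zero)
  let ?q = "(real M ^ M / fact M) ^ n"
  have q: "0 < ?q" using assms(2) by simp
  have E: "(2::real) powr (real n / 2) = exp (real n * (ln 2 / 2))"
    by (simp add: powr_def)
  have ratio: "real (C_coeff M n \<gamma>) / C_scSinkhorn M n \<gamma>
      = ?q * (real (card (decompositions n M K)) / sinkhorn_value n M K)"
    unfolding C S using q by (simp add: field_simps)
  have "(fact n / real n ^ n) ^ (M - 1) \<le> real (card (decompositions n M K)) / sinkhorn_value n M K"
    using sinkhorn_le_card_decompositions[of n m K] lines sinkhorn_value_pos[of n M K] m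
    by (simp add: pos_le_divide_eq)
  moreover have "real (card (decompositions n M K)) / sinkhorn_value n M K \<le> 1"
    using card_decompositions_le_sinkhorn[OF lines] sinkhorn_value_pos[of n M K]
    by (simp add: pos_divide_le_eq)
  moreover have "1 \<le> real (C_coeff M n \<gamma>) / C_Bethe M n \<gamma>"
    unfolding B C using bethe_le_card_decompositions[OF lines] bethe_value_pos[of n M K]
    by (simp add: pos_le_divide_eq)
  moreover have "real (C_coeff M n \<gamma>) / C_Bethe M n \<gamma> \<le> (2 powr (real n / 2)) ^ (M - 1)"
    unfolding B C E using card_decompositions_le_bethe[of n m K] lines bethe_value_pos[of n M K] m
    by (simp add: pos_divide_le_eq)
  ultimately show ?thesis
    unfolding ratio using q mult_left_mono[OF _ less_imp_le[OF q]] by fastforce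
qed

end
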